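(* Let $d,n\in\mathbb{N}$, let $\mathbb{S}\subset\mathbb{R}^n$ be the unit sphere, let $\mu\ge 0$ be a finite Borel measure on $\mathbb{S}$, let $\nu\ge 0$ be a Borel measure on $\mathbb{R}^n$ with $\nu(\{0\})=0$ and $\int_{\mathbb{R}^n}\min(|z|^2,1)\,\nu(dz)<\infty$, and let $\gamma\in\mathbb{R}^n$. Let $\phi:\mathbb{R}^n\to\mathbb{C}$ and $\varphi:\mathbb{S}\to\mathbb{C}$ be Borel functions with $\|\phi\|_\infty\le 1$ and $\|\varphi\|_\infty\le 1$. For $\zeta\in\mathbb{R}^n$ define $$\Psi(\zeta)=\int_{\mathbb{R}^n}\left(e^{i(\zeta,z)}-1-i(\zeta,z)1_{|z|\le 1}\right)\nu(dz)-\frac12\int_{\mathbb{S}}(\zeta,\theta)^2\,\mu(d\theta)+i(\zeta,\gamma),$$ $$\widetilde\Psi(\zeta)=\int_{\mathbb{R}^n}\left(e^{i(\zeta,z)}-1-i(\zeta,z)1_{|z|\le 1}\right)\phi(z)\,\nu(dz)-\frac12\int_{\mathbb{S}}(\zeta,\theta)^2\varphi(\theta)\,\mu(d\theta).$$ Let $A,B\in\mathbb{R}^{d\times n}$ and, for $\xi\in\mathbb{R}^d$, let $$m(\xi)=e^{\Psi(B^T\xi)+\Psi(-A^T\xi)}\left[\widetilde\Psi(B^T\xi-A^T\xi)-\widetilde\Psi(B^T\xi)-\widetilde\Psi(-A^T\xi)\right]\,q\!\left(\Psi(B^T\xi-A^T\xi)-\Psi(B^T\xi)-\Psi(-A^T\xi)\right),$$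 where $q(z)=(e^z-1)/z$ for $z\in\mathbb{C}\setminus\{0\}$ and $q(0)=1$. Let $M$ be the Fourier multiplier on $\mathbb{R}^d$ with symbol $m$, i.e. $\widehat{Mf}=m\hat f$. Then for every $1<p<\infty$, $$\|M\|_p\le p^*-1:=\max\left\{p-1,\frac{1}{p-1}\right\}.$$
   Context: Here $(\xi,\eta)=\sum_k\xi_k\eta_k$ and $|\xi|^2=\sum_k|\xi_k|^2$. The Fourier transform is $\hat f(\xi)=\int_{\mathbb{R}^d}e^{i(\xi,x)}f(x)\,dx$. For the multiplier $M$ with symbol $m$ one puts, for complex-valued $f,g\in C_c^\infty(\mathbb{R}^d)$, $$\Lambda(f,g)=\int_{\mathbb{R}^d}Mf(x)\,g(x)\,dx=(2\pi)^{-d}\int_{\mathbb{R}^d}m(\xi)\hat f(\xi)\hat g(-\xi)\,d\xi .$$ $\|M\|_p$ denotes the operator norm of $M$ on $L^p(\mathbb{R}^d)$, i.e. the smallest constant such that $|\Lambda(f,g)|\le\|M\|_p\|f\|_p\|g\|_q$ for all $f,g\in C_c^\infty(\mathbb{R}^d)$, where in this inequality $q=p/(p-1)$ is the conjugate exponent (not the function $q(\cdot)$ used to define $m$). *)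

theory Defs
  imports "HOL-Analysis.Analysis"
begin

section \<open>Test functions\<close>

primrec C_k :: "nat \<Rightarrow> ('a::euclidean_space \<Rightarrow> 'b::real_normed_vector) \<Rightarrow> bool" where
  "C_k 0 f \<longleftrightarrow> continuous_on UNIV f"
| "C_k (Suc k) f \<longleftrightarrow>
     (\<forall>x. f differentiable (at x)) \<and> (\<forall>v. C_k k (\<lambda>x. frechet_derivative f (at x) v))"

definition test_function :: "('a::euclidean_space \<Rightarrow> complex) \<Rightarrow> bool" where
  "test_function f \<longleftrightarrow> (\<forall>k. C_k k f) \<and> compact (closure {x. f x \<noteq> 0})"

lemma test_function_continuous: "test_function f \<Longrightarrow> continuous_on UNIV f"
  unfolding test_function_def using C_k.simps(1) by blast

lemma test_function_integrable:
  assumes "test_function f"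
  shows "integrable lborel f"
proof -
  let ?K = "closure {x. f x \<noteq> 0}"
  have K: "compact ?K" and c: "continuous_on ?K f"
    using assms continuous_on_subset[OF test_function_continuous[OF assms]]
    unfolding test_function_def by blast+
  have "integrable lborel (\<lambda>x. indicator ?K x *\<^sub>R f x)"
    by (rule borel_integrable_compact[OF K c])
  moreover have "(\<lambda>x. indicator ?K x *\<^sub>R f x) = f"
    using closure_subset[of "{x. f x \<noteq> 0}"] by (auto simp: indicator_def fun_eq_iff)
  ultimately show ?thesis by simp
qed

section \<open>Fourier multipliers and their operator norms\<close>

definition fourier :: "('a::euclidean_space \<Rightarrow> complex) \<Rightarrow> 'a \<Rightarrow> complex" where
  "fourier f \<xi> = (LINT x|lborel. exp (\<i> * complex_of_real (\<xi> \<bullet> x)) * f x)"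

text \<open>
  The operator \<open>M\<close> with \<open>(Mf)^ = m f^\<close>, by Fourier inversion; it is meaningful for those \<open>f\<close>
  for which \<open>m f^\<close> is integrable, hence for every test function if \<open>m\<close> is bounded and measurable.
\<close>

definition fourier_multiplier ::
  "('a::euclidean_space \<Rightarrow> complex) \<Rightarrow> ('a \<Rightarrow> complex) \<Rightarrow> 'a \<Rightarrow> complex" where
  "fourier_multiplier m f x =
     (LINT \<xi>|lborel. exp (- \<i> * complex_of_real (\<xi> \<bullet> x)) * (m \<xi> * fourier f \<xi>))
       / complex_of_real ((2 * pi) ^ DIM('a))"

definition dual_form ::
  "(('a::euclidean_space \<Rightarrow> complex) \<Rightarrow> 'a \<Rightarrow> complex) \<Rightarrow> ('a \<Rightarrow> complex) \<Rightarrow> ('a \<Rightarrow> complex) \<Rightarrow> complex"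
  where "dual_form M f g = (LINT x|lborel. M f x * g x)"

lemma dual_form_fourier_multiplier:
  fixes m f g :: "'a::euclidean_space \<Rightarrow> complex"
  assumes int: "integrable lborel (\<lambda>\<xi>. m \<xi> * fourier f \<xi>)" and g: "test_function g"
  shows "dual_form (fourier_multiplier m) f g =
    (LINT \<xi>|lborel. m \<xi> * fourier f \<xi> * fourier g (- \<xi>)) / complex_of_real ((2 * pi) ^ DIM('a))"
proof -
  let ?c = "complex_of_real ((2 * pi) ^ DIM('a))"
  let ?h = "\<lambda>\<xi>. m \<xi> * fourier f \<xi>"
  let ?F = "\<lambda>x \<xi>. exp (- \<i> * complex_of_real (\<xi> \<bullet> x)) * (?h \<xi> * g x)"

  have ig: "integrable lborel g" by (rule test_function_integrable[OF g])
  have [measurable]: "?h \<in> borel_measurable borel" "g \<in> borel_measurable borel"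
    using borel_measurable_integrable[OF int] borel_measurable_integrable[OF ig] by simp_all
  have prod: "integrable (lborel \<Otimes>\<^sub>M lborel) (\<lambda>(x, \<xi>). ?F x \<xi>)"
  proof (rule lborel_pair.Fubini_integrable)
    show "(\<lambda>(x, \<xi>). ?F x \<xi>) \<in> borel_measurable (lborel \<Otimes>\<^sub>M lborel)" by measurable
    have "integrable lborel (\<lambda>x. (LINT \<xi>|lborel. norm (?h \<xi>)) * norm (g x))"
      using ig by (intro integrable_mult_right integrable_norm)
    then show "integrable lborel (\<lambda>x. LINT \<xi>|lborel. norm (case (x, \<xi>) of (x, \<xi>) \<Rightarrow> ?F x \<xi>))"
      by (simp add: norm_mult mult.assoc flip: integral_mult_left_zero)
    show "AE x in lborel. integrable lborel (\<lambda>\<xi>. case (x, \<xi>) of (x, \<xi>) \<Rightarrow> ?F x \<xi>)"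
    proof (rule AE_I2)
      fix x
      show "integrable lborel (\<lambda>\<xi>. case (x, \<xi>) of (x, \<xi>) \<Rightarrow> ?F x \<xi>)"
        by (rule Bochner_Integration.integrable_bound[OF integrable_mult_left[OF int, of "g x"]])
           (auto simp: norm_mult)
    qed
  qed
  have "dual_form (fourier_multiplier m) f g = (LINT x|lborel. (LINT \<xi>|lborel. ?F x \<xi>) / ?c)"
    unfolding dual_form_def fourier_multiplier_def
    by (intro Bochner_Integration.integral_cong refl)
       (simp add: mult.assoc flip: integral_mult_left_zero)
  also have "\<dots> = (LINT x|lborel. (LINT \<xi>|lborel. ?F x \<xi>)) / ?c" by simp
  also have "(LINT x|lborel. (LINT \<xi>|lborel. ?F x \<xi>)) = (LINT \<xi>|lborel. (LINT x|lborel. ?F x \<xi>))"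
    by (rule lborel_pair.Fubini_integral[OF prod, symmetric])
  also have "\<dots> = (LINT \<xi>|lborel. ?h \<xi> * fourier g (- \<xi>))"
    unfolding fourier_def[of g]
    by (intro Bochner_Integration.integral_cong refl)
       (simp add: mult_ac flip: integral_mult_right_zero)
  finally show ?thesis by simp
qed

definition Lp_norm :: "real \<Rightarrow> ('a::euclidean_space \<Rightarrow> complex) \<Rightarrow> real" where
  "Lp_norm p f = (LINT x|lborel. cmod (f x) powr p) powr (1 / p)"

text \<open>The infimum is taken in \<^typ>\<open>ennreal\<close>, so that it is \<open>\<infinity>\<close> for an unbounded operator.\<close>

definition Lp_operator_norm ::
  "real \<Rightarrow> (('a::euclidean_space \<Rightarrow> complex) \<Rightarrow> 'a \<Rightarrow> complex) \<Rightarrow> ennreal" where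
  "Lp_operator_norm p M =
     Inf {C. \<forall>f g. test_function f \<longrightarrow> test_function g \<longrightarrow>
       ennreal (cmod (dual_form M f g))
         \<le> C * ennreal (Lp_norm p f) * ennreal (Lp_norm (p / (p - 1)) g)}"

section \<open>Levy-Khintchine exponents\<close>

definition levy_kernel :: "'a::euclidean_space \<Rightarrow> 'a \<Rightarrow> complex" where
  "levy_kernel \<zeta> z = exp (\<i> * complex_of_real (\<zeta> \<bullet> z)) - 1
     - \<i> * complex_of_real (\<zeta> \<bullet> z) * indicator {z. norm z \<le> 1} z"

definition levy_exponent ::
  "'a::euclidean_space measure \<Rightarrow> 'a measure \<Rightarrow> 'a \<Rightarrow> 'a \<Rightarrow> complex" where
  "levy_exponent \<nu> \<mu> \<gamma> \<zeta> =
     (LINT z|\<nu>. levy_kernel \<zeta> z)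
       - 1 / 2 * (LINT \<theta>|\<mu>. complex_of_real ((\<zeta> \<bullet> \<theta>)\<^sup>2))
       + \<i> * complex_of_real (\<zeta> \<bullet> \<gamma>)"

definition modulated_exponent ::
  "'a::euclidean_space measure \<Rightarrow> 'a measure \<Rightarrow> ('a \<Rightarrow> complex) \<Rightarrow> ('a \<Rightarrow> complex) \<Rightarrow> 'a \<Rightarrow> complex"
  where
  "modulated_exponent \<nu> \<mu> \<phi> \<phi>' \<zeta> =
     (LINT z|\<nu>. levy_kernel \<zeta> z * \<phi> z)
       - 1 / 2 * (LINT \<theta>|\<mu>. complex_of_real ((\<zeta> \<bullet> \<theta>)\<^sup>2) * \<phi>' \<theta>)"

definition exp_quotient :: "complex \<Rightarrow> complex" where
  "exp_quotient z = (if z = 0 then 1 else (exp z - 1) / z)"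

end

(*
  The symbol m is the limit of symbols of martingale transforms that come from products of
  two-point laws: X_1 is approximated by a sum of independent jumps, taken one at a time, so that
  each step of the transform multiplies one martingale difference of f(x + A X_1) by a
  constant of modulus at most 1.  For these finite transforms Burkholder's special function, whose
  concavity follows from that of the slices in Osekowski's integral representation, gives the
  constant p - 1 for p >= 2 by induction on the number of jumps; Young's inequality and
  integration over x yield the bilinear estimate, and Parseval's formula identifies its symbol.
  The symbols stay bounded by 1, hence the estimate passes to pointwise limits: from cycles of
  small jumps to finite jump measures, then to finite Levy triples, then to all of them.
  For p < 2 one exchanges f with g and A with B.
*)
theory Submission
  imports Defs "HOL-Probability.Probability"
begin

section \<open>Burkholder's function\<close>

text \<open>\<open>f\<close> is followed along \<open>A X_1\<close> and \<open>g\<close> along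
  \<open>B X_1\<close>, driven by the same jumps. In frequency a joint jump contributes a factor at
  \<open>B^T xi - A^T xi\<close>, separate averages the product of the factors at
  \<open>B^T xi\<close> and \<open>-A^T xi\<close>; pairing a martingale difference with
  \<open>g\<close> gives joint minus separate, whence the bracket in \<open>m\<close>. Jumps before
  the active one act jointly, later ones are averaged separately, so \<open>n\<close> equal cycles
  produce a sum of \<open>D^i * M^(n-1-i)\<close>. With \<open>D\<close> near
  \<open>exp (x/n)\<close> and \<open>M\<close> near \<open>exp (y/n)\<close>, its mean tends to the
  integral of \<open>exp (s x + (1-s) y)\<close> over the unit interval, that is
  \<open>exp y * q (x - y)\<close>: the origin of \<open>q\<close>.

  Two values per step reduce differential subordination to \<open>cmod c <= 1\<close> and concavity
  to an inequality between two points and their mean. The bound by 1 on the symbols comes from a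
  separate Cauchy-Schwarz argument on covariances. It yields dominated convergence because the
  product of the transforms of \<open>f\<close> and \<open>g\<close> is integrable; for merely
  continuous functions with compact support this is extracted from a regularised Parseval
  formula.\<close>

lemma norm_square_convex_combination:
  fixes x1 x2 :: "'a::real_inner"
  assumes "w1 + w2 = 1"
  shows "w1 * (norm x1)\<^sup>2 + w2 * (norm x2)\<^sup>2
    = (norm (w1 *\<^sub>R x1 + w2 *\<^sub>R x2))\<^sup>2 + w1 * w2 * (norm (x1 - x2))\<^sup>2"
proof -
  have w2: "w2 = 1 - w1" using assms by simp
  show ?thesis unfolding w2 power2_norm_eq_inner
    by (simp add: inner_simps inner_commute algebra_simps power2_eq_square)
qed

text \<open>The two branches agree where \<open>norm x + norm y = t\<close>, since there
  \<open>norm y - t = - norm x\<close>.\<close>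

definition burkholder_slice :: "real \<Rightarrow> 'a::real_inner \<Rightarrow> 'a \<Rightarrow> real" where
  "burkholder_slice t x y =
     (if t \<le> norm x + norm y then (norm y - t)\<^sup>2 - (norm x)\<^sup>2 else 0)"

text \<open>Jensen's inequality for a two-valued random pair whose second component has the smaller
  spread. The proof splits only according to the branch that is active at the mean.\<close>

lemma burkholder_slice_two_point:
  fixes x1 x2 y1 y2 :: "'a::real_inner"
  assumes w: "0 \<le> w1" "0 \<le> w2" "w1 + w2 = 1" and t: "0 \<le> t"
    and le: "norm (y1 - y2) \<le> norm (x1 - x2)"
  shows "w1 * burkholder_slice t x1 y1 + w2 * burkholder_slice t x2 y2
    \<le> burkholder_slice t (w1 *\<^sub>R x1 + w2 *\<^sub>R x2) (w1 *\<^sub>R y1 + w2 *\<^sub>R y2)"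
proof -
  define x y where "x = w1 *\<^sub>R x1 + w2 *\<^sub>R x2" and "y = w1 *\<^sub>R y1 + w2 *\<^sub>R y2"
  define v where "v = (\<lambda>(x::'a) (y::'a). (norm y - t)\<^sup>2 - (norm x)\<^sup>2)"
  show ?thesis
  proof (cases "t \<le> norm x + norm y")
    case True
    \<comment> \<open>The quadratic branch majorises the slice everywhere, so no cases arise at the
      two end points.\<close>
    have slice_le: "burkholder_slice t a b \<le> v a b" for a b :: 'a
    proof (cases "t \<le> norm a + norm b")
      case False
      then have "norm a \<le> t - norm b" by simp
      then have "(norm a)\<^sup>2 \<le> (t - norm b)\<^sup>2" by (intro power_mono) auto
      with False show ?thesis by (simp add: burkholder_slice_def v_def power2_commute)
    qed (simp add: burkholder_slice_def v_def)
    have "norm y \<le> w1 * norm y1 + w2 * norm y2"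
      unfolding y_def using norm_triangle_ineq[of "w1 *\<^sub>R y1" "w2 *\<^sub>R y2"] w by simp
    then have n: "t * norm y \<le> t * (w1 * norm y1 + w2 * norm y2)"
      using t by (rule mult_left_mono)
    \<comment> \<open>Comparison of variances; the remaining term \<open>- 2 * t * norm y\<close> of
      \<open>v\<close> is concave in \<open>y\<close>.\<close>
    have "w1 * w2 * (norm (y1 - y2))\<^sup>2 \<le> w1 * w2 * (norm (x1 - x2))\<^sup>2"
      using w le by (intro mult_left_mono power_mono) auto
    then have sq: "w1 * (norm y1)\<^sup>2 + w2 * (norm y2)\<^sup>2 - (norm y)\<^sup>2
        \<le> w1 * (norm x1)\<^sup>2 + w2 * (norm x2)\<^sup>2 - (norm x)\<^sup>2"
      using norm_square_convex_combination[OF w(3), of x1 x2]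
        norm_square_convex_combination[OF w(3), of y1 y2]
      unfolding x_def y_def by linarith
    have "w1 * burkholder_slice t x1 y1 + w2 * burkholder_slice t x2 y2 \<le> w1 * v x1 y1 + w2 * v x2 y2"
      using w slice_le by (intro add_mono mult_left_mono) auto
    also have "\<dots> = w1 * (norm y1)\<^sup>2 + w2 * (norm y2)\<^sup>2 - w1 * (norm x1)\<^sup>2 - w2 * (norm x2)\<^sup>2
        - 2 * (t * (w1 * norm y1 + w2 * norm y2)) + (w1 + w2) * t\<^sup>2"
      unfolding v_def by (simp add: algebra_simps power2_eq_square)
    also have "\<dots> \<le> v x y"
      using n sq unfolding v_def w(3) by (simp add: algebra_simps power2_eq_square)
    also have "\<dots> = burkholder_slice t x y" using True by (simp add: burkholder_slice_def v_def)
    finally show ?thesis unfolding x_def y_def .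
  next
    case False
    \<comment> \<open>The slice vanishes at the mean, so nonpositivity at both end points suffices.
      The smaller spread and \<open>norm x + norm y < t\<close> give
      \<open>norm b - t <= norm a\<close>; the active branch gives
      \<open>t - norm b <= norm a\<close>.\<close>
    have nonpos: "burkholder_slice t a b \<le> 0"
      if "norm (b - y) \<le> norm (a - x)" for a b
    proof (cases "t \<le> norm a + norm b")
      case True
      have "norm b \<le> norm y + norm (b - y)" using norm_triangle_sub[of b y] by simp
      also have "\<dots> \<le> norm y + (norm a + norm x)" using that norm_triangle_ineq4[of a x] by simp
      finally have "\<bar>norm b - t\<bar> \<le> norm a" using False True by simp
      then have "(norm b - t)\<^sup>2 \<le> (norm a)\<^sup>2" by (metis abs_le_square_iff abs_norm_cancel)
      then show ?thesis using True by (simp add: burkholder_slice_def)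
    qed (simp add: burkholder_slice_def)
    have e1: "a - (w1 *\<^sub>R a + w2 *\<^sub>R b) = w2 *\<^sub>R (a - b)"
      and e2: "b - (w1 *\<^sub>R a + w2 *\<^sub>R b) = w1 *\<^sub>R (b - a)" for a b :: 'a
    proof -
      have w2: "w2 = 1 - w1" using w by simp
      show "a - (w1 *\<^sub>R a + w2 *\<^sub>R b) = w2 *\<^sub>R (a - b)"
        "b - (w1 *\<^sub>R a + w2 *\<^sub>R b) = w1 *\<^sub>R (b - a)"
        unfolding w2 by (simp_all add: algebra_simps)
    qed
    have "burkholder_slice t x1 y1 \<le> 0"
      by (rule nonpos) (use w le in \<open>simp add: x_def y_def e1 mult_left_mono\<close>)
    moreover have "burkholder_slice t x2 y2 \<le> 0"
      by (rule nonpos) (use w le in \<open>simp add: x_def y_def e2 mult_left_mono norm_minus_commute\<close>)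
    ultimately have "w1 * burkholder_slice t x1 y1 + w2 * burkholder_slice t x2 y2 \<le> 0"
      using w by (intro add_nonpos_nonpos mult_nonneg_nonpos) auto
    also have "0 = burkholder_slice t x y" using False by (simp add: burkholder_slice_def)
    finally show ?thesis unfolding x_def y_def .
  qed
qed

text \<open>Burkholder's special function without its normalising factor, which is kept apart as
  \<open>burkholder_constant\<close>. It is homogeneous of degree \<open>p\<close> and changes sign
  at \<open>norm y = (p - 1) * norm x\<close>; this is where the constant \<open>p - 1\<close>
  enters.\<close>

definition burkholder_function :: "real \<Rightarrow> 'a::real_normed_vector \<Rightarrow> 'a \<Rightarrow> real" where
  "burkholder_function p x y =
     (norm y - (p - 1) * norm x) * (norm x + norm y) powr (p - 1)"

text \<open>The slice vanishes for \<open>t\<close> above \<open>norm x + norm y\<close>, so any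
  larger \<open>T\<close> gives the same value and several points can share one interval. The weight
  is integrable at 0 because \<open>2 < p\<close>.\<close>

lemma burkholder_function_integral:
  fixes x y :: "'a::real_inner"
  assumes p: "2 < p" and T: "norm x + norm y \<le> T"
  shows "((\<lambda>t. t powr (p - 3) * burkholder_slice t x y) has_integral
    2 / (p * (p - 1) * (p - 2)) * burkholder_function p x y) {0..T}"
proof -
  define a b s where "a = norm x" and "b = norm y" and "s = a + b"
  have nn: "0 \<le> a" "0 \<le> b" "0 \<le> s" by (auto simp: a_def b_def s_def)
  have pw: "t powr (p - 3) * t = t powr (p - 2)" "t powr (p - 3) * t\<^sup>2 = t powr (p - 1)"
    if "0 \<le> t" for t :: real
  proof -
    show "t powr (p - 3) * t = t powr (p - 2)"
      using that powr_mult_base[of t "p - 3"] by (simp add: mult.commute)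
    then have "t powr (p - 3) * t\<^sup>2 = t powr (p - 2) * t" by (simp add: power2_eq_square)
    then show "t powr (p - 3) * t\<^sup>2 = t powr (p - 1)"
      using that powr_mult_base[of t "p - 2"] by (simp add: mult.commute)
  qed
  have "((\<lambda>t. t powr (p - 1) - (2 * b) * t powr (p - 2) + (b\<^sup>2 - a\<^sup>2) * t powr (p - 3)) has_integral
     (s powr (p - 1 + 1) / (p - 1 + 1) - (2 * b) * (s powr (p - 2 + 1) / (p - 2 + 1))
       + (b\<^sup>2 - a\<^sup>2) * (s powr (p - 3 + 1) / (p - 3 + 1)))) {0..s}"
    using p nn by (intro has_integral_add has_integral_diff has_integral_mult_right
        has_integral_powr_from_0) auto
  also have "s powr (p - 1 + 1) / (p - 1 + 1) - (2 * b) * (s powr (p - 2 + 1) / (p - 2 + 1))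
       + (b\<^sup>2 - a\<^sup>2) * (s powr (p - 3 + 1) / (p - 3 + 1))
     = 2 / (p * (p - 1) * (p - 2)) * ((b - (p - 1) * a) * s powr (p - 1))"
  proof -
    have 1: "s powr p = s * s powr (p - 1)" using nn powr_mult_base[of s "p - 1"] by simp
    \<comment> \<open>With \<open>s = a + b\<close>, the factor \<open>b - a\<close> splits off and
      the exponent rises to \<open>p - 1\<close>, which all three terms then share.\<close>
    have 2: "(b\<^sup>2 - a\<^sup>2) * s powr (p - 2) = (b - a) * s powr (p - 1)"
    proof -
      have "(b\<^sup>2 - a\<^sup>2) * s powr (p - 2) = (b - a) * (s * s powr (p - 2))"
        by (simp add: s_def power2_eq_square algebra_simps)
      then show ?thesis using nn powr_mult_base[of s "p - 2"] by simp
    qed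
    have "s powr (p - 1 + 1) / (p - 1 + 1) - (2 * b) * (s powr (p - 2 + 1) / (p - 2 + 1))
       + (b\<^sup>2 - a\<^sup>2) * (s powr (p - 3 + 1) / (p - 3 + 1))
      = s * s powr (p - 1) / p - 2 * b * s powr (p - 1) / (p - 1)
        + (b - a) * s powr (p - 1) / (p - 2)"
      using 1 2 by simp
    also have "\<dots> = 2 / (p * (p - 1) * (p - 2)) * ((b - (p - 1) * a) * s powr (p - 1))"
      using p by (simp add: s_def divide_simps) (simp add: algebra_simps)
    finally show ?thesis .
  qed
  also have "(b - (p - 1) * a) * s powr (p - 1) = burkholder_function p x y"
    by (simp add: burkholder_function_def a_def b_def s_def)
  finally have "((\<lambda>t. t powr (p - 3) * burkholder_slice t x y) has_integral
      2 / (p * (p - 1) * (p - 2)) * burkholder_function p x y) {0..s}"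
    by (rule has_integral_eq[rotated])
       (simp add: burkholder_slice_def a_def b_def s_def power2_diff ring_distribs mult.left_commute pw
          flip: mult.assoc)
  then have "((\<lambda>t. if t \<in> {0..s} then t powr (p - 3) * burkholder_slice t x y else 0)
      has_integral 2 / (p * (p - 1) * (p - 2)) * burkholder_function p x y) {0..T}"
    using T by (subst has_integral_restrict) (auto simp: s_def a_def b_def)
  then show ?thesis
    by (rule has_integral_eq[rotated]) (auto simp: burkholder_slice_def s_def a_def b_def)
qed

text \<open>The slice inequality is integrated against a nonnegative weight. At \<open>p = 2\<close>
  this weight is not integrable, but there the function is a difference of squared norms and the
  comparison of variances suffices.\<close>

lemma burkholder_function_two_point:
  fixes x1 x2 y1 y2 :: "'a::real_inner"
  assumes p: "2 \<le> p" and w: "0 \<le> w1" "0 \<le> w2" "w1 + w2 = 1"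
    and le: "norm (y1 - y2) \<le> norm (x1 - x2)"
  shows "w1 * burkholder_function p x1 y1 + w2 * burkholder_function p x2 y2
    \<le> burkholder_function p (w1 *\<^sub>R x1 + w2 *\<^sub>R x2) (w1 *\<^sub>R y1 + w2 *\<^sub>R y2)"
proof (cases "p = 2")
  case True
  have 2: "burkholder_function p x y = (norm y)\<^sup>2 - (norm x)\<^sup>2" for x y :: 'a
    using True by (simp add: burkholder_function_def power2_eq_square algebra_simps)
  have "w1 * w2 * (norm (y1 - y2))\<^sup>2 \<le> w1 * w2 * (norm (x1 - x2))\<^sup>2"
    using w le by (intro mult_left_mono power_mono) auto
  then show ?thesis
    using norm_square_convex_combination[OF w(3), of x1 x2]
      norm_square_convex_combination[OF w(3), of y1 y2]
    unfolding 2 by (simp add: algebra_simps)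
next
  case False
  with p have p: "2 < p" by simp
  define x y where "x = w1 *\<^sub>R x1 + w2 *\<^sub>R x2" and "y = w1 *\<^sub>R y1 + w2 *\<^sub>R y2"
  define c where "c = 2 / (p * (p - 1) * (p - 2))"
  define T where "T = Max {norm x1 + norm y1, norm x2 + norm y2, norm x + norm y}"
  have c: "0 < c" using p by (simp add: c_def)
  note int = burkholder_function_integral[OF p, of _ _ T, folded c_def]
  have "w1 * (c * burkholder_function p x1 y1) + w2 * (c * burkholder_function p x2 y2)
      \<le> c * burkholder_function p x y"
  proof (rule has_integral_le)
    show "((\<lambda>t. w1 * (t powr (p - 3) * burkholder_slice t x1 y1)
          + w2 * (t powr (p - 3) * burkholder_slice t x2 y2)) has_integral
        w1 * (c * burkholder_function p x1 y1) + w2 * (c * burkholder_function p x2 y2)) {0..T}"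
      by (intro has_integral_add has_integral_mult_right int) (auto simp: T_def)
    show "((\<lambda>t. t powr (p - 3) * burkholder_slice t x y) has_integral
        c * burkholder_function p x y) {0..T}"
      by (rule int) (auto simp: T_def)
    fix t assume "t \<in> {0..T}"
    then have "0 \<le> t" by simp
    from mult_left_mono[OF burkholder_slice_two_point[OF w this le], of "t powr (p - 3)"]
    show "w1 * (t powr (p - 3) * burkholder_slice t x1 y1)
          + w2 * (t powr (p - 3) * burkholder_slice t x2 y2)
        \<le> t powr (p - 3) * burkholder_slice t x y"
      by (simp add: x_def y_def algebra_simps)
  qed
  then have "c * (w1 * burkholder_function p x1 y1 + w2 * burkholder_function p x2 y2)
      \<le> c * burkholder_function p x y"
    by (simp add: algebra_simps)
  then show ?thesis using c by (simp add: x_def y_def)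
qed

section \<open>The majorant with the sharp constant\<close>

lemma powr_convex_nonneg:
  fixes x y l r :: real
  assumes "1 \<le> r" "0 \<le> x" "0 \<le> y" "0 \<le> l" "l \<le> 1"
  shows "((1 - l) * x + l * y) powr r \<le> (1 - l) * x powr r + l * y powr r"
proof -
  have le: "t powr r \<le> t" if "0 \<le> t" "t \<le> 1" for t
    using that assms(1) powr_mono'[of 1 r t] by simp
  have scale: "(t * z) powr r \<le> t * z powr r" if "0 \<le> t" "t \<le> 1" "0 \<le> z" for t z
    using that le[of t] by (simp add: powr_mult mult_right_mono)
  consider "x = 0" | "y = 0" | "0 < x" "0 < y" using assms by linarith
  then show ?thesis
  proof cases
    case 3
    then show ?thesis using convex_onD[OF powr_convex[OF assms(1)], of l x y] assms by simp
  qed (use assms scale[of l y] scale[of "1 - l" x] in auto)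
qed

text \<open>The value forced by tangency: both sides of \<open>burkholder_majorant\<close> vanish at
  \<open>norm y = (p - 1) * norm x\<close>, and this factor makes their slopes agree there.\<close>

definition burkholder_constant :: "real \<Rightarrow> real" where
  "burkholder_constant p = p * (1 - 1 / p) powr (p - 1)"

text \<open>Amounts to \<open>p powr (p - 2) <= (p - 1) powr (p - 1)\<close>. This is the weighted
  inequality of arithmetic and geometric means for \<open>p\<close> and \<open>1\<close>: with
  weights \<open>(p - 2) / (p - 1)\<close> and \<open>1 / (p - 1)\<close> their arithmetic mean is
  exactly \<open>p - 1\<close>.\<close>

lemma burkholder_constant_ge_1:
  assumes p: "2 \<le> p"
  shows "1 \<le> burkholder_constant p"
proof -
  have "p powr ((p - 2) / (p - 1)) * 1 powr (1 / (p - 1)) \<le> (p - 2) / (p - 1) * p + 1 / (p - 1) * 1"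
    using p by (intro Youngs_inequality_0) (auto simp: field_simps)
  also have "\<dots> = p - 1" using p by (simp add: field_simps power2_eq_square)
  finally have "(p powr ((p - 2) / (p - 1))) powr (p - 1) \<le> (p - 1) powr (p - 1)"
    using p by (intro powr_mono2) auto
  then have le: "p powr (p - 2) \<le> (p - 1) powr (p - 1)" using p by (simp add: powr_powr)
  have "burkholder_constant p = p * ((p - 1) / p) powr (p - 1)"
    using p by (simp add: burkholder_constant_def diff_divide_distrib)
  also have "\<dots> = (p - 1) powr (p - 1) * (p / p powr (p - 1))" using p by (simp add: powr_divide)
  also have "p / p powr (p - 1) = 1 / p powr (p - 2)"
    using p powr_mult_base[of p "p - 2"] by (simp add: field_simps)
  finally show ?thesis using p le by simp
qed

text \<open>The majorisation on \<open>norm x + norm y = 1\<close>, with \<open>r = norm x\<close>.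
  The difference \<open>f\<close> of the two sides has derivative \<open>p * h\<close>, where
  \<open>h\<close> is convex with \<open>h 0 <= 0\<close> and \<open>h (1 / p) = 0\<close>. Hence
  \<open>h\<close> is nonpositive before \<open>1 / p\<close> and nonnegative after it, and
  \<open>f\<close> has its minimum 0 at \<open>1 / p\<close>.\<close>

lemma burkholder_majorant_segment:
  fixes r :: real
  assumes p: "2 \<le> p" and r: "0 \<le> r" "r \<le> 1"
  shows "(1 - r) powr p - (p - 1) powr p * r powr p \<le> burkholder_constant p * (1 - p * r)"
proof -
  define \<alpha> where "\<alpha> = burkholder_constant p"
  define f where "f = (\<lambda>r. \<alpha> * (1 - p * r) - (1 - r) powr p + (p - 1) powr p * r powr p)"
  define h where "h = (\<lambda>r. (1 - r) powr (p - 1) + (p - 1) powr p * r powr (p - 1) - \<alpha>)"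
  have pm: "(p - 1) powr p = (p - 1) * (p - 1) powr (p - 1)"
    using p powr_mult_base[of "p - 1" "p - 1"] by simp
  have ip: "0 < 1 / p" "1 / p < 1" using p by auto
  have q1: "(1 - 1 / p) powr (p - 1) = (p - 1) powr (p - 1) * (1 / p) powr (p - 1)"
    using p by (subst powr_mult[symmetric]) (auto simp: field_simps)
  have h0: "h 0 \<le> 0" using burkholder_constant_ge_1[OF p] p by (simp add: h_def \<alpha>_def)
  have hp: "h (1 / p) = 0"
    unfolding h_def \<alpha>_def burkholder_constant_def pm q1 by (simp add: algebra_simps)
  have convex_h: "h ((1 - l) * u + l * v) \<le> (1 - l) * h u + l * h v"
    if "0 \<le> l" "l \<le> 1" "0 \<le> u" "u \<le> 1" "0 \<le> v" "v \<le> 1" for l u v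
  proof -
    have 1: "((1 - l) * u + l * v) powr (p - 1) \<le> (1 - l) * u powr (p - 1) + l * v powr (p - 1)"
      using that p by (intro powr_convex_nonneg) auto
    have e: "1 - ((1 - l) * u + l * v) = (1 - l) * (1 - u) + l * (1 - v)" by (simp add: algebra_simps)
    have 2: "(1 - ((1 - l) * u + l * v)) powr (p - 1)
        \<le> (1 - l) * (1 - u) powr (p - 1) + l * (1 - v) powr (p - 1)"
      unfolding e using that p by (intro powr_convex_nonneg) auto
    show ?thesis using mult_left_mono[OF 1, of "(p - 1) powr p"] 2
      unfolding h_def by (simp add: algebra_simps)
  qed
  have h_left: "h s \<le> 0" if "0 \<le> s" "s \<le> 1 / p" for s
  proof -
    have "h ((1 - p * s) * 0 + p * s * (1 / p)) \<le> (1 - p * s) * h 0 + p * s * h (1 / p)"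
      using that p ip by (intro convex_h) (auto simp: field_simps)
    also have "\<dots> \<le> 0" using h0 hp mult_nonneg_nonpos[of "1 - p * s" "h 0"] that p
      by (simp add: field_simps)
    finally show ?thesis using p by simp
  qed
  \<comment> \<open>Now \<open>1 / p\<close> lies between 0 and \<open>s\<close>, so convexity
    bounds \<open>h (1 / p) = 0\<close> by a nonpositive number plus a positive multiple of
    \<open>h s\<close>.\<close>
  have h_right: "0 \<le> h s" if "1 / p \<le> s" "s \<le> 1" for s
  proof -
    have s: "0 < s" using that ip by linarith
    define l where "l = 1 / (p * s)"
    have l: "0 < l" "l \<le> 1" using that s p by (auto simp: l_def field_simps)
    have "h ((1 - l) * 0 + l * s) \<le> (1 - l) * h 0 + l * h s"
      using l s that by (intro convex_h) auto
    moreover have "(1 - l) * 0 + l * s = 1 / p" using s p by (simp add: l_def)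
    moreover have "(1 - l) * h 0 \<le> 0" using h0 l by (intro mult_nonneg_nonpos) auto
    ultimately have "0 \<le> l * h s" using hp by simp
    then show ?thesis using l by (simp add: zero_le_mult_iff)
  qed
  have cont: "continuous_on {0..1} f"
    unfolding f_def using p by (intro continuous_intros continuous_on_powr') auto
  have deriv: "(f has_real_derivative p * h s) (at s)" if "0 < s" "s < 1" for s
    unfolding f_def h_def using that p
    by (auto intro!: derivative_eq_intros simp: algebra_simps)
  have fp: "f (1 / p) = 0"
    using ip p unfolding f_def
    by (simp add: powr_mult[symmetric] diff_divide_distrib)
  have "0 \<le> f r"
  proof (cases "r \<le> 1 / p")
    case True
    have "f (1 / p) \<le> f r"
    proof (rule DERIV_nonpos_imp_decreasing_open[OF True])
      show "\<exists>y. (f has_real_derivative y) (at x) \<and> y \<le> 0" if "r < x" "x < 1 / p" for x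
        using deriv[of x] h_left[of x] that r ip p
        by (intro exI[of _ "p * h x"] conjI mult_nonneg_nonpos) auto
      show "continuous_on {r..1 / p} f"
        by (rule continuous_on_subset[OF cont]) (use r ip in auto)
    qed
    then show ?thesis using fp by simp
  next
    case False
    then have le: "1 / p \<le> r" by simp
    have "f (1 / p) \<le> f r"
    proof (rule DERIV_nonneg_imp_increasing_open[OF le])
      show "\<exists>y. (f has_real_derivative y) (at x) \<and> 0 \<le> y" if "1 / p < x" "x < r" for x
        using deriv[of x] h_right[of x] that r ip p
        by (intro exI[of _ "p * h x"] conjI mult_nonneg_nonneg) auto
      show "continuous_on {1 / p..r} f"
        by (rule continuous_on_subset[OF cont]) (use r ip in auto)
    qed
    then show ?thesis using fp by simp
  qed
  then show ?thesis unfolding f_def \<alpha>_def by simp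
qed

text \<open>Both sides are homogeneous of degree \<open>p\<close>, so dividing by
  \<open>norm x + norm y\<close> reduces the claim to the segment.\<close>

lemma burkholder_majorant:
  fixes x y :: "'a::real_normed_vector"
  assumes p: "2 \<le> p"
  shows "norm y powr p - (p - 1) powr p * norm x powr p
    \<le> burkholder_constant p * burkholder_function p x y"
proof (cases "norm x + norm y = 0")
  case True
  then have "norm x = 0" "norm y = 0" by (smt (verit) norm_ge_zero)+
  then show ?thesis using p by (simp add: burkholder_function_def)
next
  case False
  define s r where "s = norm x + norm y" and "r = norm x / s"
  have s: "0 < s" using False by (smt (verit) norm_ge_zero s_def)
  have r: "0 \<le> r" "r \<le> 1" using s by (auto simp: r_def s_def)
  have x: "norm x = s * r" and y: "norm y = s * (1 - r)"
    using s by (auto simp: r_def s_def field_simps)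
  have sp: "s powr p = s * s powr (p - 1)" using s powr_mult_base[of s "p - 1"] by simp
  have "norm x powr p = s powr p * r powr p" "norm y powr p = s powr p * (1 - r) powr p"
    unfolding x y using s r by (simp_all only: powr_mult)
  then have "norm y powr p - (p - 1) powr p * norm x powr p
      = s powr p * ((1 - r) powr p - (p - 1) powr p * r powr p)"
    by (simp add: algebra_simps)
  also have "\<dots> \<le> s powr p * (burkholder_constant p * (1 - p * r))"
    by (intro mult_left_mono burkholder_majorant_segment p r) auto
  also have "\<dots> = burkholder_constant p * burkholder_function p x y"
    unfolding burkholder_function_def s_def[symmetric] sp unfolding x y by (simp add: algebra_simps)
  finally show ?thesis .
qed

section \<open>Fourier transform and Parseval's formula\<close>

text \<open>A non-measurable \<open>h\<close> is covered too: neither side is then integrable and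
  both integrals take the default value 0. This keeps \<open>fourier_translate\<close> free of
  hypotheses.\<close>

lemma lborel_integral_translate:
  fixes h :: "'a::euclidean_space \<Rightarrow> 'b::{banach, second_countable_topology}"
  shows "(LINT x|lborel. h (x + v)) = (LINT x|lborel. h x)"
proof (cases "h \<in> borel_measurable borel")
  case True
  have "(LINT x|lborel. h x) = (LINT x|distr lborel borel ((+) v). h x)"
    by (simp add: lborel_distr_plus)
  also have "\<dots> = (LINT x|lborel. h (v + x))" using True by (intro integral_distr) auto
  finally show ?thesis by (simp add: add.commute)
next
  case False
  have "h \<in> borel_measurable borel" if "(\<lambda>x. h (x + v)) \<in> borel_measurable borel"
  proof -
    have "(\<lambda>x. h ((x - v) + v)) \<in> borel_measurable borel"
      by (rule measurable_compose[OF _ that]) simp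
    then show ?thesis by simp
  qed
  then have "\<not> integrable lborel (\<lambda>x. h (x + v))" "\<not> integrable lborel h"
    using False borel_measurable_integrable[of lborel h] borel_measurable_integrable[of lborel "\<lambda>x. h (x + v)"]
    unfolding measurable_lborel1 measurable_lborel2 by blast+
  then show ?thesis by (simp add: not_integrable_integral_eq)
qed

lemma lborel_integrable_translate:
  fixes h :: "'a::euclidean_space \<Rightarrow> 'b::{banach, second_countable_topology}"
  assumes "integrable lborel h"
  shows "integrable lborel (\<lambda>x. h (x + v))"
proof -
  have "integrable (distr lborel borel ((+) v)) h" using assms by (simp add: lborel_distr_plus)
  then have "integrable lborel (\<lambda>x. h (v + x))" by (rule integrable_distr[rotated]) simp
  then show ?thesis by (simp add: add.commute)
qed

lemma lborel_integral_affine: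
  fixes h :: "'a::euclidean_space \<Rightarrow> 'b::{banach, second_countable_topology}"
  assumes [measurable]: "h \<in> borel_measurable borel" and c: "c \<noteq> 0"
  shows "(LINT x|lborel. h x) = \<bar>c\<bar> ^ DIM('a) *\<^sub>R (LINT x|lborel. h (t + c *\<^sub>R x))"
proof -
  let ?D = "distr lborel borel (\<lambda>x. t + c *\<^sub>R x)"
  have "(LINT x|lborel. h x) = (LINT x|density ?D (\<lambda>_. ennreal (\<bar>c\<bar> ^ DIM('a))). h x)"
    using lborel_affine[OF c, of t] by simp
  also have "\<dots> = (LINT x|?D. \<bar>c\<bar> ^ DIM('a) *\<^sub>R h x)"
    by (rule integral_density) auto
  also have "\<dots> = (LINT x|lborel. \<bar>c\<bar> ^ DIM('a) *\<^sub>R h (t + c *\<^sub>R x))"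
    by (rule integral_distr) auto
  finally show ?thesis by simp
qed

lemma lborel_integrable_affine:
  fixes h :: "'a::euclidean_space \<Rightarrow> 'b::{banach, second_countable_topology}"
  assumes h: "integrable lborel h" and c: "c \<noteq> 0"
  shows "integrable lborel (\<lambda>x. h (t + c *\<^sub>R x))"
proof -
  have [measurable]: "h \<in> borel_measurable borel" using h by (simp add: borel_measurable_integrable)
  have "integrable (density (distr lborel borel (\<lambda>x. t + c *\<^sub>R x)) (\<lambda>_. ennreal (\<bar>c\<bar> ^ DIM('a)))) h"
    using h lborel_affine[OF c, of t] by simp
  then have "integrable (distr lborel borel (\<lambda>x. t + c *\<^sub>R x)) (\<lambda>x. \<bar>c\<bar> ^ DIM('a) *\<^sub>R h x)"
    by (subst (asm) integrable_density) auto
  then have "integrable lborel (\<lambda>x. \<bar>c\<bar> ^ DIM('a) *\<^sub>R h (t + c *\<^sub>R x))"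
    by (rule integrable_distr[rotated]) simp
  from integrable_scaleR_right[OF this, of "inverse (\<bar>c\<bar> ^ DIM('a))"] show ?thesis using c by simp
qed

section \<open>Gaussians and rules for the Fourier transform\<close>

definition gaussian :: "'a::euclidean_space \<Rightarrow> real" where
  "gaussian x = exp (- (norm x)\<^sup>2 / 2)"

lemma gaussian_measurable [measurable]: "gaussian \<in> borel_measurable borel"
  unfolding gaussian_def by measurable

lemma fourier_gaussian_real:
  fixes t :: real
  shows "integrable lborel (\<lambda>x::real. exp (\<i> * complex_of_real (t * x)) * complex_of_real (exp (- x\<^sup>2 / 2)))"
    and "(LINT x|lborel. exp (\<i> * complex_of_real (t * x)) * complex_of_real (exp (- x\<^sup>2 / 2)))
      = complex_of_real (sqrt (2 * pi) * exp (- t\<^sup>2 / 2))"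
proof -
  have d: "complex_of_real (exp (- x\<^sup>2 / 2)) = complex_of_real (sqrt (2 * pi)) * complex_of_real (std_normal_density x)"
    for x by (simp add: std_normal_density_def)
  have int: "integrable lborel (\<lambda>x. std_normal_density x *\<^sub>R exp (\<i> * complex_of_real (t * x)))"
    by (rule Bochner_Integration.integrable_bound[OF integrable_normal_density[of 1 0]]) auto
  show "integrable lborel (\<lambda>x::real. exp (\<i> * complex_of_real (t * x)) * complex_of_real (exp (- x\<^sup>2 / 2)))"
    unfolding d using integrable_mult_right[OF int, of "complex_of_real (sqrt (2 * pi))"]
    by (simp add: scaleR_conv_of_real mult_ac)
  have "char std_normal_distribution t = (LINT x|lborel. std_normal_density x *\<^sub>R exp (\<i> * complex_of_real (t * x)))"
    unfolding char_def by (subst integral_density) (auto simp: normal_density_nonneg)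
  then have e: "(LINT x|lborel. std_normal_density x *\<^sub>R exp (\<i> * complex_of_real (t * x))) = complex_of_real (exp (- t\<^sup>2 / 2))"
    by (simp add: char_std_normal_distribution)
  have "(LINT x|lborel. exp (\<i> * complex_of_real (t * x)) * complex_of_real (exp (- x\<^sup>2 / 2)))
     = (LINT x|lborel. complex_of_real (sqrt (2 * pi)) * (std_normal_density x *\<^sub>R exp (\<i> * complex_of_real (t * x))))"
    unfolding d by (simp add: scaleR_conv_of_real mult_ac)
  also have "\<dots> = complex_of_real (sqrt (2 * pi)) * complex_of_real (exp (- t\<^sup>2 / 2))"
    by (simp only: integral_mult_right_zero e)
  finally show "(LINT x|lborel. exp (\<i> * complex_of_real (t * x)) * complex_of_real (exp (- x\<^sup>2 / 2)))
      = complex_of_real (sqrt (2 * pi) * exp (- t\<^sup>2 / 2))" by simp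
qed

text \<open>The integrand factorises over the coordinates and Lebesgue measure is the image of a
  product measure; in dimension one the formula is the characteristic function of the standard
  normal law.\<close>

lemma fourier_gaussian:
  fixes y :: "'a::euclidean_space"
  shows "integrable lborel (\<lambda>x. exp (\<i> * complex_of_real (y \<bullet> x)) * complex_of_real (gaussian x))"
    and "fourier (\<lambda>x. complex_of_real (gaussian x)) y
      = complex_of_real (sqrt (2 * pi) ^ DIM('a) * gaussian y)"
proof -
  interpret product_sigma_finite "\<lambda>_::'a. lborel :: real measure" ..
  let ?S = "\<lambda>f::'a \<Rightarrow> real. \<Sum>b\<in>Basis. f b *\<^sub>R b"
  let ?h = "\<lambda>x::'a. exp (\<i> * complex_of_real (y \<bullet> x)) * complex_of_real (gaussian x)"
  let ?g = "\<lambda>b x. exp (\<i> * complex_of_real ((y \<bullet> b) * x)) * complex_of_real (exp (- x\<^sup>2 / 2))"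
  have h: "?h (?S f) = (\<Prod>b\<in>Basis. ?g b (f b))" for f
  proof -
    have "(norm (?S f))\<^sup>2 = (\<Sum>b\<in>Basis. (f b)\<^sup>2)"
      unfolding power2_norm_eq_inner by (subst euclidean_inner) (simp add: power2_eq_square)
    then have "gaussian (?S f) = (\<Prod>b\<in>Basis. exp (- (f b)\<^sup>2 / 2))"
      by (simp add: gaussian_def exp_sum[symmetric] sum_negf sum_divide_distrib)
    moreover have "exp (\<i> * complex_of_real (y \<bullet> ?S f)) = (\<Prod>b\<in>Basis. exp (\<i> * complex_of_real ((y \<bullet> b) * f b)))"
      by (simp add: exp_sum[symmetric] inner_sum_right sum_distrib_left mult_ac)
    ultimately show ?thesis by (simp add: prod.distrib)
  qed
  have S: "?S \<in> measurable (Pi\<^sub>M Basis (\<lambda>_. lborel)) borel" by measurable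
  have mh: "?h \<in> borel_measurable borel" by measurable
  have "integrable (Pi\<^sub>M Basis (\<lambda>_. lborel)) (\<lambda>f. \<Prod>b\<in>Basis. ?g b (f b))"
    by (rule product_integrable_prod[where f="?g"], rule finite_Basis, rule fourier_gaussian_real(1))
  then have "integrable (Pi\<^sub>M Basis (\<lambda>_. lborel)) (\<lambda>f. ?h (?S f))" by (simp only: h)
  then have "integrable (distr (Pi\<^sub>M Basis (\<lambda>_. lborel)) borel ?S) ?h"
    by (subst integrable_distr_eq[OF S mh])
  then show "integrable lborel ?h" by (simp only: lborel_eq[where 'a='a])
  have "fourier (\<lambda>x. complex_of_real (gaussian x)) y = (LINT f|Pi\<^sub>M Basis (\<lambda>_. lborel). ?h (?S f))"
    unfolding fourier_def by (simp only: lborel_eq[where 'a='a] integral_distr[OF S mh])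
  also have "\<dots> = (\<Prod>b\<in>Basis. LINT x|lborel. ?g b x)"
    unfolding h
    by (rule product_integral_prod[where f="?g"], rule finite_Basis, rule fourier_gaussian_real(1))
  also have "\<dots> = (\<Prod>b\<in>Basis. complex_of_real (sqrt (2 * pi) * exp (- (y \<bullet> b)\<^sup>2 / 2)))"
    by (simp only: fourier_gaussian_real)
  also have "\<dots> = complex_of_real (sqrt (2 * pi) ^ DIM('a) * gaussian y)"
  proof -
    have "(norm y)\<^sup>2 = (\<Sum>b\<in>Basis. (y \<bullet> b)\<^sup>2)"
      unfolding power2_norm_eq_inner by (subst euclidean_inner) (simp add: power2_eq_square)
    then have "gaussian y = (\<Prod>b\<in>Basis. exp (- (y \<bullet> b)\<^sup>2 / 2))"
      by (simp add: gaussian_def exp_sum[symmetric] sum_negf sum_divide_distrib)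
    then show ?thesis by (simp add: prod.distrib)
  qed
  finally show "fourier (\<lambda>x. complex_of_real (gaussian x)) y
      = complex_of_real (sqrt (2 * pi) ^ DIM('a) * gaussian y)" .
qed

lemma gaussian_integral:
  shows "integrable lborel (gaussian :: 'a::euclidean_space \<Rightarrow> real)"
    and "(LINT x|lborel. gaussian (x::'a)) = sqrt (2 * pi) ^ DIM('a)"
proof -
  have i: "integrable lborel (\<lambda>x::'a. complex_of_real (gaussian x))"
    using fourier_gaussian(1)[of 0] by simp
  then show "integrable lborel (gaussian :: 'a::euclidean_space \<Rightarrow> real)"
    by (simp add: complex_of_real_integrable_eq)
  have "(LINT x|lborel. complex_of_real (gaussian (x::'a))) = complex_of_real (sqrt (2 * pi) ^ DIM('a))"
    using fourier_gaussian(2)[of "0::'a"] by (simp add: fourier_def gaussian_def)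
  then show "(LINT x|lborel. gaussian (x::'a)) = sqrt (2 * pi) ^ DIM('a)"
    by (simp only: integral_complex_of_real of_real_eq_iff)
qed

lemma fourier_measurable [measurable]:
  fixes f :: "'a::euclidean_space \<Rightarrow> complex"
  assumes [measurable]: "f \<in> borel_measurable borel"
  shows "fourier f \<in> borel_measurable borel"
  unfolding fourier_def[abs_def] by measurable

lemma fourier_norm_le:
  shows "cmod (fourier f \<xi>) \<le> (LINT x|lborel. cmod (f x))"
  unfolding fourier_def using integral_norm_bound[of lborel "\<lambda>x. exp (\<i> * complex_of_real (\<xi> \<bullet> x)) * f x"]
  by (simp add: norm_mult)

lemma fourier_cnj: "fourier (\<lambda>x. cnj (f x)) \<xi> = cnj (fourier f (- \<xi>))"
proof -
  have "fourier (\<lambda>x. cnj (f x)) \<xi> = (LINT x|lborel. cnj (exp (\<i> * complex_of_real (- \<xi> \<bullet> x)) * f x))"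
    unfolding fourier_def
    by (intro Bochner_Integration.integral_cong refl) (simp add: exp_cnj)
  then show ?thesis unfolding fourier_def by (simp only: Bochner_Integration.integral_cnj)
qed

lemma fourier_translate:
  "fourier (\<lambda>x. f (x + v)) \<xi> = exp (- \<i> * complex_of_real (\<xi> \<bullet> v)) * fourier f \<xi>"
proof -
  have "fourier (\<lambda>x. f (x + v)) \<xi> = (LINT x|lborel. exp (- \<i> * complex_of_real (\<xi> \<bullet> v)) * (exp (\<i> * complex_of_real (\<xi> \<bullet> (x + v))) * f (x + v)))"
    unfolding fourier_def
    by (intro Bochner_Integration.integral_cong refl)
       (simp add: inner_right_distrib exp_add ring_distribs exp_minus)
  also have "\<dots> = exp (- \<i> * complex_of_real (\<xi> \<bullet> v)) * (LINT x|lborel. exp (\<i> * complex_of_real (\<xi> \<bullet> (x + v))) * f (x + v))"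
    by (rule integral_mult_right_zero)
  also have "(LINT x|lborel. exp (\<i> * complex_of_real (\<xi> \<bullet> (x + v))) * f (x + v)) = fourier f \<xi>"
    unfolding fourier_def by (rule lborel_integral_translate)
  finally show ?thesis .
qed

lemma integrable_mult_fourier:
  fixes f g :: "'a::euclidean_space \<Rightarrow> complex"
  assumes f: "integrable lborel f" and g: "integrable lborel g"
  shows "integrable lborel (\<lambda>x. f x * fourier g x)"
proof -
  have [measurable]: "f \<in> borel_measurable borel" "g \<in> borel_measurable borel"
    using borel_measurable_integrable[OF f] borel_measurable_integrable[OF g] by simp_all
  show ?thesis
    by (rule Bochner_Integration.integrable_bound[OF integrable_mult_left[OF f, of "complex_of_real (LINT x|lborel. cmod (g x))"]])
       (auto simp: norm_mult fourier_norm_le intro!: mult_left_mono order_trans[OF fourier_norm_le])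
qed

lemma fourier_multiplication_formula:
  fixes f g :: "'a::euclidean_space \<Rightarrow> complex"
  assumes f: "integrable lborel f" and g: "integrable lborel g"
  shows "(LINT \<xi>|lborel. fourier f \<xi> * g \<xi>) = (LINT x|lborel. f x * fourier g x)"
proof -
  let ?F = "\<lambda>x \<xi>. exp (\<i> * complex_of_real (\<xi> \<bullet> x)) * (f x * g \<xi>)"
  have [measurable]: "f \<in> borel_measurable borel" "g \<in> borel_measurable borel"
    using borel_measurable_integrable[OF f] borel_measurable_integrable[OF g] by simp_all
  have prod: "integrable (lborel \<Otimes>\<^sub>M lborel) (\<lambda>(x, \<xi>). ?F x \<xi>)"
  proof (rule lborel_pair.Fubini_integrable)
    show "(\<lambda>(x, \<xi>). ?F x \<xi>) \<in> borel_measurable (lborel \<Otimes>\<^sub>M lborel)" by measurable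
    have "integrable lborel (\<lambda>x. cmod (f x) * (LINT \<xi>|lborel. cmod (g \<xi>)))"
      using f by (intro integrable_mult_left integrable_norm)
    then show "integrable lborel (\<lambda>x. LINT \<xi>|lborel. norm (case (x, \<xi>) of (x, \<xi>) \<Rightarrow> ?F x \<xi>))"
      by (simp add: norm_mult mult.assoc flip: integral_mult_right_zero)
    show "AE x in lborel. integrable lborel (\<lambda>\<xi>. case (x, \<xi>) of (x, \<xi>) \<Rightarrow> ?F x \<xi>)"
    proof (rule AE_I2)
      fix x
      show "integrable lborel (\<lambda>\<xi>. case (x, \<xi>) of (x, \<xi>) \<Rightarrow> ?F x \<xi>)"
        by (rule Bochner_Integration.integrable_bound[OF integrable_mult_right[OF g, of "f x"]])
           (auto simp: norm_mult)
    qed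
  qed
  have "(LINT \<xi>|lborel. fourier f \<xi> * g \<xi>) = (LINT \<xi>|lborel. LINT x|lborel. ?F x \<xi>)"
    unfolding fourier_def
    by (intro Bochner_Integration.integral_cong refl)
       (simp add: mult_ac flip: integral_mult_right_zero)
  also have "\<dots> = (LINT x|lborel. LINT \<xi>|lborel. ?F x \<xi>)"
    by (rule lborel_pair.Fubini_integral[OF prod])
  also have "\<dots> = (LINT x|lborel. f x * fourier g x)"
    unfolding fourier_def
    by (intro Bochner_Integration.integral_cong refl)
       (simp add: mult_ac inner_commute flip: integral_mult_right_zero)
  finally show ?thesis .
qed


lemma fourier_reflect:
  fixes g :: "'a::euclidean_space \<Rightarrow> complex"
  assumes [measurable]: "g \<in> borel_measurable borel"
  shows "fourier (\<lambda>y. g (x - y)) \<xi> = exp (\<i> * complex_of_real (\<xi> \<bullet> x)) * fourier g (- \<xi>)"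
proof -
  have "fourier (\<lambda>y. g (x - y)) \<xi>
      = (LINT y|lborel. exp (\<i> * complex_of_real (\<xi> \<bullet> (x + (- 1) *\<^sub>R y))) * g (x - (x + (- 1) *\<^sub>R y)))"
    unfolding fourier_def by (subst lborel_integral_affine[where c="-1" and t=x]) auto
  also have "\<dots> = (LINT y|lborel. exp (\<i> * complex_of_real (\<xi> \<bullet> x)) * (exp (\<i> * complex_of_real (- \<xi> \<bullet> y)) * g y))"
    by (intro Bochner_Integration.integral_cong refl)
       (simp add: inner_diff_right exp_add ring_distribs exp_minus exp_diff divide_inverse)
  also have "\<dots> = exp (\<i> * complex_of_real (\<xi> \<bullet> x)) * fourier g (- \<xi>)"
    unfolding fourier_def by (rule integral_mult_right_zero)
  finally show ?thesis .
qed

lemma fourier_scaled_gaussian: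
  fixes u :: "'a::euclidean_space"
  assumes e: "0 < e"
  shows "e ^ DIM('a) *\<^sub>R fourier (\<lambda>\<xi>. complex_of_real (gaussian (e *\<^sub>R \<xi>))) (e *\<^sub>R u)
    = complex_of_real (sqrt (2 * pi) ^ DIM('a) * gaussian u)"
proof -
  have "fourier (\<lambda>\<xi>. complex_of_real (gaussian \<xi>)) u = (LINT \<xi>|lborel. exp (\<i> * complex_of_real (u \<bullet> \<xi>)) * complex_of_real (gaussian \<xi>))"
    by (simp add: fourier_def)
  also have "\<dots> = e ^ DIM('a) *\<^sub>R (LINT \<xi>|lborel. exp (\<i> * complex_of_real (u \<bullet> (0 + e *\<^sub>R \<xi>))) * complex_of_real (gaussian (0 + e *\<^sub>R \<xi>)))"
    using e by (subst lborel_integral_affine[where c=e and t=0]) auto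
  also have "\<dots> = e ^ DIM('a) *\<^sub>R fourier (\<lambda>\<xi>. complex_of_real (gaussian (e *\<^sub>R \<xi>))) (e *\<^sub>R u)"
    by (simp add: fourier_def)
  finally show ?thesis using fourier_gaussian(2)[of u] by simp
qed

lemma integrable_scaled_gaussian:
  assumes "0 < e"
  shows "integrable lborel (\<lambda>\<xi>::'a::euclidean_space. complex_of_real (gaussian (e *\<^sub>R \<xi>)))"
  using lborel_integrable_affine[OF gaussian_integral(1), of e 0] assms
  by (simp add: complex_of_real_integrable_eq)

text \<open>The Gaussian weight makes \<open>?H\<close> integrable, so the multiplication formula
  can move the transform from \<open>f\<close> to \<open>?H\<close>. The transform of
  \<open>?H\<close> at \<open>x\<close> is, up to a constant, the average of \<open>g\<close> around
  \<open>x\<close> against a Gaussian of width \<open>e\<close>.\<close>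

lemma parseval_regularized:
  fixes f g :: "'a::euclidean_space \<Rightarrow> complex"
  assumes f: "integrable lborel f" and g: "integrable lborel g" and e: "0 < e"
  shows "integrable lborel (\<lambda>\<xi>. complex_of_real (gaussian (e *\<^sub>R \<xi>)) * (fourier f \<xi> * fourier g (- \<xi>)))"
    and "(LINT \<xi>|lborel. complex_of_real (gaussian (e *\<^sub>R \<xi>)) * (fourier f \<xi> * fourier g (- \<xi>)))
    = (LINT x|lborel. f x * (LINT u|lborel. g (x - e *\<^sub>R u)
        * complex_of_real (sqrt (2 * pi) ^ DIM('a) * gaussian u)))"
proof -
  have [measurable]: "f \<in> borel_measurable borel" "g \<in> borel_measurable borel"
    using borel_measurable_integrable[OF f] borel_measurable_integrable[OF g] by simp_all
  let ?w = "\<lambda>\<xi>::'a. complex_of_real (gaussian (e *\<^sub>R \<xi>))"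
  let ?H = "\<lambda>\<xi>. ?w \<xi> * fourier g (- \<xi>)"
  note w = integrable_scaled_gaussian[OF e, where 'a='a]
  have H: "integrable lborel ?H"
    by (rule Bochner_Integration.integrable_bound[OF integrable_mult_left[OF w, of "complex_of_real (LINT x|lborel. cmod (g x))"]])
       (auto simp: norm_mult intro!: mult_left_mono order_trans[OF fourier_norm_le])
  have "integrable lborel (\<lambda>\<xi>. ?H \<xi> * fourier f \<xi>)" by (rule integrable_mult_fourier[OF H f])
  then show "integrable lborel (\<lambda>\<xi>. ?w \<xi> * (fourier f \<xi> * fourier g (- \<xi>)))"
    by (simp add: mult_ac)
  have inner: "fourier ?H x = (LINT u|lborel. g (x - e *\<^sub>R u) * complex_of_real (sqrt (2 * pi) ^ DIM('a) * gaussian u))" for x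
  proof -
    have gx: "integrable lborel (\<lambda>y. g (x - y))"
      using lborel_integrable_affine[OF g, of "-1" x] by simp
    have "fourier ?H x = (LINT \<xi>|lborel. fourier (\<lambda>y. g (x - y)) \<xi> * ?w \<xi>)"
      unfolding fourier_def[of ?H]
      by (intro Bochner_Integration.integral_cong refl) (simp add: fourier_reflect inner_commute)
    also have "\<dots> = (LINT y|lborel. g (x - y) * fourier ?w y)"
      by (rule fourier_multiplication_formula[OF gx w])
    also have "\<dots> = e ^ DIM('a) *\<^sub>R (LINT u|lborel. g (x - (0 + e *\<^sub>R u)) * fourier ?w (0 + e *\<^sub>R u))"
      using e by (subst lborel_integral_affine[where c=e and t=0]) auto
    also have "\<dots> = (LINT u|lborel. e ^ DIM('a) *\<^sub>R (g (x - e *\<^sub>R u) * fourier ?w (e *\<^sub>R u)))"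
      by simp
    also have "\<dots> = (LINT u|lborel. g (x - e *\<^sub>R u) * complex_of_real (sqrt (2 * pi) ^ DIM('a) * gaussian u))"
      by (intro Bochner_Integration.integral_cong refl)
         (simp only: mult_scaleR_right[symmetric] fourier_scaled_gaussian[OF e])
    finally show ?thesis .
  qed
  have "(LINT \<xi>|lborel. ?w \<xi> * (fourier f \<xi> * fourier g (- \<xi>))) = (LINT \<xi>|lborel. fourier f \<xi> * ?H \<xi>)"
    by (simp add: mult_ac)
  also have "\<dots> = (LINT x|lborel. f x * fourier ?H x)"
    by (rule fourier_multiplication_formula[OF f H])
  finally show "(LINT \<xi>|lborel. ?w \<xi> * (fourier f \<xi> * fourier g (- \<xi>)))
    = (LINT x|lborel. f x * (LINT u|lborel. g (x - e *\<^sub>R u)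
        * complex_of_real (sqrt (2 * pi) ^ DIM('a) * gaussian u)))"
    unfolding inner .
qed

lemma parseval_regularized_limit:
  fixes f g :: "'a::euclidean_space \<Rightarrow> complex"
  assumes f: "integrable lborel f" and g: "integrable lborel g"
    and cont: "continuous_on UNIV g" and K: "\<And>x. cmod (g x) \<le> K"
  shows "(\<lambda>n. LINT \<xi>|lborel. complex_of_real (gaussian ((1 / real (Suc n)) *\<^sub>R \<xi>)) * (fourier f \<xi> * fourier g (- \<xi>)))
    \<longlonglongrightarrow> complex_of_real ((2 * pi) ^ DIM('a)) * (LINT x|lborel. f x * g x)"
proof -
  have [measurable]: "f \<in> borel_measurable borel" "g \<in> borel_measurable borel"
    using borel_measurable_integrable[OF f] borel_measurable_integrable[OF g] by simp_all
  define c where "c = sqrt (2 * pi) ^ DIM('a)"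
  have c: "0 \<le> c" by (simp add: c_def)
  let ?e = "\<lambda>n. 1 / real (Suc n)"
  let ?G = "\<lambda>n x. LINT u|lborel. g (x - ?e n *\<^sub>R u) * complex_of_real (c * gaussian u)"
  have gc: "integrable lborel (\<lambda>u::'a. c * gaussian u)" "integrable lborel (\<lambda>u::'a. K * (c * gaussian u))"
    using gaussian_integral(1)[where 'a='a] by (auto intro!: integrable_mult_right)
  \<comment> \<open>One factor \<open>sqrt (2 * pi) ^ DIM('a)\<close> stems from the transform of
    the Gaussian, the other from its integral.\<close>
  have tot: "(LINT u|lborel. c * gaussian (u::'a)) = (2 * pi) ^ DIM('a)"
  proof -
    have "c * c = (2 * pi) ^ DIM('a)" unfolding c_def power_mult_distrib[symmetric] by simp
    then show ?thesis by (simp add: gaussian_integral(2) c_def[symmetric])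
  qed
  have lim: "(\<lambda>n. ?G n x) \<longlonglongrightarrow> g x * complex_of_real ((2 * pi) ^ DIM('a))" for x
  proof -
    have "(\<lambda>n. ?G n x) \<longlonglongrightarrow> (LINT u|lborel. g x * complex_of_real (c * gaussian (u::'a)))"
    proof (rule integral_dominated_convergence[where w="\<lambda>u::'a. K * (c * gaussian u)"])
      show "AE u in lborel. (\<lambda>n. g (x - ?e n *\<^sub>R u) * complex_of_real (c * gaussian u))
          \<longlonglongrightarrow> g x * complex_of_real (c * gaussian u)"
      proof (intro AE_I2 tendsto_mult tendsto_const)
        fix u
        have "(\<lambda>n. x - ?e n *\<^sub>R u) \<longlonglongrightarrow> x - 0 *\<^sub>R u"
          by (intro tendsto_intros) (use LIMSEQ_Suc[OF lim_1_over_n] in simp)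
        then have "(\<lambda>n. x - ?e n *\<^sub>R u) \<longlonglongrightarrow> x" by simp
        with cont show "(\<lambda>n. g (x - ?e n *\<^sub>R u)) \<longlonglongrightarrow> g x"
          by (intro isCont_tendsto_compose[of x g]) (auto simp: continuous_on_eq_continuous_at)
      qed
      show "AE u in lborel. norm (g (x - ?e n *\<^sub>R u) * complex_of_real (c * gaussian u)) \<le> K * (c * gaussian u)" for n
        using K c by (intro AE_I2) (auto simp: norm_mult gaussian_def abs_mult intro!: mult_right_mono)
    qed (use gc in auto)
    also have "(LINT u|lborel. g x * complex_of_real (c * gaussian (u::'a))) = g x * complex_of_real ((2 * pi) ^ DIM('a))"
      by (simp only: integral_mult_right_zero[of _ "g x"] integral_complex_of_real tot)
    finally show ?thesis .
  qed
  have bound: "cmod (?G n x) \<le> K * (2 * pi) ^ DIM('a)" for n x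
  proof -
    have "cmod (?G n x) \<le> (LINT u|lborel. K * (c * gaussian (u::'a)))"
    proof (rule Bochner_Integration.integral_norm_bound_integral)
      show "integrable lborel (\<lambda>u. g (x - ?e n *\<^sub>R u) * complex_of_real (c * gaussian u))"
        by (rule Bochner_Integration.integrable_bound[OF gc(2)])
           (use K c in \<open>auto simp: norm_mult gaussian_def abs_mult intro!: mult_right_mono order_trans[OF K]\<close>)
    qed (use K c gc in \<open>auto simp: norm_mult gaussian_def abs_mult intro!: mult_right_mono\<close>)
    then show ?thesis by (simp only: integral_mult_right_zero[of _ K] tot)
  qed
  have "(\<lambda>n. LINT x|lborel. f x * ?G n x) \<longlonglongrightarrow> (LINT x|lborel. f x * (g x * complex_of_real ((2 * pi) ^ DIM('a))))"
  proof (rule integral_dominated_convergence[where w="\<lambda>x. cmod (f x) * (K * (2 * pi) ^ DIM('a))"])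
    show "AE x in lborel. (\<lambda>n. f x * ?G n x) \<longlonglongrightarrow> f x * (g x * complex_of_real ((2 * pi) ^ DIM('a)))"
      by (intro AE_I2 tendsto_mult tendsto_const lim)
    show "AE x in lborel. norm (f x * ?G n x) \<le> cmod (f x) * (K * (2 * pi) ^ DIM('a))" for n
      using bound by (intro AE_I2) (auto simp: norm_mult intro!: mult_left_mono)
  qed (use f in auto)
  also have "(LINT x|lborel. f x * (g x * complex_of_real ((2 * pi) ^ DIM('a))))
      = complex_of_real ((2 * pi) ^ DIM('a)) * (LINT x|lborel. f x * g x)"
    by (simp add: mult_ac flip: integral_mult_right_zero)
  finally show ?thesis
    by (subst parseval_regularized(2)[OF f g]) (auto simp: c_def)
qed

text \<open>Pairing \<open>f\<close> with its conjugate makes the regularised integrand nonnegative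
  and increasing in \<open>n\<close>, so monotone convergence turns the finite limit into
  integrability. This yields decay of the transform without integrating by parts.\<close>

lemma fourier_square_integrable:
  fixes f :: "'a::euclidean_space \<Rightarrow> complex"
  assumes f: "integrable lborel f"
    and cont: "continuous_on UNIV f" and K: "\<And>x. cmod (f x) \<le> K"
  shows "integrable lborel (\<lambda>\<xi>. (cmod (fourier f \<xi>))\<^sup>2)"
proof -
  have [measurable]: "f \<in> borel_measurable borel"
    using borel_measurable_integrable[OF f] by simp
  let ?F = "\<lambda>n \<xi>. gaussian ((1 / real (Suc n)) *\<^sub>R \<xi>) * (cmod (fourier f \<xi>))\<^sup>2"
  have cf: "integrable lborel (\<lambda>x. cnj (f x))" using f by simp
  have eq: "complex_of_real (gaussian ((1 / real (Suc n)) *\<^sub>R \<xi>)) * (fourier f \<xi> * fourier (\<lambda>x. cnj (f x)) (- \<xi>))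
      = complex_of_real (?F n \<xi>)" for n \<xi>
    by (simp add: fourier_cnj complex_norm_square[symmetric])
  have i: "integrable lborel (?F n)" for n
    using parseval_regularized(1)[OF f cf, of "1 / real (Suc n)"]
    unfolding eq complex_of_real_integrable_eq by simp
  have "(\<lambda>n. LINT \<xi>|lborel. complex_of_real (?F n \<xi>))
      \<longlonglongrightarrow> complex_of_real ((2 * pi) ^ DIM('a)) * (LINT x|lborel. f x * cnj (f x))"
    using parseval_regularized_limit[OF f cf, of K] cont K
    unfolding eq by (simp add: continuous_on_cnj)
  then have "(\<lambda>n. Re (LINT \<xi>|lborel. complex_of_real (?F n \<xi>)))
      \<longlonglongrightarrow> Re (complex_of_real ((2 * pi) ^ DIM('a)) * (LINT x|lborel. f x * cnj (f x)))"
    by (rule tendsto_Re)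
  then have lim: "(\<lambda>n. LINT \<xi>|lborel. ?F n \<xi>)
      \<longlonglongrightarrow> Re (complex_of_real ((2 * pi) ^ DIM('a)) * (LINT x|lborel. f x * cnj (f x)))"
    by (simp only: integral_complex_of_real Re_complex_of_real)
  show ?thesis
  proof (rule integrable_monotone_convergence[OF i _ _ lim])
    show "AE \<xi> in lborel. mono (\<lambda>n. ?F n \<xi>)"
    proof (intro AE_I2 monoI mult_right_mono)
      fix \<xi> :: 'a and m n :: nat
      assume "m \<le> n"
      then have "1 / real (Suc n) * norm \<xi> \<le> 1 / real (Suc m) * norm \<xi>"
        by (intro mult_right_mono) (auto simp: field_simps)
      then have "(norm ((1 / real (Suc n)) *\<^sub>R \<xi>))\<^sup>2 \<le> (norm ((1 / real (Suc m)) *\<^sub>R \<xi>))\<^sup>2"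
        by (intro power_mono) auto
      then show "gaussian ((1 / real (Suc m)) *\<^sub>R \<xi>) \<le> gaussian ((1 / real (Suc n)) *\<^sub>R \<xi>)"
        unfolding gaussian_def by simp
    qed simp
    show "AE \<xi> in lborel. (\<lambda>n. ?F n \<xi>) \<longlonglongrightarrow> (cmod (fourier f \<xi>))\<^sup>2"
    proof (intro AE_I2)
      fix \<xi> :: 'a
      have "(\<lambda>n. exp (- (norm ((1 / real (Suc n)) *\<^sub>R \<xi>))\<^sup>2 / 2) * (cmod (fourier f \<xi>))\<^sup>2)
         \<longlonglongrightarrow> exp (- (norm (0 *\<^sub>R \<xi>))\<^sup>2 / 2) * (cmod (fourier f \<xi>))\<^sup>2"
        by (intro tendsto_intros) (use LIMSEQ_Suc[OF lim_1_over_n] in auto)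
      then show "(\<lambda>n. ?F n \<xi>) \<longlonglongrightarrow> (cmod (fourier f \<xi>))\<^sup>2" by (simp add: gaussian_def)
    qed
  qed simp
qed

lemma fourier_mult_integrable:
  fixes f g :: "'a::euclidean_space \<Rightarrow> complex"
  assumes f: "integrable lborel f" "continuous_on UNIV f" "\<And>x. cmod (f x) \<le> K"
    and g: "integrable lborel g" "continuous_on UNIV g" "\<And>x. cmod (g x) \<le> K'"
  shows "integrable lborel (\<lambda>\<xi>. fourier f \<xi> * fourier g (- \<xi>))"
proof -
  have [measurable]: "f \<in> borel_measurable borel" "g \<in> borel_measurable borel"
    using borel_measurable_integrable[OF f(1)] borel_measurable_integrable[OF g(1)] by simp_all
  have "integrable lborel (\<lambda>\<xi>. (cmod (fourier (\<lambda>x. cnj (g x)) \<xi>))\<^sup>2)"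
    by (rule fourier_square_integrable[where K=K']) (use g in \<open>auto simp: continuous_on_cnj\<close>)
  then have g2: "integrable lborel (\<lambda>\<xi>. (cmod (fourier g (- \<xi>)))\<^sup>2)"
    by (simp add: fourier_cnj)
  show ?thesis
  proof (rule Bochner_Integration.integrable_bound[OF Bochner_Integration.integrable_add[OF
          fourier_square_integrable[OF f] g2]])
    show "AE \<xi> in lborel. norm (fourier f \<xi> * fourier g (- \<xi>))
        \<le> norm ((cmod (fourier f \<xi>))\<^sup>2 + (cmod (fourier g (- \<xi>)))\<^sup>2)"
    proof (intro AE_I2)
      fix \<xi>
      have "0 \<le> (cmod (fourier f \<xi>) - cmod (fourier g (- \<xi>)))\<^sup>2 + (cmod (fourier f \<xi>))\<^sup>2 + (cmod (fourier g (- \<xi>)))\<^sup>2"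
        by simp
      then show "norm (fourier f \<xi> * fourier g (- \<xi>))
        \<le> norm ((cmod (fourier f \<xi>))\<^sup>2 + (cmod (fourier g (- \<xi>)))\<^sup>2)"
        by (simp add: norm_mult power2_diff)
    qed
  qed simp
qed

text \<open>The regularised integrals converge to both sides: to one by
  \<open>parseval_regularized_limit\<close>, to the other by dominated convergence, now that the
  product of the transforms is integrable.\<close>

theorem parseval:
  fixes f g :: "'a::euclidean_space \<Rightarrow> complex"
  assumes f: "integrable lborel f" "continuous_on UNIV f" "\<And>x. cmod (f x) \<le> K"
    and g: "integrable lborel g" "continuous_on UNIV g" "\<And>x. cmod (g x) \<le> K'"
  shows "(LINT \<xi>|lborel. fourier f \<xi> * fourier g (- \<xi>))
    = complex_of_real ((2 * pi) ^ DIM('a)) * (LINT x|lborel. f x * g x)"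
proof (rule LIMSEQ_unique[OF _ parseval_regularized_limit[OF f(1) g(1-3)]])
  have [measurable]: "f \<in> borel_measurable borel" "g \<in> borel_measurable borel"
    using borel_measurable_integrable[OF f(1)] borel_measurable_integrable[OF g(1)] by simp_all
  let ?w = "\<lambda>n \<xi>::'a. gaussian ((1 / real (Suc n)) *\<^sub>R \<xi>)"
  show "(\<lambda>n. LINT \<xi>|lborel. complex_of_real (?w n \<xi>) * (fourier f \<xi> * fourier g (- \<xi>)))
    \<longlonglongrightarrow> (LINT \<xi>|lborel. fourier f \<xi> * fourier g (- \<xi>))"
  proof (rule integral_dominated_convergence[where w="\<lambda>\<xi>. cmod (fourier f \<xi> * fourier g (- \<xi>))"])
    show "AE \<xi> in lborel. (\<lambda>n. complex_of_real (?w n \<xi>) * (fourier f \<xi> * fourier g (- \<xi>)))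
        \<longlonglongrightarrow> fourier f \<xi> * fourier g (- \<xi>)"
    proof (intro AE_I2)
      fix \<xi> :: 'a
      have "(\<lambda>n. complex_of_real (exp (- (norm ((1 / real (Suc n)) *\<^sub>R \<xi>))\<^sup>2 / 2)) * (fourier f \<xi> * fourier g (- \<xi>)))
         \<longlonglongrightarrow> complex_of_real (exp (- (norm (0 *\<^sub>R \<xi>))\<^sup>2 / 2)) * (fourier f \<xi> * fourier g (- \<xi>))"
        by (intro tendsto_intros) (use LIMSEQ_Suc[OF lim_1_over_n] in auto)
      then show "(\<lambda>n. complex_of_real (?w n \<xi>) * (fourier f \<xi> * fourier g (- \<xi>)))
        \<longlonglongrightarrow> fourier f \<xi> * fourier g (- \<xi>)" by (simp add: gaussian_def)
    qed
    show "AE \<xi> in lborel. norm (complex_of_real (?w n \<xi>) * (fourier f \<xi> * fourier g (- \<xi>)))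
        \<le> cmod (fourier f \<xi> * fourier g (- \<xi>))" for n
      by (intro AE_I2) (simp add: norm_mult gaussian_def mult_left_le_one_le)
  qed (use fourier_mult_integrable[OF f g] in auto)
qed

section \<open>Transforms of finitely many jumps\<close>

text \<open>Besides the test functions this class contains the functions
  \<open>norm (f x) powr r\<close>, which need not be smooth.\<close>

definition cc_function :: "('a::euclidean_space \<Rightarrow> 'b::real_normed_vector) \<Rightarrow> bool" where
  "cc_function f \<longleftrightarrow> continuous_on UNIV f \<and> compact (closure {x. f x \<noteq> 0})"

lemma test_function_cc: "test_function f \<Longrightarrow> cc_function f"
  by (simp add: cc_function_def test_function_continuous) (simp add: test_function_def)

lemma cc_function_compose:
  assumes f: "cc_function f" and h: "continuous_on UNIV h" "h 0 = 0"
  shows "cc_function (\<lambda>x. h (f x))"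
  unfolding cc_function_def
proof
  show "continuous_on UNIV (\<lambda>x. h (f x))"
    using f continuous_on_compose2[OF h(1), of UNIV f] by (simp add: cc_function_def)
  have "closure {x. h (f x) \<noteq> 0} \<subseteq> closure {x. f x \<noteq> 0}"
    using h(2) by (intro closure_mono) auto
  then show "compact (closure {x. h (f x) \<noteq> 0})"
    using f compact_Int_closed[of "closure {x. f x \<noteq> 0}" "closure {x. h (f x) \<noteq> 0}"]
    by (simp add: cc_function_def Int_absorb1)
qed

lemma cc_function_integrable:
  fixes f :: "'a::euclidean_space \<Rightarrow> 'b::{banach, second_countable_topology}"
  assumes "cc_function f"
  shows "integrable lborel f"
proof -
  let ?K = "closure {x. f x \<noteq> 0}"
  have "continuous_on ?K f" and "compact ?K"
    using assms continuous_on_subset unfolding cc_function_def by blast+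
  then have "integrable lborel (\<lambda>x. indicator ?K x *\<^sub>R f x)"
    by (intro borel_integrable_compact)
  moreover have "(\<lambda>x. indicator ?K x *\<^sub>R f x) = f"
    using closure_subset[of "{x. f x \<noteq> 0}"] by (auto simp: indicator_def fun_eq_iff)
  ultimately show ?thesis by simp
qed

lemma cc_function_bounded:
  fixes f :: "'a::euclidean_space \<Rightarrow> 'b::real_normed_vector"
  assumes "cc_function f"
  obtains K where "\<And>x. norm (f x) \<le> K"
proof -
  let ?K = "closure {x. f x \<noteq> 0}"
  have "continuous_on ?K f" and "compact ?K"
    using assms continuous_on_subset unfolding cc_function_def by blast+
  then have "bounded (f ` ?K)" by (intro compact_imp_bounded compact_continuous_image)
  then obtain B where B: "0 < B" "\<And>x. x \<in> ?K \<Longrightarrow> norm (f x) \<le> B"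
    by (auto simp: bounded_pos)
  have "norm (f x) \<le> B" for x
    using B closure_subset[of "{x. f x \<noteq> 0}"] by (cases "f x = 0") auto
  then show ?thesis by (rule that)
qed

lemma cc_function_continuous: "cc_function f \<Longrightarrow> continuous_on UNIV f"
  by (simp add: cc_function_def)

lemma cc_function_norm_powr:
  assumes "cc_function f" "0 < r"
  shows "cc_function (\<lambda>x. norm (f x) powr r)"
  using assms by (intro cc_function_compose[of f "\<lambda>z. norm z powr r"] continuous_on_powr' continuous_intros) auto

text \<open>An entry \<open>(e, u, v, c)\<close> is an independent jump taken with probability
  \<open>e\<close>: it moves the argument of \<open>f\<close> by \<open>u\<close> and that of
  \<open>g\<close> by \<open>v\<close>, and the corresponding martingale difference of
  \<open>f\<close> is multiplied by \<open>c\<close>.\<close>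

type_synonym 'a jump = "real \<times> 'a \<times> 'a \<times> complex"

definition valid_jumps :: "'a jump list \<Rightarrow> bool" where
  "valid_jumps js \<longleftrightarrow> (\<forall>(e, u, v, c) \<in> set js. 0 \<le> e \<and> e \<le> 1 \<and> cmod c \<le> 1)"

lemma valid_jumps_simps [simp]:
  "valid_jumps []"
  "valid_jumps ((e, u, v, c) # js) \<longleftrightarrow> 0 \<le> e \<and> e \<le> 1 \<and> cmod c \<le> 1 \<and> valid_jumps js"
  by (auto simp: valid_jumps_def)

text \<open>The head of the list is the first jump in time. So \<open>left_mean js f\<close>,
  evaluated where the head has led, is the conditional expectation after the first jump.\<close>

fun left_mean :: "'a::plus jump list \<Rightarrow> ('a \<Rightarrow> 'b::real_vector) \<Rightarrow> 'a \<Rightarrow> 'b" where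
  "left_mean [] f x = f x"
| "left_mean ((e, u, v, c) # js) f x =
     (1 - e) *\<^sub>R left_mean js f x + e *\<^sub>R left_mean js f (x + u)"

fun right_mean :: "'a::plus jump list \<Rightarrow> ('a \<Rightarrow> 'b::real_vector) \<Rightarrow> 'a \<Rightarrow> 'b" where
  "right_mean [] f x = f x"
| "right_mean ((e, u, v, c) # js) f x =
     (1 - e) *\<^sub>R right_mean js f x + e *\<^sub>R right_mean js f (x + v)"

lemma mean_Nil [simp]: "left_mean [] f = f" "right_mean [] f = f"
  by (simp_all add: fun_eq_iff)

text \<open>The expectation of the martingale transform of \<open>f\<close> (multipliers
  \<open>c\<close>, starting value 0) times the final value of \<open>g\<close>, both walks using
  the same jumps. The first difference sees \<open>g\<close> only through its conditional
  expectation \<open>right_mean js g\<close>.\<close>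

fun transform_form ::
  "'a::plus jump list \<Rightarrow> ('a \<Rightarrow> complex) \<Rightarrow> ('a \<Rightarrow> complex) \<Rightarrow> 'a \<Rightarrow> 'a \<Rightarrow> complex" where
  "transform_form [] f g x y = 0"
| "transform_form ((e, u, v, c) # js) f g x y =
     (1 - e) *\<^sub>R (c * (left_mean js f x - left_mean ((e, u, v, c) # js) f x) * right_mean js g y
       + transform_form js f g x y)
     + e *\<^sub>R (c * (left_mean js f (x + u) - left_mean ((e, u, v, c) # js) f x) * right_mean js g (y + v)
       + transform_form js f g (x + u) (y + v))"

text \<open>The transform starts from an arbitrary value \<open>Y\<close>, since after one jump it
  has become \<open>Y0\<close> or \<open>Y1\<close>. The induction is the supermartingale property
  of Burkholder's function along the pair formed by the martingale and its transform.\<close>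

lemma transform_form_bound:
  fixes f g :: "'a::euclidean_space \<Rightarrow> complex"
  assumes p: "2 \<le> p" and q: "1 / p + 1 / q = 1" and js: "valid_jumps js"
  shows "cmod (Y * right_mean js g y + transform_form js f g x y)
    \<le> (burkholder_constant p * burkholder_function p (left_mean js f x) Y
        + (p - 1) powr p * left_mean js (\<lambda>x. cmod (f x) powr p) x) / p
      + right_mean js (\<lambda>x. cmod (g x) powr q) y / q"
  using js
proof (induction js arbitrary: x y Y)
  case Nil
  have q1: "1 < q"
  proof -
    have "1 / q = 1 - 1 / p" using q by simp
    moreover have "0 < 1 - 1 / p" "1 - 1 / p < 1" using p by (auto simp: field_simps)
    ultimately show ?thesis by (metis divide_less_eq_1_pos less_divide_eq_1_pos zero_less_divide_1_iff)
  qed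
  \<comment> \<open>At the terminal time Young's inequality separates \<open>Y\<close> from
    \<open>g\<close>, and the majorant brings in \<open>f x\<close>.\<close>
  have "cmod (Y * g y) \<le> cmod Y powr p / p + cmod (g y) powr q / q"
    unfolding norm_mult using p q q1 by (intro Youngs_inequality) auto
  also have "\<dots> \<le> (burkholder_constant p * burkholder_function p (f x) Y
      + (p - 1) powr p * cmod (f x) powr p) / p + cmod (g y) powr q / q"
    using burkholder_majorant[OF p, of Y "f x"] p
    by (intro add_right_mono divide_right_mono) auto
  finally show ?case by simp
next
  case (Cons j js)
  obtain e u v c where j: "j = (e, u, v, c)" by (cases j)
  have e: "0 \<le> e" "e \<le> 1" and c: "cmod c \<le> 1" and js: "valid_jumps js"
    using Cons.prems by (auto simp: j)
  let ?L = "left_mean js f" and ?R = "right_mean js g"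
  let ?L' = "(1 - e) *\<^sub>R ?L x + e *\<^sub>R ?L (x + u)"
  let ?U = "burkholder_function p"
  define Y0 Y1 where "Y0 = Y + c * (?L x - ?L')" and "Y1 = Y + c * (?L (x + u) - ?L')"
  let ?F = "left_mean js (\<lambda>x. cmod (f x) powr p)" and ?G = "right_mean js (\<lambda>x. cmod (g x) powr q)"
  let ?\<alpha> = "burkholder_constant p" and ?\<kappa> = "(p - 1) powr p"
  \<comment> \<open>The transform changes by \<open>c\<close> times the change of the martingale;
    with \<open>cmod c <= 1\<close> this is the spread condition of the two-point
    inequality.\<close>
  have "Y0 - Y1 = c * (?L x - ?L (x + u))" by (simp add: Y0_def Y1_def algebra_simps)
  then have "cmod (Y0 - Y1) \<le> cmod (?L x - ?L (x + u))"
    using c by (simp add: norm_mult mult_left_le_one_le)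
  then have "(1 - e) * ?U (?L x) Y0 + e * ?U (?L (x + u)) Y1
      \<le> ?U ?L' ((1 - e) *\<^sub>R Y0 + e *\<^sub>R Y1)"
    using e by (intro burkholder_function_two_point p) auto
  also have "(1 - e) *\<^sub>R Y0 + e *\<^sub>R Y1 = Y"
    by (simp add: Y0_def Y1_def scaleR_conv_of_real algebra_simps)
  finally have U: "?\<alpha> * ((1 - e) * ?U (?L x) Y0 + e * ?U (?L (x + u)) Y1) \<le> ?\<alpha> * ?U ?L' Y"
    using burkholder_constant_ge_1[OF p] by (intro mult_left_mono) auto
  have eq: "Y * right_mean (j # js) g y + transform_form (j # js) f g x y
      = (1 - e) *\<^sub>R (Y0 * ?R y + transform_form js f g x y)
        + e *\<^sub>R (Y1 * ?R (y + v) + transform_form js f g (x + u) (y + v))"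
    by (simp add: j Y0_def Y1_def scaleR_conv_of_real algebra_simps)
  have "cmod (Y * right_mean (j # js) g y + transform_form (j # js) f g x y)
      \<le> (1 - e) * cmod (Y0 * ?R y + transform_form js f g x y)
        + e * cmod (Y1 * ?R (y + v) + transform_form js f g (x + u) (y + v))"
    unfolding eq using e by (intro order_trans[OF norm_triangle_ineq]) auto
  also have "\<dots> \<le> (1 - e) * ((?\<alpha> * ?U (?L x) Y0 + ?\<kappa> * ?F x) / p + ?G y / q)
      + e * ((?\<alpha> * ?U (?L (x + u)) Y1 + ?\<kappa> * ?F (x + u)) / p + ?G (y + v) / q)"
    using e by (intro add_mono mult_left_mono Cons.IH js) auto
  also have "\<dots> = (?\<alpha> * ((1 - e) * ?U (?L x) Y0 + e * ?U (?L (x + u)) Y1)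
      + ?\<kappa> * ((1 - e) * ?F x + e * ?F (x + u))) / p + ((1 - e) * ?G y + e * ?G (y + v)) / q"
    by (simp add: add_divide_distrib diff_divide_distrib algebra_simps)
  also have "\<dots> \<le> (?\<alpha> * ?U ?L' Y + ?\<kappa> * ((1 - e) * ?F x + e * ?F (x + u))) / p
      + ((1 - e) * ?G y + e * ?G (y + v)) / q"
    using U p by (intro add_right_mono divide_right_mono) auto
  finally show ?case by (simp add: j)
qed

lemma left_mean_integral:
  fixes h :: "'a::euclidean_space \<Rightarrow> real"
  assumes h: "integrable lborel h"
  shows "integrable lborel (left_mean js h)" "(LINT x|lborel. left_mean js h x) = (LINT x|lborel. h x)"
proof (induction js)
  case (Cons j js)
  obtain e u v c where j: "j = (e, u, v, c)" by (cases j)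
  have e: "left_mean (j # js) h = (\<lambda>x. (1 - e) * left_mean js h x + e * left_mean js h (x + u))"
    by (simp add: j fun_eq_iff)
  have i: "integrable lborel (\<lambda>x. left_mean js h (x + u))"
    by (rule lborel_integrable_translate[OF Cons.IH(1)])
  {
    case 1
    show ?case unfolding e using Cons.IH(1) i by simp
  next
    case 2
    show ?case unfolding e using Cons.IH i by (simp add: lborel_integral_translate algebra_simps)
  }
qed (use h in auto)

lemma right_mean_integral:
  fixes h :: "'a::euclidean_space \<Rightarrow> real"
  assumes h: "integrable lborel h"
  shows "integrable lborel (right_mean js h)" "(LINT x|lborel. right_mean js h x) = (LINT x|lborel. h x)"
proof (induction js)
  case (Cons j js)
  obtain e u v c where j: "j = (e, u, v, c)" by (cases j)
  have e: "right_mean (j # js) h = (\<lambda>x. (1 - e) * right_mean js h x + e * right_mean js h (x + v))"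
    by (simp add: j fun_eq_iff)
  have i: "integrable lborel (\<lambda>x. right_mean js h (x + v))"
    by (rule lborel_integrable_translate[OF Cons.IH(1)])
  {
    case 1
    show ?case unfolding e using Cons.IH(1) i by simp
  next
    case 2
    show ?case unfolding e using Cons.IH i by (simp add: lborel_integral_translate algebra_simps)
  }
qed (use h in auto)

section \<open>Symbols of the finite transforms\<close>

definition wave :: "'a::real_inner \<Rightarrow> 'a \<Rightarrow> complex" where
  "wave \<xi> u = exp (\<i> * complex_of_real (\<xi> \<bullet> u))"

lemma wave_measurable [measurable]:
  "(\<lambda>\<xi>. wave \<xi> u) \<in> borel_measurable (borel :: 'a::euclidean_space measure)"
  unfolding wave_def by measurable

lemma wave_simps [simp]:
  "cmod (wave \<xi> u) = 1" "wave \<xi> 0 = 1" "wave 0 u = 1"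
  by (auto simp: wave_def)

lemma wave_add: "wave \<xi> (u + v) = wave \<xi> u * wave \<xi> v"
  by (simp add: wave_def inner_add_right exp_add ring_distribs)

lemma wave_minus: "wave \<xi> (- u) = cnj (wave \<xi> u)"
  by (simp add: wave_def exp_cnj)

lemma wave_diff: "wave \<xi> (u - v) = wave \<xi> u * cnj (wave \<xi> v)"
  using wave_add[of \<xi> u "- v"] by (simp add: wave_minus)

text \<open>The pairing \<open>dual_form\<close> on the frequency side. It makes sense for every
  bounded measurable \<open>m\<close> and all continuous compactly supported \<open>f\<close> and
  \<open>g\<close>.\<close>

definition spectral_form ::
  "('a::euclidean_space \<Rightarrow> complex) \<Rightarrow> ('a \<Rightarrow> complex) \<Rightarrow> ('a \<Rightarrow> complex) \<Rightarrow> complex" where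
  "spectral_form f g m = (LINT \<xi>|lborel. m \<xi> * (fourier f \<xi> * fourier g (- \<xi>)))
     / complex_of_real ((2 * pi) ^ DIM('a))"

lemma spectral_form_integrable:
  fixes f g :: "'a::euclidean_space \<Rightarrow> complex"
  assumes f: "cc_function f" and g: "cc_function g"
    and [measurable]: "m \<in> borel_measurable borel" and m: "\<And>\<xi>. cmod (m \<xi>) \<le> C"
  shows "integrable lborel (\<lambda>\<xi>. m \<xi> * (fourier f \<xi> * fourier g (- \<xi>)))"
proof -
  obtain K K' where K: "\<And>x. cmod (f x) \<le> K" "\<And>x. cmod (g x) \<le> K'"
    using cc_function_bounded[OF f] cc_function_bounded[OF g] by metis
  have i: "integrable lborel (\<lambda>\<xi>. fourier f \<xi> * fourier g (- \<xi>))"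
    using f g K by (intro fourier_mult_integrable) (auto intro: cc_function_integrable cc_function_continuous)
  have "0 \<le> C" using m[of 0] norm_ge_zero order_trans by blast
  then show ?thesis
    using borel_measurable_integrable[OF i] m
    by (intro Bochner_Integration.integrable_bound[OF integrable_mult_right[OF i, of "complex_of_real C"]])
       (auto simp: norm_mult intro!: mult_right_mono)
qed

text \<open>The shifts by \<open>v\<close> and \<open>w\<close> make the notion stable under the translations in the two
  arguments that occur in the recursion.\<close>

definition has_symbol ::
  "('a::euclidean_space \<Rightarrow> complex) \<Rightarrow> ('a \<Rightarrow> complex) \<Rightarrow> ('a \<Rightarrow> 'a \<Rightarrow> complex) \<Rightarrow> ('a \<Rightarrow> complex) \<Rightarrow> bool"
  where "has_symbol f g K m \<longleftrightarrow>
     m \<in> borel_measurable borel \<and> (\<exists>C. \<forall>\<xi>. cmod (m \<xi>) \<le> C) \<and>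
     (\<forall>v w. integrable lborel (\<lambda>x. K (x + v) (x + w)) \<and>
       (LINT x|lborel. K (x + v) (x + w)) = spectral_form f g (\<lambda>\<xi>. m \<xi> * wave \<xi> (w - v)))"

context
  fixes f g :: "'a::euclidean_space \<Rightarrow> complex"
  assumes f: "cc_function f" and g: "cc_function g"
begin

lemma spectral_form_wave_integrable:
  assumes [measurable]: "m \<in> borel_measurable borel" and m: "\<And>\<xi>. cmod (m \<xi>) \<le> C"
  shows "integrable lborel (\<lambda>\<xi>. m \<xi> * wave \<xi> u * (fourier f \<xi> * fourier g (- \<xi>)))"
  using m by (intro spectral_form_integrable[OF f g, where C=C]) (auto simp: norm_mult)

lemma has_symbol_product: "has_symbol f g (\<lambda>x y. f x * g y) (\<lambda>_. 1)"
  unfolding has_symbol_def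
proof (intro conjI allI)
  fix v w :: 'a
  obtain K K' where K: "\<And>x. cmod (f x) \<le> K" "\<And>x. cmod (g x) \<le> K'"
    using cc_function_bounded[OF f] cc_function_bounded[OF g] by metis
  have shift: "integrable lborel (\<lambda>x. h (x + s))" "continuous_on UNIV (\<lambda>x. h (x + s))"
    if "cc_function h" for h :: "'a \<Rightarrow> complex" and s
  proof -
    show "integrable lborel (\<lambda>x. h (x + s))"
      using cc_function_integrable[OF that] by (rule lborel_integrable_translate)
    show "continuous_on UNIV (\<lambda>x. h (x + s))"
      by (rule continuous_on_compose2[OF cc_function_continuous[OF that]]) (auto intro!: continuous_intros)
  qed
  show "integrable lborel (\<lambda>x. f (x + v) * g (x + w))"
    using borel_measurable_integrable[OF shift(1)[OF f, of v]] borel_measurable_integrable[OF shift(1)[OF g, of w]] K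
    by (intro Bochner_Integration.integrable_bound[OF integrable_mult_right[OF shift(1)[OF g, of w], of "complex_of_real K"]])
       (auto simp: norm_mult intro!: mult_right_mono order_trans[OF K(1)])
  have "(LINT \<xi>|lborel. fourier (\<lambda>x. f (x + v)) \<xi> * fourier (\<lambda>x. g (x + w)) (- \<xi>))
      = complex_of_real ((2 * pi) ^ DIM('a)) * (LINT x|lborel. f (x + v) * g (x + w))"
    by (rule parseval[where K=K and K'=K']) (use f g K shift in auto)
  moreover have "fourier (\<lambda>x. f (x + v)) \<xi> * fourier (\<lambda>x. g (x + w)) (- \<xi>)
      = 1 * wave \<xi> (w - v) * (fourier f \<xi> * fourier g (- \<xi>))" for \<xi>
    by (simp add: fourier_translate wave_def inner_diff_right exp_diff ring_distribs exp_minus divide_inverse)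
  ultimately show "(LINT x|lborel. f (x + v) * g (x + w)) = spectral_form f g (\<lambda>\<xi>. 1 * wave \<xi> (w - v))"
    by (simp add: spectral_form_def)
qed (auto intro: exI[of _ 1])

lemma has_symbol_add:
  assumes K: "has_symbol f g K m" and K': "has_symbol f g K' m'"
  shows "has_symbol f g (\<lambda>x y. K x y + K' x y) (\<lambda>\<xi>. m \<xi> + m' \<xi>)"
proof -
  obtain C C' where C: "\<And>\<xi>. cmod (m \<xi>) \<le> C" "\<And>\<xi>. cmod (m' \<xi>) \<le> C'"
    using K K' unfolding has_symbol_def by metis
  have "cmod (m \<xi> + m' \<xi>) \<le> C + C'" for \<xi>
    using C by (intro norm_triangle_le add_mono)
  moreover have "spectral_form f g (\<lambda>\<xi>. (m \<xi> + m' \<xi>) * wave \<xi> u)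
      = spectral_form f g (\<lambda>\<xi>. m \<xi> * wave \<xi> u) + spectral_form f g (\<lambda>\<xi>. m' \<xi> * wave \<xi> u)" for u
    unfolding spectral_form_def add_divide_distrib[symmetric]
    using K K' C by (subst Bochner_Integration.integral_add[symmetric])
      (auto simp: has_symbol_def ring_distribs intro!: spectral_form_wave_integrable)
  ultimately show ?thesis using K K' unfolding has_symbol_def by auto
qed

lemma has_symbol_cmult:
  assumes K: "has_symbol f g K m"
  shows "has_symbol f g (\<lambda>x y. a * K x y) (\<lambda>\<xi>. a * m \<xi>)"
proof -
  obtain C where C: "\<And>\<xi>. cmod (m \<xi>) \<le> C" using K unfolding has_symbol_def by metis
  have "cmod (a * m \<xi>) \<le> cmod a * C" for \<xi> using C by (simp add: norm_mult mult_left_mono)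
  moreover have "spectral_form f g (\<lambda>\<xi>. a * m \<xi> * wave \<xi> u) = a * spectral_form f g (\<lambda>\<xi>. m \<xi> * wave \<xi> u)" for u
    unfolding spectral_form_def mult.assoc integral_mult_right_zero by simp
  ultimately show ?thesis using K unfolding has_symbol_def by auto
qed

lemma has_symbol_shift:
  assumes K: "has_symbol f g K m"
  shows "has_symbol f g (\<lambda>x y. K (x + s) (y + t)) (\<lambda>\<xi>. wave \<xi> (t - s) * m \<xi>)"
proof -
  have e: "K (x + v + s) (x + w + t) = K (x + (v + s)) (x + (w + t))" for x v w
    by (simp add: add.assoc)
  have "wave \<xi> (w + t - (v + s)) = wave \<xi> (t - s) * wave \<xi> (w - v)" for \<xi> v w
    unfolding wave_add[symmetric] by (simp add: algebra_simps)
  then show ?thesis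
    using K unfolding has_symbol_def e by (auto simp: norm_mult mult_ac)
qed

end

text \<open>The characteristic function of the law with mass \<open>e\<close> at \<open>u\<close>
  and \<open>1 - e\<close> at 0.\<close>

definition jump_symbol :: "real \<Rightarrow> 'a::real_inner \<Rightarrow> 'a \<Rightarrow> complex" where
  "jump_symbol e u \<xi> = 1 + e *\<^sub>R (wave \<xi> u - 1)"

text \<open>A product of two means behaves as if the arguments were moved by independent copies of
  the jumps, hence two factors per entry.\<close>

fun mean_symbol :: "'a::real_inner jump list \<Rightarrow> 'a \<Rightarrow> complex" where
  "mean_symbol [] \<xi> = 1"
| "mean_symbol ((e, u, v, c) # js) \<xi> =
     jump_symbol e v \<xi> * jump_symbol e (- u) \<xi> * mean_symbol js \<xi>"

text \<open>The difference in parentheses is a covariance: joint jump minus separate averages. Jumps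
  after the active one enter through \<open>mean_symbol\<close>, jumps before it through the joint
  factor \<open>jump_symbol e (v - u)\<close>.\<close>

fun form_symbol :: "'a::real_inner jump list \<Rightarrow> 'a \<Rightarrow> complex" where
  "form_symbol [] \<xi> = 0"
| "form_symbol ((e, u, v, c) # js) \<xi> =
     c * (jump_symbol e (v - u) \<xi> - jump_symbol e v \<xi> * jump_symbol e (- u) \<xi>) * mean_symbol js \<xi>
     + jump_symbol e (v - u) \<xi> * form_symbol js \<xi>"

context
  fixes f g :: "'a::euclidean_space \<Rightarrow> complex"
  assumes f: "cc_function f" and g: "cc_function g"
begin

lemma has_symbol_mean:
  "has_symbol f g (\<lambda>x y. left_mean js f x * right_mean js g y) (mean_symbol js)"
proof (induction js)
  case Nil
  show ?case using has_symbol_product[OF f g] by simp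
next
  case (Cons j js)
  obtain e u v c where j: "j = (e, u, v, c)" by (cases j)
  let ?K = "\<lambda>x y. left_mean js f x * right_mean js g y"
  note shift = has_symbol_shift[OF f g Cons.IH]
  \<comment> \<open>Averaging separately gives four combinations of jumping and staying.\<close>
  have "has_symbol f g
    (\<lambda>x y. complex_of_real ((1 - e) * (1 - e)) * ?K (x + 0) (y + 0) + complex_of_real ((1 - e) * e) * ?K (x + 0) (y + v)
       + complex_of_real (e * (1 - e)) * ?K (x + u) (y + 0) + complex_of_real (e * e) * ?K (x + u) (y + v))
    (\<lambda>\<xi>. complex_of_real ((1 - e) * (1 - e)) * (wave \<xi> (0 - 0) * mean_symbol js \<xi>)
       + complex_of_real ((1 - e) * e) * (wave \<xi> (v - 0) * mean_symbol js \<xi>)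
       + complex_of_real (e * (1 - e)) * (wave \<xi> (0 - u) * mean_symbol js \<xi>)
       + complex_of_real (e * e) * (wave \<xi> (v - u) * mean_symbol js \<xi>))"
    by (intro has_symbol_add[OF f g] has_symbol_cmult[OF f g] shift)
  moreover have "complex_of_real ((1 - e) * (1 - e)) * ?K (x + 0) (y + 0) + complex_of_real ((1 - e) * e) * ?K (x + 0) (y + v)
       + complex_of_real (e * (1 - e)) * ?K (x + u) (y + 0) + complex_of_real (e * e) * ?K (x + u) (y + v)
      = left_mean (j # js) f x * right_mean (j # js) g y" for x y
    by (simp add: j scaleR_conv_of_real algebra_simps)
  moreover have "complex_of_real ((1 - e) * (1 - e)) * (wave \<xi> (0 - 0) * mean_symbol js \<xi>)
       + complex_of_real ((1 - e) * e) * (wave \<xi> (v - 0) * mean_symbol js \<xi>)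
       + complex_of_real (e * (1 - e)) * (wave \<xi> (0 - u) * mean_symbol js \<xi>)
       + complex_of_real (e * e) * (wave \<xi> (v - u) * mean_symbol js \<xi>) = mean_symbol (j # js) \<xi>" for \<xi>
    by (simp add: j jump_symbol_def wave_diff wave_minus scaleR_conv_of_real algebra_simps)
  ultimately show ?case by simp
qed

lemma has_symbol_transform_form: "has_symbol f g (transform_form js f g) (form_symbol js)"
proof (induction js)
  case Nil
  show ?case using has_symbol_cmult[OF f g has_symbol_product[OF f g], of 0] by simp
next
  case (Cons j js)
  obtain e u v c where j: "j = (e, u, v, c)" by (cases j)
  let ?K = "\<lambda>x y. left_mean js f x * right_mean js g y"
  let ?T = "transform_form js f g"
  let ?a = "complex_of_real (1 - e)" and ?b = "complex_of_real e"
  note shift = has_symbol_shift[OF f g has_symbol_mean] has_symbol_shift[OF f g Cons.IH]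
  \<comment> \<open>\<open>left_mean (j # js) f x\<close> is common to both branches, so its two
    contributions add up to a single product of means at \<open>(x, y)\<close>.\<close>
  have "has_symbol f g
    (\<lambda>x y. c * (?a * ?K (x + 0) (y + 0) + ?b * ?K (x + u) (y + v)
          + (-1) * (left_mean (j # js) f x * right_mean (j # js) g y))
       + (?a * ?T (x + 0) (y + 0) + ?b * ?T (x + u) (y + v)))
    (\<lambda>\<xi>. c * (?a * (wave \<xi> (0 - 0) * mean_symbol js \<xi>) + ?b * (wave \<xi> (v - u) * mean_symbol js \<xi>)
          + (-1) * mean_symbol (j # js) \<xi>)
       + (?a * (wave \<xi> (0 - 0) * form_symbol js \<xi>) + ?b * (wave \<xi> (v - u) * form_symbol js \<xi>)))"
    by (intro has_symbol_add[OF f g] has_symbol_cmult[OF f g] shift has_symbol_mean)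
  moreover have "c * (?a * ?K (x + 0) (y + 0) + ?b * ?K (x + u) (y + v)
          + (-1) * (left_mean (j # js) f x * right_mean (j # js) g y))
       + (?a * ?T (x + 0) (y + 0) + ?b * ?T (x + u) (y + v)) = transform_form (j # js) f g x y" for x y
    by (simp add: j scaleR_conv_of_real algebra_simps)
  moreover have "c * (?a * (wave \<xi> (0 - 0) * mean_symbol js \<xi>) + ?b * (wave \<xi> (v - u) * mean_symbol js \<xi>)
          + (-1) * mean_symbol (j # js) \<xi>)
       + (?a * (wave \<xi> (0 - 0) * form_symbol js \<xi>) + ?b * (wave \<xi> (v - u) * form_symbol js \<xi>))
       = form_symbol (j # js) \<xi>" for \<xi>
    by (simp add: j jump_symbol_def scaleR_conv_of_real algebra_simps)
  ultimately show ?case by simp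
qed

end

section \<open>The bilinear estimate for finitely many jumps\<close>

text \<open>An additive bound that survives scaling of both functions is a product bound: take
  \<open>s = 1 / a\<close> and \<open>t = 1 / b\<close>. If one norm vanishes, scaling that function
  alone forces \<open>l <= 0\<close>.\<close>

lemma young_homogeneous:
  fixes a b l :: real
  assumes p: "0 < p" and q: "0 < q" and pq: "1 / p + 1 / q = 1" and a: "0 \<le> a" and b: "0 \<le> b"
    and le: "\<And>s t. 0 < s \<Longrightarrow> 0 < t \<Longrightarrow> s * t * l \<le> (s * a) powr p / p + (t * b) powr q / q"
  shows "l \<le> a * b"
proof (cases "a = 0 \<or> b = 0")
  case False
  with a b le[of "1 / a" "1 / b"] pq show ?thesis by (simp add: field_simps)
next
  case True
  have "l \<le> 0"
  proof (rule ccontr)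
    assume "\<not> l \<le> 0"
    then have l: "0 < l" by simp
    define c where "c = (if a = 0 then b powr q / q else a powr p / p)"
    have c: "0 \<le> c" using p q by (simp add: c_def)
    have bd: "s * l \<le> c" if "0 < s" for s
      using True le[of s 1] le[of 1 s] that by (auto simp: c_def split: if_splits)
    have "(c + 1) / l * l \<le> c" by (rule bd) (use c l in simp)
    then show False using l by simp
  qed
  with True show ?thesis by auto
qed

lemma spectral_form_scale:
  "spectral_form (\<lambda>x. complex_of_real s * f x) (\<lambda>x. complex_of_real t * g x) m
    = complex_of_real (s * t) * spectral_form f g m"
proof -
  have F: "fourier (\<lambda>x. complex_of_real s * h x) \<xi> = complex_of_real s * fourier h \<xi>" for s h and \<xi> :: 'a
    unfolding fourier_def by (subst integral_mult_right_zero[symmetric]) (simp add: mult_ac)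
  have "(\<lambda>\<xi>. m \<xi> * (complex_of_real s * fourier f \<xi> * (complex_of_real t * fourier g (- \<xi>))))
      = (\<lambda>\<xi>. complex_of_real (s * t) * (m \<xi> * (fourier f \<xi> * fourier g (- \<xi>))))"
    by (simp add: fun_eq_iff mult_ac)
  then show ?thesis
    unfolding spectral_form_def F by (simp only: integral_mult_right_zero times_divide_eq_right)
qed

lemma cc_function_scale: "cc_function f \<Longrightarrow> cc_function (\<lambda>x. complex_of_real s * f x)"
  by (rule cc_function_compose) (auto intro!: continuous_intros)

lemma Lp_norm_powr:
  assumes "0 < p"
  shows "Lp_norm p f powr p = (LINT x|lborel. cmod (f x) powr p)"
  using assms by (simp add: Lp_norm_def powr_powr)

lemma Lp_norm_scale:
  assumes "0 < p" "0 \<le> s"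
  shows "Lp_norm p (\<lambda>x. complex_of_real s * f x) = s * Lp_norm p f"
  using assms by (simp add: Lp_norm_def norm_mult powr_mult powr_powr)

lemma Lp_norm_nonneg: "0 \<le> Lp_norm p f"
  by (simp add: Lp_norm_def)

lemma conjugate_exponent:
  fixes p :: real
  assumes "1 < p"
  shows "1 / p + 1 / (p / (p - 1)) = 1" "1 < p / (p - 1)" "p / (p - 1) - 1 = 1 / (p - 1)"
    "p / (p - 1) / (p / (p - 1) - 1) = p"
  using assms by (auto simp: field_simps)

text \<open>\<open>transform_form_bound\<close> on the diagonal with \<open>Y = 0\<close>,
  integrated over \<open>x\<close>. Burkholder's function is nonpositive when its second argument is
  0, and averaging over jumps preserves Lebesgue integrals.\<close>

lemma form_symbol_additive_bound:
  fixes f g :: "'a::euclidean_space \<Rightarrow> complex"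
  assumes p: "2 \<le> p" and q: "q = p / (p - 1)" and js: "valid_jumps js"
    and f: "cc_function f" and g: "cc_function g"
  shows "cmod (spectral_form f g (form_symbol js)) \<le> ((p - 1) * Lp_norm p f) powr p / p + Lp_norm q g powr q / q"
proof -
  have pq: "1 / p + 1 / q = 1" "1 < q" using conjugate_exponent[of p] p q by auto
  let ?T = "\<lambda>x. transform_form js f g x x"
  let ?F = "\<lambda>x. cmod (f x) powr p" and ?G = "\<lambda>x. cmod (g x) powr q"
  have F: "integrable lborel ?F" and G: "integrable lborel ?G"
    using p pq by (auto intro!: cc_function_integrable cc_function_norm_powr f g)
  note F' = left_mean_integral[OF F, of js] and G' = right_mean_integral[OF G, of js]
  have T: "integrable lborel ?T" "(LINT x|lborel. ?T x) = spectral_form f g (form_symbol js)"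
    using has_symbol_transform_form[OF f g, of js] unfolding has_symbol_def
    by (auto dest!: spec[of _ 0])
  have "cmod (spectral_form f g (form_symbol js))
      \<le> (LINT x|lborel. (p - 1) powr p / p * left_mean js ?F x + right_mean js ?G x / q)"
    unfolding T(2)[symmetric]
  proof (rule Bochner_Integration.integral_norm_bound_integral[OF T(1)])
    show "integrable lborel (\<lambda>x. (p - 1) powr p / p * left_mean js ?F x + right_mean js ?G x / q)"
      using F' G' by auto
    fix x :: 'a
    have "burkholder_constant p * burkholder_function p (left_mean js f x) 0 \<le> 0"
      using burkholder_constant_ge_1[OF p] p
      by (auto simp: burkholder_function_def intro!: mult_nonneg_nonpos mult_nonpos_nonneg)
    then have "(burkholder_constant p * burkholder_function p (left_mean js f x) 0
        + (p - 1) powr p * left_mean js ?F x) / p \<le> (p - 1) powr p * left_mean js ?F x / p"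
      using p by (intro divide_right_mono) auto
    then show "norm (?T x) \<le> (p - 1) powr p / p * left_mean js ?F x + right_mean js ?G x / q"
      using transform_form_bound[OF p pq(1) js, of 0 g x f x] by simp
  qed
  also have "\<dots> = (p - 1) powr p / p * (LINT x|lborel. ?F x) + (LINT x|lborel. ?G x) / q"
    using F' G' by simp
  also have "\<dots> = ((p - 1) * Lp_norm p f) powr p / p + Lp_norm q g powr q / q"
    using p pq by (simp add: powr_mult Lp_norm_nonneg Lp_norm_powr)
  finally show ?thesis .
qed

theorem form_symbol_Lp_bound:
  fixes f g :: "'a::euclidean_space \<Rightarrow> complex"
  assumes p: "2 \<le> p" and js: "valid_jumps js"
    and f: "cc_function f" and g: "cc_function g"
  shows "cmod (spectral_form f g (form_symbol js)) \<le> (p - 1) * Lp_norm p f * Lp_norm (p / (p - 1)) g"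
proof -
  define q where "q = p / (p - 1)"
  have pq: "1 / p + 1 / q = 1" "1 < q" using conjugate_exponent[of p] p q_def by auto
  show ?thesis unfolding q_def[symmetric]
  proof (rule young_homogeneous[OF _ _ pq(1)])
    fix s t :: real assume st: "0 < s" "0 < t"
    show "s * t * cmod (spectral_form f g (form_symbol js))
        \<le> (s * ((p - 1) * Lp_norm p f)) powr p / p + (t * Lp_norm q g) powr q / q"
      using form_symbol_additive_bound[OF p q_def js cc_function_scale[OF f, of s] cc_function_scale[OF g, of t]] st p pq
      by (simp add: spectral_form_scale norm_mult Lp_norm_scale mult_ac)
  qed (use p pq in \<open>auto simp: Lp_norm_nonneg\<close>)
qed

section \<open>The pointwise bound of the symbols by 1\<close>

lemma jump_symbol_minus: "jump_symbol e (- u) \<xi> = cnj (jump_symbol e u \<xi>)"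
  by (simp add: jump_symbol_def wave_minus)

text \<open>The subtracted term is the variance of the phase \<open>wave \<xi>\<close> at a
  two-point jump.\<close>

lemma norm_jump_symbol:
  "(cmod (jump_symbol e u \<xi>))\<^sup>2 = 1 - e * (1 - e) * (cmod (wave \<xi> u - 1))\<^sup>2"
proof -
  let ?w = "wave \<xi> u"
  have w: "Re ?w * Re ?w + Im ?w * Im ?w = 1"
    using cmod_power2[of ?w] by (simp add: power2_eq_square)
  show ?thesis
    unfolding jump_symbol_def cmod_power2 using w
    by (simp add: power2_eq_square) (simp add: algebra_simps, algebra)
qed

lemma norm_jump_symbol_le_1:
  assumes "0 \<le> e" "e \<le> 1"
  shows "cmod (jump_symbol e u \<xi>) \<le> 1"
proof -
  have "(cmod (jump_symbol e u \<xi>))\<^sup>2 \<le> 1\<^sup>2"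
    unfolding norm_jump_symbol using assms by simp
  then show ?thesis by (rule power2_le_imp_le) simp
qed

text \<open>Equality in Cauchy-Schwarz: two variables that depend on one coin are affinely
  dependent, so their covariance has the product of the standard deviations as modulus.\<close>

lemma norm_jump_symbol_covariance:
  assumes e: "0 \<le> e" "e \<le> 1"
  shows "cmod (jump_symbol e (v - u) \<xi> - jump_symbol e v \<xi> * jump_symbol e (- u) \<xi>)
    = sqrt (1 - (cmod (jump_symbol e u \<xi>))\<^sup>2) * sqrt (1 - (cmod (jump_symbol e v \<xi>))\<^sup>2)"
proof -
  have "jump_symbol e (v - u) \<xi> - jump_symbol e v \<xi> * jump_symbol e (- u) \<xi>
      = complex_of_real (e * (1 - e)) * ((wave \<xi> v - 1) * cnj (wave \<xi> u - 1))"
    by (simp add: jump_symbol_def wave_diff wave_minus scaleR_conv_of_real algebra_simps)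
  then have "cmod (jump_symbol e (v - u) \<xi> - jump_symbol e v \<xi> * jump_symbol e (- u) \<xi>)
      = e * (1 - e) * (cmod (wave \<xi> v - 1) * cmod (wave \<xi> u - 1))"
    using e by (simp only: norm_mult complex_mod_cnj norm_of_real abs_mult)
  also have "\<dots> = sqrt (e * (1 - e) * (cmod (wave \<xi> u - 1))\<^sup>2) * sqrt (e * (1 - e) * (cmod (wave \<xi> v - 1))\<^sup>2)"
  proof -
    have "sqrt (d * x\<^sup>2) * sqrt (d * y\<^sup>2) = d * (y * x)" if "0 \<le> d" "0 \<le> x" "0 \<le> y" for d x y :: real
      using that by (simp add: real_sqrt_mult)
    then show ?thesis using e by simp
  qed
  finally show ?thesis by (simp add: norm_jump_symbol)
qed

lemma cauchy_schwarz_real: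
  fixes a b c d :: real
  shows "a * b + c * d \<le> sqrt (a\<^sup>2 + c\<^sup>2) * sqrt (b\<^sup>2 + d\<^sup>2)"
proof -
  have "0 \<le> (a * d - b * c)\<^sup>2" by simp
  then have "(a * b + c * d)\<^sup>2 \<le> (a\<^sup>2 + c\<^sup>2) * (b\<^sup>2 + d\<^sup>2)"
    by (simp add: power2_eq_square algebra_simps)
  then show ?thesis by (simp add: real_le_rsqrt flip: real_sqrt_mult)
qed

text \<open>In the induction \<open>\<alpha>\<close> and \<open>\<beta>\<close> are the products of
  the moduli of the jump symbols along \<open>u\<close> and along \<open>v\<close>;
  \<open>1 - \<alpha>^2\<close> and \<open>1 - \<beta>^2\<close> are the variances of the phases of
  the two walks. A new head with moduli \<open>s\<close> and \<open>t\<close> keeps the bound, by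
  Cauchy-Schwarz and \<open>(1 - s^2) * \<alpha>^2 + (1 - \<alpha>^2) = 1 - (s *
  \<alpha>)^2\<close>.\<close>

lemma form_symbol_le_1:
  assumes "valid_jumps js"
  shows "cmod (form_symbol js \<xi>) \<le> 1"
proof -
  have "\<exists>\<alpha> \<beta>. 0 \<le> \<alpha> \<and> \<alpha> \<le> 1 \<and> 0 \<le> \<beta> \<and> \<beta> \<le> 1 \<and> cmod (mean_symbol js \<xi>) = \<alpha> * \<beta>
      \<and> cmod (form_symbol js \<xi>) \<le> sqrt (1 - \<alpha>\<^sup>2) * sqrt (1 - \<beta>\<^sup>2)"
    using assms
  proof (induction js)
    case Nil
    show ?case by (intro exI[of _ 1]) simp
  next
    case (Cons j js)
    obtain e u v c where j: "j = (e, u, v, c)" by (cases j)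
    have e: "0 \<le> e" "e \<le> 1" and c: "cmod c \<le> 1" and "valid_jumps js"
      using Cons.prems by (auto simp: j)
    then obtain \<alpha> \<beta> where ab: "0 \<le> \<alpha>" "\<alpha> \<le> 1" "0 \<le> \<beta>" "\<beta> \<le> 1"
      and M: "cmod (mean_symbol js \<xi>) = \<alpha> * \<beta>"
      and F: "cmod (form_symbol js \<xi>) \<le> sqrt (1 - \<alpha>\<^sup>2) * sqrt (1 - \<beta>\<^sup>2)"
      using Cons.IH by blast
    define s t where "s = cmod (jump_symbol e u \<xi>)" and "t = cmod (jump_symbol e v \<xi>)"
    have st: "0 \<le> s" "s \<le> 1" "0 \<le> t" "t \<le> 1"
      using e by (auto simp: s_def t_def norm_jump_symbol_le_1)
    let ?cov = "jump_symbol e (v - u) \<xi> - jump_symbol e v \<xi> * jump_symbol e (- u) \<xi>"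
    have "cmod (form_symbol (j # js) \<xi>)
        \<le> cmod c * cmod ?cov * cmod (mean_symbol js \<xi>) + cmod (jump_symbol e (v - u) \<xi>) * cmod (form_symbol js \<xi>)"
      by (simp add: j norm_triangle_le norm_mult)
    also have "\<dots> \<le> 1 * cmod ?cov * cmod (mean_symbol js \<xi>) + 1 * cmod (form_symbol js \<xi>)"
      using c e by (intro add_mono mult_right_mono norm_jump_symbol_le_1) auto
    also have "\<dots> \<le> sqrt (1 - s\<^sup>2) * sqrt (1 - t\<^sup>2) * (\<alpha> * \<beta>) + sqrt (1 - \<alpha>\<^sup>2) * sqrt (1 - \<beta>\<^sup>2)"
      using F by (simp add: M norm_jump_symbol_covariance[OF e] s_def t_def)
    also have "\<dots> = (sqrt (1 - s\<^sup>2) * \<alpha>) * (sqrt (1 - t\<^sup>2) * \<beta>) + sqrt (1 - \<alpha>\<^sup>2) * sqrt (1 - \<beta>\<^sup>2)"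
      by (simp add: mult_ac)
    also have "\<dots> \<le> sqrt ((sqrt (1 - s\<^sup>2) * \<alpha>)\<^sup>2 + (sqrt (1 - \<alpha>\<^sup>2))\<^sup>2) * sqrt ((sqrt (1 - t\<^sup>2) * \<beta>)\<^sup>2 + (sqrt (1 - \<beta>\<^sup>2))\<^sup>2)"
      by (rule cauchy_schwarz_real)
    also have "(sqrt (1 - s\<^sup>2) * \<alpha>)\<^sup>2 + (sqrt (1 - \<alpha>\<^sup>2))\<^sup>2 = 1 - (s * \<alpha>)\<^sup>2"
      using st ab by (simp add: power_mult_distrib power_le_one algebra_simps)
    also have "(sqrt (1 - t\<^sup>2) * \<beta>)\<^sup>2 + (sqrt (1 - \<beta>\<^sup>2))\<^sup>2 = 1 - (t * \<beta>)\<^sup>2"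
      using st ab by (simp add: power_mult_distrib power_le_one algebra_simps)
    finally have le: "cmod (form_symbol (j # js) \<xi>) \<le> sqrt (1 - (s * \<alpha>)\<^sup>2) * sqrt (1 - (t * \<beta>)\<^sup>2)" .
    have "cmod (mean_symbol (j # js) \<xi>) = (s * \<alpha>) * (t * \<beta>)"
      by (simp add: j norm_mult M jump_symbol_minus s_def t_def mult_ac)
    with le show ?case
      using st ab by (intro exI[of _ "s * \<alpha>"] exI[of _ "t * \<beta>"]) (auto simp: mult_le_one)
  qed
  then obtain \<alpha> \<beta> where ab: "0 \<le> \<alpha>" "\<alpha> \<le> 1" "0 \<le> \<beta>" "\<beta> \<le> 1"
    and F: "cmod (form_symbol js \<xi>) \<le> sqrt (1 - \<alpha>\<^sup>2) * sqrt (1 - \<beta>\<^sup>2)"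
    by blast
  note F
  also have "sqrt (1 - \<alpha>\<^sup>2) * sqrt (1 - \<beta>\<^sup>2) \<le> 1"
    using ab by (intro mult_le_one) (auto simp: power_le_one)
  finally show ?thesis .
qed

text \<open>The bound by 1 makes the class stable under pointwise limits.\<close>

definition admissible_symbol ::
  "('a::euclidean_space \<Rightarrow> complex) \<Rightarrow> ('a \<Rightarrow> complex) \<Rightarrow> real \<Rightarrow> ('a \<Rightarrow> complex) \<Rightarrow> bool" where
  "admissible_symbol f g K m \<longleftrightarrow> m \<in> borel_measurable borel \<and> (\<forall>\<xi>. cmod (m \<xi>) \<le> 1)
     \<and> cmod (spectral_form f g m) \<le> K"

lemma admissible_form_symbol:
  fixes f g :: "'a::euclidean_space \<Rightarrow> complex"
  assumes "2 \<le> p" "valid_jumps js" "cc_function f" "cc_function g"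
  shows "admissible_symbol f g ((p - 1) * Lp_norm p f * Lp_norm (p / (p - 1)) g) (form_symbol js)"
  using form_symbol_Lp_bound[OF assms] form_symbol_le_1[OF assms(2)]
    has_symbol_transform_form[OF assms(3,4), of js]
  by (auto simp: admissible_symbol_def has_symbol_def)

text \<open>Dominated convergence; the product of the two transforms is itself the dominating
  function.\<close>

lemma admissible_symbol_limit:
  fixes f g :: "'a::euclidean_space \<Rightarrow> complex"
  assumes f: "cc_function f" and g: "cc_function g"
    and ev: "eventually (\<lambda>n. admissible_symbol f g K (m n)) sequentially"
    and lim: "\<And>\<xi>. (\<lambda>n. m n \<xi>) \<longlonglongrightarrow> l \<xi>"
  shows "admissible_symbol f g K l"
proof -
  obtain N where N: "\<And>n. N \<le> n \<Longrightarrow> admissible_symbol f g K (m n)"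
    using ev by (auto simp: eventually_sequentially)
  define M where "M n = m (n + N)" for n
  have M: "admissible_symbol f g K (M n)" for n by (simp add: M_def N)
  have limM: "(\<lambda>n. M n \<xi>) \<longlonglongrightarrow> l \<xi>" for \<xi>
    unfolding M_def using lim by (rule LIMSEQ_ignore_initial_segment)
  have [measurable]: "M n \<in> borel_measurable borel" for n using M by (simp add: admissible_symbol_def)
  have l [measurable]: "l \<in> borel_measurable borel"
    by (rule borel_measurable_LIMSEQ_metric[OF _ limM]) auto
  have le1: "cmod (l \<xi>) \<le> 1" for \<xi>
    using M by (intro LIMSEQ_le_const2[OF tendsto_norm[OF limM]]) (auto simp: admissible_symbol_def)
  have [measurable]: "f \<in> borel_measurable borel" "g \<in> borel_measurable borel"
    using borel_measurable_integrable[OF cc_function_integrable[OF f]]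
      borel_measurable_integrable[OF cc_function_integrable[OF g]] by simp_all
  let ?h = "\<lambda>\<xi>. fourier f \<xi> * fourier g (- \<xi>)"
  have h: "integrable lborel ?h"
    using spectral_form_integrable[OF f g, of "\<lambda>_. 1" 1] by simp
  have "(\<lambda>n. LINT \<xi>|lborel. M n \<xi> * ?h \<xi>) \<longlonglongrightarrow> (LINT \<xi>|lborel. l \<xi> * ?h \<xi>)"
  proof (rule integral_dominated_convergence[where w="\<lambda>\<xi>. cmod (?h \<xi>)"])
    show "AE \<xi> in lborel. (\<lambda>n. M n \<xi> * ?h \<xi>) \<longlonglongrightarrow> l \<xi> * ?h \<xi>"
      by (intro AE_I2 tendsto_mult limM tendsto_const)
    show "AE \<xi> in lborel. norm (M n \<xi> * ?h \<xi>) \<le> cmod (?h \<xi>)" for n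
      using M[of n] by (intro AE_I2) (simp add: admissible_symbol_def norm_mult mult_left_le_one_le)
  qed (use h in auto)
  then have "(\<lambda>n. spectral_form f g (M n)) \<longlonglongrightarrow> spectral_form f g l"
    unfolding spectral_form_def by (intro tendsto_intros) auto
  then have "cmod (spectral_form f g l) \<le> K"
    using M by (intro LIMSEQ_le_const2[OF tendsto_norm]) (auto simp: admissible_symbol_def)
  with l le1 show ?thesis by (simp add: admissible_symbol_def)
qed

section \<open>Many small jumps\<close>

lemma exp_quotient_tendsto: "((exp_quotient) \<longlongrightarrow> exp_quotient z) (at z)"
proof (cases "z = 0")
  case True
  have "((\<lambda>z. (exp z - 1) / z :: complex) \<longlongrightarrow> 1) (at 0)" by (rule lim_exp_minus_1)
  then have "(exp_quotient \<longlongrightarrow> 1) (at 0)"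
    by (rule Lim_transform_eventually) (auto simp: exp_quotient_def eventually_at_filter)
  then show ?thesis using True by (simp add: exp_quotient_def)
next
  case False
  have "((\<lambda>z. (exp z - 1) / z) \<longlongrightarrow> (exp z - 1) / z) (at z)"
    using False by (intro tendsto_intros)
  moreover have "eventually (\<lambda>w. (exp w - 1) / w = exp_quotient w) (at z)"
    using False t1_space_nhds[OF False] by (auto simp: exp_quotient_def eventually_at_filter elim: eventually_mono)
  ultimately show ?thesis using False by (auto simp: exp_quotient_def elim: Lim_transform_eventually)
qed

lemma isCont_exp_quotient: "isCont exp_quotient z"
  using exp_quotient_tendsto by (simp add: isCont_def)

lemma tendsto_exp_quotient [tendsto_intros]:
  "(h \<longlongrightarrow> z) F \<Longrightarrow> ((\<lambda>x. exp_quotient (h x)) \<longlongrightarrow> exp_quotient z) F"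
  by (rule isCont_tendsto_compose[OF isCont_exp_quotient])

lemma exp_quotient_mult: "z * exp_quotient z = exp z - 1"
  by (simp add: exp_quotient_def)

lemma tendsto_divide_nat: "(\<lambda>n. (z::complex) / of_nat n) \<longlonglongrightarrow> 0"
  using tendsto_mult[OF tendsto_const[of z] lim_inverse_n] by (simp add: divide_inverse)

lemma exp_quotient_divide_nat_tendsto: "(\<lambda>n. exp_quotient (z / of_nat n)) \<longlonglongrightarrow> 1"
  using tendsto_exp_quotient[OF tendsto_divide_nat, of z] by (simp add: exp_quotient_def)

lemma exp_divide_nat_tendsto: "(\<lambda>n. of_nat n * (exp ((z::complex) / of_nat n) - 1)) \<longlonglongrightarrow> z"
proof -
  have "(\<lambda>n. z * exp_quotient (z / of_nat n)) \<longlonglongrightarrow> z * 1"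
    by (intro tendsto_intros exp_quotient_divide_nat_tendsto)
  moreover have "eventually (\<lambda>n. z * exp_quotient (z / of_nat n) = of_nat n * (exp (z / of_nat n) - 1)) sequentially"
    using eventually_gt_at_top[of 0] by eventually_elim (simp flip: exp_quotient_mult)
  ultimately show ?thesis by (simp add: Lim_transform_eventually)
qed

text \<open>A Riemann sum of \<open>exp (s * z)\<close> over the unit interval. Summing the
  geometric series gives it exactly as
  \<open>exp_quotient z / exp_quotient (z / of_nat n)\<close>.\<close>

lemma geometric_mean_tendsto:
  "(\<lambda>n. (\<Sum>i<n. exp ((z::complex) / of_nat n) ^ i) / of_nat n) \<longlonglongrightarrow> exp_quotient z"
proof -
  have "(\<lambda>n. exp_quotient z / exp_quotient (z / of_nat n)) \<longlonglongrightarrow> exp_quotient z / 1"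
    by (intro tendsto_intros exp_quotient_divide_nat_tendsto) simp
  moreover have "eventually (\<lambda>n. exp_quotient (z / of_nat n) \<noteq> 0) sequentially"
    using tendsto_imp_eventually_ne[OF exp_quotient_divide_nat_tendsto, of 0] by simp
  then have "eventually (\<lambda>n. exp_quotient z / exp_quotient (z / of_nat n)
      = (\<Sum>i<n. exp (z / of_nat n) ^ i) / of_nat n) sequentially"
    using eventually_gt_at_top[of 0]
  proof eventually_elim
    case (elim n)
    show ?case
    proof (cases "z = 0")
      case True
      then show ?thesis using elim by (simp add: exp_quotient_def)
    next
      case False
      have "exp (z / of_nat n) ^ n = exp z"
        using elim by (simp flip: exp_of_nat_mult)
      then have "(exp (z / of_nat n) - 1) * (\<Sum>i<n. exp (z / of_nat n) ^ i) = exp z - 1"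
        using power_diff_1_eq[of "exp (z / of_nat n)" n] by simp
      then have "z / of_nat n * exp_quotient (z / of_nat n) * (\<Sum>i<n. exp (z / of_nat n) ^ i) = z * exp_quotient z"
        by (simp only: exp_quotient_mult)
      then show ?thesis using elim False by (simp add: field_simps)
    qed
  qed
  ultimately show ?thesis by (simp add: Lim_transform_eventually)
qed

lemma norm_exp_divide_nat_le_1:
  assumes X: "eventually (\<lambda>n. cmod (X n) \<le> 1) sequentially"
    and x: "(\<lambda>n. of_nat n * (X n - 1)) \<longlonglongrightarrow> x"
  shows "cmod (exp (x / of_nat n)) \<le> 1"
proof -
  have "Re x \<le> 0"
  proof (rule tendsto_upperbound[OF tendsto_Re[OF x]])
    show "eventually (\<lambda>n. Re (of_nat n * (X n - 1)) \<le> 0) sequentially"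
      using X
    proof eventually_elim
      case (elim n)
      have "Re (X n) \<le> 1" using elim complex_Re_le_cmod[of "X n"] by linarith
      then show ?case by (simp add: mult_nonneg_nonpos)
    qed
  qed simp
  then show ?thesis by (simp add: Re_divide_of_nat divide_nonpos_nonneg)
qed

text \<open>The source of \<open>exp_quotient\<close> in the symbol. For the exact exponentials
  \<open>E\<close> and \<open>F\<close> the sum is geometric. \<open>X\<close> and \<open>E\<close>
  differ by \<open>o(1/n)\<close>, likewise \<open>Y\<close> and \<open>F\<close>, and
  \<open>i\<close>-th powers of numbers in the unit disc differ by at most \<open>i\<close> times
  the distance of the bases.\<close>

lemma power_sum_tendsto:
  fixes X Y :: "nat \<Rightarrow> complex"
  assumes X1: "eventually (\<lambda>n. cmod (X n) \<le> 1) sequentially"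
    and Y1: "eventually (\<lambda>n. cmod (Y n) \<le> 1) sequentially"
    and x: "(\<lambda>n. of_nat n * (X n - 1)) \<longlonglongrightarrow> x"
    and y: "(\<lambda>n. of_nat n * (Y n - 1)) \<longlonglongrightarrow> y"
  shows "(\<lambda>n. (\<Sum>i<n. X n ^ i * Y n ^ (n - 1 - i)) / of_nat n) \<longlonglongrightarrow> exp y * exp_quotient (x - y)"
proof -
  define E F where "E n = exp (x / of_nat n)" and "F n = exp (y / of_nat n)" for n :: nat
  have E1: "cmod (E n) \<le> 1" and F1: "cmod (F n) \<le> 1" for n
    unfolding E_def F_def by (rule norm_exp_divide_nat_le_1[OF X1 x] norm_exp_divide_nat_le_1[OF Y1 y])+
  have lim: "(\<lambda>n. (\<Sum>i<n. E n ^ i * F n ^ (n - 1 - i)) / of_nat n) \<longlonglongrightarrow> exp y * exp_quotient (x - y)"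
  proof -
    \<comment> \<open>The exponents \<open>i\<close> and \<open>n - 1 - i\<close> add up to
      \<open>n - 1\<close>, which leaves the correction \<open>- y / n\<close>.\<close>
    have "(\<lambda>n. exp (y - y / of_nat n) * ((\<Sum>i<n. exp ((x - y) / of_nat n) ^ i) / of_nat n))
        \<longlonglongrightarrow> exp (y - 0) * exp_quotient (x - y)"
      by (intro tendsto_intros tendsto_divide_nat geometric_mean_tendsto)
    moreover have "eventually (\<lambda>n. exp (y - y / of_nat n) * ((\<Sum>i<n. exp ((x - y) / of_nat n) ^ i) / of_nat n)
        = (\<Sum>i<n. E n ^ i * F n ^ (n - 1 - i)) / of_nat n) sequentially"
      using eventually_gt_at_top[of 0]
    proof eventually_elim
      case (elim n)
      have "exp (y - y / of_nat n) * exp ((x - y) / of_nat n) ^ i = E n ^ i * F n ^ (n - 1 - i)" if "i < n" for i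
      proof -
        have "y - y / of_nat n + of_nat i * ((x - y) / of_nat n)
            = of_nat i * (x / of_nat n) + of_nat (n - 1 - i) * (y / of_nat n)"
          using that by (simp add: of_nat_diff field_simps)
        then show ?thesis
          unfolding E_def F_def by (simp only: exp_of_nat_mult[symmetric] exp_add[symmetric])
      qed
      then show ?case by (simp add: sum_distrib_left)
    qed
    ultimately show ?thesis by (simp add: Lim_transform_eventually)
  qed
  have small: "(\<lambda>n. of_nat n * cmod (X n - E n) + of_nat n * cmod (Y n - F n)) \<longlonglongrightarrow> 0"
  proof -
    have 1: "(\<lambda>n. of_nat n * (X n - 1) - of_nat n * (E n - 1)) \<longlonglongrightarrow> x - x"
      unfolding E_def by (intro tendsto_diff x exp_divide_nat_tendsto)
    have 2: "(\<lambda>n. of_nat n * (Y n - 1) - of_nat n * (F n - 1)) \<longlonglongrightarrow> y - y"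
      unfolding F_def by (intro tendsto_diff y exp_divide_nat_tendsto)
    have e: "of_nat n * (a - 1) - of_nat n * (b - 1) = of_nat n * (a - b)" for n and a b :: complex
      by (simp add: algebra_simps)
    show ?thesis
      using tendsto_add[OF tendsto_norm[OF 1] tendsto_norm[OF 2]] by (simp add: e norm_mult)
  qed
  have "(\<lambda>n. (\<Sum>i<n. X n ^ i * Y n ^ (n - 1 - i)) / of_nat n - (\<Sum>i<n. E n ^ i * F n ^ (n - 1 - i)) / of_nat n) \<longlonglongrightarrow> 0"
  proof (rule Lim_null_comparison[OF _ small])
    show "eventually (\<lambda>n. norm ((\<Sum>i<n. X n ^ i * Y n ^ (n - 1 - i)) / of_nat n - (\<Sum>i<n. E n ^ i * F n ^ (n - 1 - i)) / of_nat n)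
        \<le> of_nat n * cmod (X n - E n) + of_nat n * cmod (Y n - F n)) sequentially"
      using X1 Y1 eventually_gt_at_top[of 0]
    proof eventually_elim
      case (elim n)
      let ?B = "of_nat n * cmod (X n - E n) + of_nat n * cmod (Y n - F n)"
      have "cmod (X n ^ i * Y n ^ (n - 1 - i) - E n ^ i * F n ^ (n - 1 - i)) \<le> ?B" if "i < n" for i
      proof -
        have "X n ^ i * Y n ^ (n - 1 - i) - E n ^ i * F n ^ (n - 1 - i)
            = (X n ^ i - E n ^ i) * Y n ^ (n - 1 - i) + E n ^ i * (Y n ^ (n - 1 - i) - F n ^ (n - 1 - i))"
          by (simp add: algebra_simps)
        also have "cmod \<dots> \<le> cmod (X n ^ i - E n ^ i) * 1 + 1 * cmod (Y n ^ (n - 1 - i) - F n ^ (n - 1 - i))"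
          unfolding norm_mult using elim E1
          by (intro norm_triangle_le add_mono) (auto simp: norm_mult norm_power intro!: mult_left_mono mult_left_le_one_le mult_left_le power_le_one)
        also have "\<dots> \<le> of_nat i * cmod (X n - E n) + of_nat (n - 1 - i) * cmod (Y n - F n)"
          unfolding mult_1_right mult_1_left using elim E1 F1 by (intro add_mono norm_power_diff) auto
        also have "\<dots> \<le> ?B"
          using that by (intro add_mono mult_right_mono) auto
        finally show ?thesis .
      qed
      then have "cmod (\<Sum>i<n. X n ^ i * Y n ^ (n - 1 - i) - E n ^ i * F n ^ (n - 1 - i)) \<le> of_nat n * ?B"
        by (intro order_trans[OF sum_norm_bound[where K="?B"]]) auto
      then show ?case
        using elim by (simp add: diff_divide_distrib[symmetric] sum_subtractf norm_divide field_simps)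
    qed
  qed
  from tendsto_add[OF this lim] show ?thesis by simp
qed

text \<open>The characteristic function of the difference of the two walks when both use the same
  jumps.\<close>

fun diff_symbol :: "'a::real_inner jump list \<Rightarrow> 'a \<Rightarrow> complex" where
  "diff_symbol [] \<xi> = 1"
| "diff_symbol ((e, u, v, c) # js) \<xi> = jump_symbol e (v - u) \<xi> * diff_symbol js \<xi>"

lemma mean_symbol_append: "mean_symbol (js @ ks) \<xi> = mean_symbol js \<xi> * mean_symbol ks \<xi>"
  by (induction js \<xi> rule: mean_symbol.induct) auto

text \<open>A product rule: if the active jump lies in \<open>js\<close>, all of \<open>ks\<close>
  is averaged separately; if it lies in \<open>ks\<close>, all of \<open>js\<close> has acted
  jointly.\<close>

lemma form_symbol_append:
  "form_symbol (js @ ks) \<xi> = form_symbol js \<xi> * mean_symbol ks \<xi> + diff_symbol js \<xi> * form_symbol ks \<xi>"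
  by (induction js \<xi> rule: form_symbol.induct) (auto simp: mean_symbol_append algebra_simps)

lemma valid_jumps_append [simp]: "valid_jumps (js @ ks) \<longleftrightarrow> valid_jumps js \<and> valid_jumps ks"
  unfolding valid_jumps_def set_append ball_Un by (rule refl)

lemma valid_jumps_replicate: "valid_jumps js \<Longrightarrow> valid_jumps (concat (replicate n js))"
  by (induction n) auto

lemma mean_symbol_replicate: "mean_symbol (concat (replicate n js)) \<xi> = mean_symbol js \<xi> ^ n"
  by (induction n) (auto simp: mean_symbol_append)

lemma form_symbol_replicate:
  "form_symbol (concat (replicate n js)) \<xi>
    = form_symbol js \<xi> * (\<Sum>i<n. diff_symbol js \<xi> ^ i * mean_symbol js \<xi> ^ (n - 1 - i))"
proof (induction n)
  case (Suc n)
  have "(\<Sum>i<Suc n. diff_symbol js \<xi> ^ i * mean_symbol js \<xi> ^ (Suc n - 1 - i))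
      = mean_symbol js \<xi> ^ n + diff_symbol js \<xi> * (\<Sum>i<n. diff_symbol js \<xi> ^ i * mean_symbol js \<xi> ^ (n - 1 - i))"
    by (subst sum.lessThan_Suc_shift) (simp add: sum_distrib_left mult_ac)
  with Suc show ?case
    by (simp add: form_symbol_append mean_symbol_replicate algebra_simps)
qed simp

lemma norm_mean_symbol_le_1: "valid_jumps js \<Longrightarrow> cmod (mean_symbol js \<xi>) \<le> 1"
  by (induction js \<xi> rule: mean_symbol.induct)
     (auto simp: norm_mult intro!: mult_le_one norm_jump_symbol_le_1)

lemma norm_diff_symbol_le_1: "valid_jumps js \<Longrightarrow> cmod (diff_symbol js \<xi>) \<le> 1"
  by (induction js \<xi> rule: diff_symbol.induct)
     (auto simp: norm_mult intro!: mult_le_one norm_jump_symbol_le_1)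

text \<open>\<open>(w, z, c)\<close> stands for mass \<open>w\<close> of the jump measure at
  \<open>z\<close>, where the modulating function has the value \<open>c\<close>.\<close>

type_synonym 'b atom = "real \<times> 'b \<times> complex"

definition valid_atoms :: "'b atom list \<Rightarrow> bool" where
  "valid_atoms xs \<longleftrightarrow> (\<forall>(w, z, c) \<in> set xs. 0 \<le> w \<and> cmod c \<le> 1)"

definition poisson_exponent :: "'b::real_inner atom list \<Rightarrow> 'b \<Rightarrow> complex" where
  "poisson_exponent xs \<zeta> = (\<Sum>(w, z, c)\<leftarrow>xs. w *\<^sub>R (wave \<zeta> z - 1))"

definition poisson_modulated :: "'b::real_inner atom list \<Rightarrow> 'b \<Rightarrow> complex" where
  "poisson_modulated xs \<zeta> = (\<Sum>(w, z, c)\<leftarrow>xs. w *\<^sub>R ((wave \<zeta> z - 1) * c))"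

text \<open>The expression that defines \<open>m\<close>, as a functional of the two exponents, so
  that approximating exponents can be inserted.\<close>

definition transform_symbol :: "('b::real_inner \<Rightarrow> complex) \<Rightarrow> ('b \<Rightarrow> complex) \<Rightarrow> 'b \<Rightarrow> 'b \<Rightarrow> complex" where
  "transform_symbol \<Psi> \<Psi>' a b = exp (\<Psi> b + \<Psi> (- a)) * (\<Psi>' (b - a) - \<Psi>' b - \<Psi>' (- a))
     * exp_quotient (\<Psi> (b - a) - \<Psi> b - \<Psi> (- a))"

lemma transform_symbol_tendsto:
  assumes "\<And>\<zeta>. (\<lambda>n. \<Psi> n \<zeta>) \<longlonglongrightarrow> \<Phi> \<zeta>" "\<And>\<zeta>. (\<lambda>n. \<Psi>' n \<zeta>) \<longlonglongrightarrow> \<Phi>' \<zeta>"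
  shows "(\<lambda>n. transform_symbol (\<Psi> n) (\<Psi>' n) a b) \<longlonglongrightarrow> transform_symbol \<Phi> \<Phi>' a b"
  unfolding transform_symbol_def by (intro tendsto_intros assms)

text \<open>Hence the compensator of the modulated exponent, which finite jump lists do not produce, can be
  added freely.\<close>

lemma transform_symbol_add_additive:
  assumes "\<And>\<zeta> \<eta>. L (\<zeta> + \<eta>) = L \<zeta> + L \<eta>"
  shows "transform_symbol \<Psi> (\<lambda>\<zeta>. \<Psi>' \<zeta> + L \<zeta>) a b = transform_symbol \<Psi> \<Psi>' a b"
  using assms[of b "- a"] by (simp add: transform_symbol_def algebra_simps)

lemma jump_symbol_limits:
  "(\<lambda>n. jump_symbol (w / real n) u \<xi>) \<longlonglongrightarrow> 1"
  "(\<lambda>n. of_nat n * (jump_symbol (w / real n) u \<xi> - 1)) \<longlonglongrightarrow> w *\<^sub>R (wave \<xi> u - 1)"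
  "(\<lambda>n. of_nat n * (jump_symbol (w / real n) (v - u) \<xi> - jump_symbol (w / real n) v \<xi> * jump_symbol (w / real n) (- u) \<xi>))
     \<longlonglongrightarrow> w *\<^sub>R (wave \<xi> (v - u) - 1) - w *\<^sub>R (wave \<xi> v - 1) - w *\<^sub>R (wave \<xi> (- u) - 1)"
proof -
  have w0: "(\<lambda>n. w / real n) \<longlonglongrightarrow> 0"
    using tendsto_mult[OF tendsto_const[of w] lim_inverse_n[where 'a=real]] by (simp add: divide_inverse)
  have "(\<lambda>n. jump_symbol (w / real n) u \<xi>) \<longlonglongrightarrow> 1 + 0 *\<^sub>R (wave \<xi> u - 1)" for u \<xi>
    unfolding jump_symbol_def by (intro tendsto_intros w0)
  then show 1: "(\<lambda>n. jump_symbol (w / real n) u \<xi>) \<longlonglongrightarrow> 1" for u \<xi> by simp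
  have eq: "eventually (\<lambda>n. w *\<^sub>R (wave \<xi> u - 1) = of_nat n * (jump_symbol (w / real n) u \<xi> - 1)) sequentially" for u \<xi>
    using eventually_gt_at_top[of 0] by eventually_elim (simp add: jump_symbol_def scaleR_conv_of_real)
  show 2: "(\<lambda>n. of_nat n * (jump_symbol (w / real n) u \<xi> - 1)) \<longlonglongrightarrow> w *\<^sub>R (wave \<xi> u - 1)" for u \<xi>
    by (rule Lim_transform_eventually[OF tendsto_const eq])
  let ?r = "\<lambda>u n. jump_symbol (w / real n) u \<xi>"
  \<comment> \<open>The covariance is written as
    \<open>(?r (v - u) - 1) - (?r v - 1) * ?r (- u) - (?r (- u) - 1)\<close>.\<close>
  have "(\<lambda>n. of_nat n * (?r (v - u) n - 1) - of_nat n * (?r v n - 1) * ?r (- u) n - of_nat n * (?r (- u) n - 1))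
     \<longlonglongrightarrow> w *\<^sub>R (wave \<xi> (v - u) - 1) - w *\<^sub>R (wave \<xi> v - 1) * 1 - w *\<^sub>R (wave \<xi> (- u) - 1)"
    by (intro tendsto_intros 1 2)
  then show "(\<lambda>n. of_nat n * (?r (v - u) n - ?r v n * ?r (- u) n))
     \<longlonglongrightarrow> w *\<^sub>R (wave \<xi> (v - u) - 1) - w *\<^sub>R (wave \<xi> v - 1) - w *\<^sub>R (wave \<xi> (- u) - 1)"
    by (simp add: algebra_simps)
qed

lemma tendsto_1_of_scaled_difference:
  fixes X :: "nat \<Rightarrow> complex"
  assumes "(\<lambda>n. of_nat n * (X n - 1)) \<longlonglongrightarrow> x"
  shows "X \<longlonglongrightarrow> 1"
proof -
  have "(\<lambda>n. inverse (of_nat n) * (of_nat n * (X n - 1)) + 1) \<longlonglongrightarrow> 0 * x + 1"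
    by (intro tendsto_intros assms lim_inverse_n)
  moreover have "eventually (\<lambda>n. inverse (of_nat n) * (of_nat n * (X n - 1)) + 1 = X n) sequentially"
    using eventually_gt_at_top[of 0] by eventually_elim (simp add: field_simps)
  ultimately show ?thesis by (simp add: Lim_transform_eventually)
qed

lemma product_scaled_difference:
  fixes X Y :: "nat \<Rightarrow> complex"
  assumes x: "(\<lambda>n. of_nat n * (X n - 1)) \<longlonglongrightarrow> x" and y: "(\<lambda>n. of_nat n * (Y n - 1)) \<longlonglongrightarrow> y"
  shows "(\<lambda>n. of_nat n * (X n * Y n - 1)) \<longlonglongrightarrow> x + y"
proof -
  have "(\<lambda>n. of_nat n * (X n - 1) * Y n + of_nat n * (Y n - 1)) \<longlonglongrightarrow> x * 1 + y"
    by (intro tendsto_intros x y tendsto_1_of_scaled_difference[OF y])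
  then show ?thesis by (simp add: algebra_simps)
qed

text \<open>One cycle of jumps, the jump along \<open>z\<close> having probability \<open>w / n\<close>; as \<open>n\<close> cycles are run,
  their law approaches the compound Poisson law with atoms \<open>w\<close> at \<open>z\<close>.\<close>

definition jump_cycle :: "('b \<Rightarrow> 'a) \<Rightarrow> ('b \<Rightarrow> 'a) \<Rightarrow> 'b atom list \<Rightarrow> nat \<Rightarrow> 'a jump list" where
  "jump_cycle S T xs n = map (\<lambda>(w, z, c). (w / real n, S z, T z, c)) xs"

context
  fixes S T :: "'b::real_inner \<Rightarrow> 'a::euclidean_space" and S' T' :: "'a \<Rightarrow> 'b"
  assumes S: "\<And>\<xi> z. \<xi> \<bullet> S z = S' \<xi> \<bullet> z" and T: "\<And>\<xi> z. \<xi> \<bullet> T z = T' \<xi> \<bullet> z"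
begin

lemma wave_adjoint:
  "wave \<xi> (S z) = wave (S' \<xi>) z" "wave \<xi> (T z) = wave (T' \<xi>) z"
  "wave \<xi> (- S z) = wave (- S' \<xi>) z" "wave \<xi> (T z - S z) = wave (T' \<xi> - S' \<xi>) z"
  by (simp_all add: wave_def S T inner_diff_left inner_diff_right)

lemma eventually_valid_cycle:
  assumes "valid_atoms xs"
  shows "eventually (\<lambda>n. valid_jumps (jump_cycle S T xs n)) sequentially"
  using assms
proof (induction xs)
  case (Cons x xs)
  obtain w z c where x: "x = (w, z, c)" by (cases x)
  have "eventually (\<lambda>n. valid_jumps (jump_cycle S T xs n)) sequentially"
    using Cons by (auto simp: valid_atoms_def)
  moreover have "eventually (\<lambda>n. w \<le> real n) sequentially"
    using filterlim_real_sequentially by (simp add: filterlim_at_top)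
  ultimately show ?case using eventually_gt_at_top[of 0]
    by eventually_elim (use Cons.prems in \<open>auto simp: jump_cycle_def x valid_atoms_def\<close>)
qed (simp add: jump_cycle_def)

text \<open>To first order in \<open>1 / n\<close> the jumps of one cycle do not interact: the other
  factors tend to 1, so each limit is a sum over the atoms.\<close>

lemma cycle_limits:
  "(\<lambda>n. of_nat n * (diff_symbol (jump_cycle S T xs n) \<xi> - 1)) \<longlonglongrightarrow> poisson_exponent xs (T' \<xi> - S' \<xi>)"
  "(\<lambda>n. of_nat n * (mean_symbol (jump_cycle S T xs n) \<xi> - 1))
    \<longlonglongrightarrow> poisson_exponent xs (T' \<xi>) + poisson_exponent xs (- S' \<xi>)"
  "(\<lambda>n. of_nat n * form_symbol (jump_cycle S T xs n) \<xi>)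
    \<longlonglongrightarrow> poisson_modulated xs (T' \<xi> - S' \<xi>) - poisson_modulated xs (T' \<xi>) - poisson_modulated xs (- S' \<xi>)"
proof (induction xs)
  case (Cons x xs)
  obtain w z c where x: "x = (w, z, c)" by (cases x)
  note IH = Cons.IH
  have cyc: "jump_cycle S T ((w, z, c) # xs) n = (w / real n, S z, T z, c) # jump_cycle S T xs n" for n
    by (simp add: jump_cycle_def)
  note M1 = tendsto_1_of_scaled_difference[OF IH(2)]
  {
    case 1
    show ?case
      using product_scaled_difference[OF jump_symbol_limits(2)[of w "T z - S z" \<xi>] IH(1)]
      by (simp add: cyc poisson_exponent_def x wave_adjoint)
  next
    case 2
    show ?case
      using product_scaled_difference[OF product_scaled_difference[OF jump_symbol_limits(2)[of w "T z" \<xi>]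
            jump_symbol_limits(2)[of w "- S z" \<xi>]] IH(2)]
      by (simp add: cyc poisson_exponent_def x wave_adjoint add_ac)
  next
    case 3
    let ?r = "\<lambda>u n. jump_symbol (w / real n) u \<xi>"
    have "(\<lambda>n. c * (of_nat n * (?r (T z - S z) n - ?r (T z) n * ?r (- S z) n)) * mean_symbol (jump_cycle S T xs n) \<xi>
          + ?r (T z - S z) n * (of_nat n * form_symbol (jump_cycle S T xs n) \<xi>))
        \<longlonglongrightarrow> c * (w *\<^sub>R (wave \<xi> (T z - S z) - 1) - w *\<^sub>R (wave \<xi> (T z) - 1) - w *\<^sub>R (wave \<xi> (- S z) - 1)) * 1
          + 1 * (poisson_modulated xs (T' \<xi> - S' \<xi>) - poisson_modulated xs (T' \<xi>) - poisson_modulated xs (- S' \<xi>))"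
      by (intro tendsto_intros jump_symbol_limits M1 IH(3))
    then show ?case
      by (simp add: cyc poisson_modulated_def x wave_adjoint scaleR_conv_of_real algebra_simps)
  }
qed (simp_all add: jump_cycle_def poisson_exponent_def poisson_modulated_def)

text \<open>In \<open>form_symbol_replicate\<close> the form symbol of one cycle is multiplied by
  \<open>n\<close> and the sum of powers divided by \<open>n\<close>; each factor then
  converges.\<close>

lemma cycles_tendsto:
  assumes xs: "valid_atoms xs"
  shows "(\<lambda>n. form_symbol (concat (replicate n (jump_cycle S T xs n))) \<xi>)
    \<longlonglongrightarrow> transform_symbol (poisson_exponent xs) (poisson_modulated xs) (S' \<xi>) (T' \<xi>)"
proof -
  let ?X = "\<lambda>n. diff_symbol (jump_cycle S T xs n) \<xi>" and ?Y = "\<lambda>n. mean_symbol (jump_cycle S T xs n) \<xi>"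
  have X1: "eventually (\<lambda>n. cmod (?X n) \<le> 1) sequentially" and Y1: "eventually (\<lambda>n. cmod (?Y n) \<le> 1) sequentially"
    using eventually_valid_cycle[OF xs]
    by (auto elim!: eventually_mono intro: norm_diff_symbol_le_1 norm_mean_symbol_le_1)
  note lim = tendsto_mult[OF cycle_limits(3) power_sum_tendsto[OF X1 Y1 cycle_limits(1,2)]]
  have "eventually (\<lambda>n. of_nat n * form_symbol (jump_cycle S T xs n) \<xi> * ((\<Sum>i<n. ?X n ^ i * ?Y n ^ (n - 1 - i)) / of_nat n)
      = form_symbol (concat (replicate n (jump_cycle S T xs n))) \<xi>) sequentially"
    using eventually_gt_at_top[of 0] by eventually_elim (simp add: form_symbol_replicate)
  from Lim_transform_eventually[OF lim this] show ?thesis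
    by (simp add: transform_symbol_def algebra_simps)
qed

lemma admissible_poisson:
  fixes f g :: "'a \<Rightarrow> complex"
  assumes p: "2 \<le> p" and f: "cc_function f" and g: "cc_function g" and xs: "valid_atoms xs"
  shows "admissible_symbol f g ((p - 1) * Lp_norm p f * Lp_norm (p / (p - 1)) g)
    (\<lambda>\<xi>. transform_symbol (poisson_exponent xs) (poisson_modulated xs) (S' \<xi>) (T' \<xi>))"
proof (rule admissible_symbol_limit[OF f g _ cycles_tendsto[OF xs]])
  show "eventually (\<lambda>n. admissible_symbol f g ((p - 1) * Lp_norm p f * Lp_norm (p / (p - 1)) g)
      (form_symbol (concat (replicate n (jump_cycle S T xs n))))) sequentially"
    using eventually_valid_cycle[OF xs]
    by eventually_elim (intro admissible_form_symbol p f g valid_jumps_replicate)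
qed

end

section \<open>Finite Levy triples\<close>

lemma nat_square_cos_tendsto: "(\<lambda>n. (real n)\<^sup>2 * (cos (x / real n) - 1)) \<longlonglongrightarrow> - x\<^sup>2 / 2"
proof -
  have Im: "Im (of_nat n * (exp (\<i> * complex_of_real y / of_nat n) - 1)) = real n * sin (y / real n)" for n y
    by (simp add: Im_exp Im_divide_of_nat)
  have sin: "(\<lambda>n. real n * sin (y / real n)) \<longlonglongrightarrow> y" for y
    using tendsto_Im[OF exp_divide_nat_tendsto[of "\<i> * complex_of_real y"]] unfolding Im by simp
  have "(\<lambda>n. - 2 * (real n * sin (x / 2 / real n))\<^sup>2) \<longlonglongrightarrow> - 2 * (x / 2)\<^sup>2"
    by (intro tendsto_intros sin)
  moreover have "- 2 * (real n * sin (x / 2 / real n))\<^sup>2 = (real n)\<^sup>2 * (cos (x / real n) - 1)" for n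
  proof -
    have "cos (x / real n) = 1 - 2 * (sin (x / 2 / real n))\<^sup>2"
      using cos_double_sin[of "x / 2 / real n"] by simp
    then show ?thesis by (simp only: power_mult_distrib) simp
  qed
  ultimately show ?thesis by (simp add: power2_eq_square)
qed

lemma wave_plus_minus: "wave \<zeta> z + wave \<zeta> (- z) = complex_of_real (2 * cos (\<zeta> \<bullet> z))"
proof -
  have "Re (wave \<zeta> z) = cos (\<zeta> \<bullet> z)" by (simp add: wave_def Re_exp)
  then show ?thesis unfolding wave_minus complex_add_cnj by simp
qed

definition gauss_exponent :: "'b::real_inner atom list \<Rightarrow> 'b \<Rightarrow> complex" where
  "gauss_exponent ys \<zeta> = (\<Sum>(w, z, c)\<leftarrow>ys. w *\<^sub>R complex_of_real ((\<zeta> \<bullet> z)\<^sup>2))"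

definition gauss_modulated :: "'b::real_inner atom list \<Rightarrow> 'b \<Rightarrow> complex" where
  "gauss_modulated ys \<zeta> = (\<Sum>(w, z, c)\<leftarrow>ys. w *\<^sub>R (complex_of_real ((\<zeta> \<bullet> z)\<^sup>2) * c))"

text \<open>A Gaussian component along \<open>z\<close> is a limit of symmetric jumps by
  \<open>z / n\<close> at total rate \<open>w * n^2\<close>. Symmetry cancels the first-order
  term.\<close>

definition gauss_atoms :: "'b::real_inner atom list \<Rightarrow> nat \<Rightarrow> 'b atom list" where
  "gauss_atoms ys n = concat (map (\<lambda>(w, z, c). [(w * (real n)\<^sup>2 / 2, (1 / real n) *\<^sub>R z, c),
     (w * (real n)\<^sup>2 / 2, - ((1 / real n) *\<^sub>R z), c)]) ys)"

lemma poisson_append: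
  "poisson_exponent (xs @ ys) \<zeta> = poisson_exponent xs \<zeta> + poisson_exponent ys \<zeta>"
  "poisson_modulated (xs @ ys) \<zeta> = poisson_modulated xs \<zeta> + poisson_modulated ys \<zeta>"
  by (simp_all add: poisson_exponent_def poisson_modulated_def)

lemma valid_atoms_append: "valid_atoms (xs @ ys) \<longleftrightarrow> valid_atoms xs \<and> valid_atoms ys"
  unfolding valid_atoms_def set_append ball_Un by (rule refl)

lemma valid_atoms_simps:
  "valid_atoms []" "valid_atoms ((w, z, c) # xs) \<longleftrightarrow> 0 \<le> w \<and> cmod c \<le> 1 \<and> valid_atoms xs"
  by (simp_all add: valid_atoms_def)

lemma gauss_atoms_simps:
  "gauss_atoms [] n = []"
  "gauss_atoms ((w, z, c) # ys) n = [(w * (real n)\<^sup>2 / 2, (1 / real n) *\<^sub>R z, c),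
     (w * (real n)\<^sup>2 / 2, - ((1 / real n) *\<^sub>R z), c)] @ gauss_atoms ys n"
  by (simp_all add: gauss_atoms_def)

lemma valid_gauss_atoms: "valid_atoms ys \<Longrightarrow> valid_atoms (gauss_atoms ys n)"
proof (induction ys)
  case (Cons y ys)
  then show ?case by (cases y) (simp add: valid_atoms_simps gauss_atoms_simps)
qed (simp add: gauss_atoms_simps valid_atoms_simps)

lemma gauss_atoms_tendsto:
  "(\<lambda>n. poisson_exponent (gauss_atoms ys n) \<zeta>) \<longlonglongrightarrow> - 1 / 2 * gauss_exponent ys \<zeta>"
  "(\<lambda>n. poisson_modulated (gauss_atoms ys n) \<zeta>) \<longlonglongrightarrow> - 1 / 2 * gauss_modulated ys \<zeta>"
proof (induction ys)
  case (Cons y ys)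
  obtain w z c where y: "y = (w, z, c)" by (cases y)
  have pair: "(w * (real n)\<^sup>2 / 2) *\<^sub>R (wave \<zeta> ((1 / real n) *\<^sub>R z) - 1) + (w * (real n)\<^sup>2 / 2) *\<^sub>R (wave \<zeta> (- ((1 / real n) *\<^sub>R z)) - 1)
      = complex_of_real (w * ((real n)\<^sup>2 * (cos (\<zeta> \<bullet> z / real n) - 1)))" for n
  proof -
    have "(w * (real n)\<^sup>2 / 2) *\<^sub>R (wave \<zeta> ((1 / real n) *\<^sub>R z) - 1) + (w * (real n)\<^sup>2 / 2) *\<^sub>R (wave \<zeta> (- ((1 / real n) *\<^sub>R z)) - 1)
        = (w * (real n)\<^sup>2 / 2) *\<^sub>R ((wave \<zeta> ((1 / real n) *\<^sub>R z) + wave \<zeta> (- ((1 / real n) *\<^sub>R z))) - 2)"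
      by (simp add: scaleR_right_distrib[symmetric])
    then show ?thesis unfolding wave_plus_minus by (simp add: scaleR_conv_of_real algebra_simps)
  qed
  have lim: "(\<lambda>n. complex_of_real (w * ((real n)\<^sup>2 * (cos (\<zeta> \<bullet> z / real n) - 1)))) \<longlonglongrightarrow> complex_of_real (w * (- (\<zeta> \<bullet> z)\<^sup>2 / 2))"
    by (intro tendsto_intros nat_square_cos_tendsto)
  note atoms = gauss_atoms_simps(2)
  {
    case 1
    have "poisson_exponent (gauss_atoms ((w, z, c) # ys) n) \<zeta>
        = complex_of_real (w * ((real n)\<^sup>2 * (cos (\<zeta> \<bullet> z / real n) - 1))) + poisson_exponent (gauss_atoms ys n) \<zeta>" for n
      unfolding atoms poisson_append pair[symmetric] by (simp add: poisson_exponent_def)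
    moreover have "- 1 / 2 * gauss_exponent ((w, z, c) # ys) \<zeta>
        = complex_of_real (w * (- (\<zeta> \<bullet> z)\<^sup>2 / 2)) + - 1 / 2 * gauss_exponent ys \<zeta>"
      by (simp add: gauss_exponent_def scaleR_conv_of_real algebra_simps)
    ultimately show ?case unfolding y using tendsto_add[OF lim Cons.IH(1)] by simp
  next
    case 2
    have "poisson_modulated (gauss_atoms ((w, z, c) # ys) n) \<zeta>
        = complex_of_real (w * ((real n)\<^sup>2 * (cos (\<zeta> \<bullet> z / real n) - 1))) * c + poisson_modulated (gauss_atoms ys n) \<zeta>" for n
    proof -
      have distrib: "a *\<^sub>R (u * c) + a *\<^sub>R (v * c) = (a *\<^sub>R u + a *\<^sub>R v) * c" for a and u v :: complex
        by (simp add: scaleR_conv_of_real algebra_simps)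
      show ?thesis
        unfolding atoms poisson_append pair[symmetric]
        by (simp only: poisson_modulated_def list.map sum_list.Cons sum_list.Nil prod.case add_0_right distrib)
    qed
    moreover have "- 1 / 2 * gauss_modulated ((w, z, c) # ys) \<zeta>
        = complex_of_real (w * (- (\<zeta> \<bullet> z)\<^sup>2 / 2)) * c + - 1 / 2 * gauss_modulated ys \<zeta>"
      by (simp add: gauss_modulated_def scaleR_conv_of_real algebra_simps)
    ultimately show ?case unfolding y
      using tendsto_add[OF tendsto_mult[OF lim tendsto_const[of c]] Cons.IH(2)] by simp
  }
qed (simp_all add: gauss_atoms_def poisson_exponent_def poisson_modulated_def gauss_exponent_def gauss_modulated_def)

text \<open>Drift as jumps by \<open>\<gamma> / n\<close> at rate \<open>n\<close>. The multiplier
  is 0 because the modulated exponent has no drift term.\<close>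

definition drift_atoms :: "'b::real_inner \<Rightarrow> nat \<Rightarrow> 'b atom list" where
  "drift_atoms \<gamma> n = [(real n, (1 / real n) *\<^sub>R \<gamma>, 0)]"

lemma drift_atoms_tendsto:
  "(\<lambda>n. poisson_exponent (drift_atoms \<gamma> n) \<zeta>) \<longlonglongrightarrow> \<i> * complex_of_real (\<zeta> \<bullet> \<gamma>)"
proof -
  have "wave \<zeta> ((1 / real n) *\<^sub>R \<gamma>) = exp (\<i> * complex_of_real (\<zeta> \<bullet> \<gamma>) / of_nat n)" for n
    by (simp add: wave_def)
  then have "poisson_exponent (drift_atoms \<gamma> n) \<zeta>
      = of_nat n * (exp (\<i> * complex_of_real (\<zeta> \<bullet> \<gamma>) / of_nat n) - 1)" for n
    by (simp add: poisson_exponent_def drift_atoms_def scaleR_conv_of_real)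
  then show ?thesis by (simp only: exp_divide_nat_tendsto)
qed

lemma admissible_finite_levy:
  fixes S T :: "'b::real_inner \<Rightarrow> 'a::euclidean_space" and S' T' :: "'a \<Rightarrow> 'b"
    and f g :: "'a \<Rightarrow> complex"
  assumes S: "\<And>\<xi> z. \<xi> \<bullet> S z = S' \<xi> \<bullet> z" and T: "\<And>\<xi> z. \<xi> \<bullet> T z = T' \<xi> \<bullet> z"
    and p: "2 \<le> p" and f: "cc_function f" and g: "cc_function g"
    and xs: "valid_atoms xs" and ys: "valid_atoms ys"
    and L: "\<And>\<zeta> \<eta>. L (\<zeta> + \<eta>) = L \<zeta> + L \<eta>"
  shows "admissible_symbol f g ((p - 1) * Lp_norm p f * Lp_norm (p / (p - 1)) g)
    (\<lambda>\<xi>. transform_symbol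
      (\<lambda>\<zeta>. poisson_exponent xs \<zeta> + - 1 / 2 * gauss_exponent ys \<zeta> + \<i> * complex_of_real (\<zeta> \<bullet> \<gamma>))
      (\<lambda>\<zeta>. poisson_modulated xs \<zeta> + - 1 / 2 * gauss_modulated ys \<zeta> + L \<zeta>) (S' \<xi>) (T' \<xi>))"
  unfolding transform_symbol_add_additive[of L, OF L]
proof (rule admissible_symbol_limit[OF f g])
  let ?zs = "\<lambda>n. (xs @ gauss_atoms ys n) @ drift_atoms \<gamma> n"
  have "valid_atoms (?zs n)" for n
    using xs ys by (simp add: valid_atoms_append valid_gauss_atoms) (simp add: valid_atoms_def drift_atoms_def)
  then show "eventually (\<lambda>n. admissible_symbol f g ((p - 1) * Lp_norm p f * Lp_norm (p / (p - 1)) g)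
      (\<lambda>\<xi>. transform_symbol (poisson_exponent (?zs n)) (poisson_modulated (?zs n)) (S' \<xi>) (T' \<xi>))) sequentially"
    by (intro always_eventually allI admissible_poisson[OF S T p f g])
  have 0: "poisson_modulated (drift_atoms \<gamma> n) \<zeta> = 0" for n \<zeta>
    by (simp add: poisson_modulated_def drift_atoms_def)
  show "(\<lambda>n. transform_symbol (poisson_exponent (?zs n)) (poisson_modulated (?zs n)) (S' \<xi>) (T' \<xi>))
    \<longlonglongrightarrow> transform_symbol
      (\<lambda>\<zeta>. poisson_exponent xs \<zeta> + - 1 / 2 * gauss_exponent ys \<zeta> + \<i> * complex_of_real (\<zeta> \<bullet> \<gamma>))
      (\<lambda>\<zeta>. poisson_modulated xs \<zeta> + - 1 / 2 * gauss_modulated ys \<zeta>) (S' \<xi>) (T' \<xi>)" for \<xi>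
    unfolding poisson_append 0 add_0_right
    by (intro transform_symbol_tendsto tendsto_add tendsto_const gauss_atoms_tendsto drift_atoms_tendsto)
qed

section \<open>Discretisation of measures\<close>

text \<open>The atoms are the joint level sets of \<open>s\<close> and \<open>t\<close>. One list
  serves all integrands \<open>h\<close>, so the plain and the modulated exponent are discretised
  together.\<close>

lemma simple_function_atoms:
  fixes s :: "'m \<Rightarrow> 'b" and t :: "'m \<Rightarrow> complex"
  assumes "finite_measure M" and s: "simple_function M s" and t: "simple_function M t"
    and t1: "\<And>x. x \<in> space M \<Longrightarrow> cmod (t x) \<le> 1"
  shows "\<exists>xs. valid_atoms xs \<and>
    (\<forall>h :: 'b \<Rightarrow> complex \<Rightarrow> complex. (\<Sum>(w, z, c)\<leftarrow>xs. w *\<^sub>R h z c) = (LINT x|M. h (s x) (t x)))"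
proof -
  interpret finite_measure M by fact
  let ?P = "\<lambda>x. (s x, t x)"
  have P: "simple_function M ?P" using s t by (rule simple_function_Pair)
  define V where "V = ?P ` space M"
  have V: "finite V" using P by (simp add: V_def simple_function_def)
  then obtain vs where vs: "set vs = V" "distinct vs" using finite_distinct_list by blast
  define xs where "xs = map (\<lambda>v. (measure M (?P -` {v} \<inter> space M), fst v, snd v)) vs"
  have "valid_atoms xs"
    using t1 by (auto simp: valid_atoms_def xs_def vs V_def)
  moreover have "(\<Sum>(w, z, c)\<leftarrow>xs. w *\<^sub>R h z c) = (LINT x|M. h (s x) (t x))" for h :: "'b \<Rightarrow> complex \<Rightarrow> complex"
  proof -
    let ?A = "\<lambda>v. ?P -` {v} \<inter> space M"
    have A: "?A v \<in> sets M" for v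
      using simple_functionD(2)[OF P] by blast
    have "(LINT x|M. h (s x) (t x)) = (LINT x|M. (\<Sum>v\<in>V. indicator (?A v) x *\<^sub>R h (fst v) (snd v)))"
    proof (rule Bochner_Integration.integral_cong[OF refl])
      fix x assume x: "x \<in> space M"
      have "(\<Sum>v\<in>V. indicator (?A v) x *\<^sub>R h (fst v) (snd v)) = (\<Sum>v\<in>V. if v = ?P x then h (fst v) (snd v) else 0)"
        using x by (intro sum.cong) (auto simp: indicator_def)
      also have "\<dots> = h (s x) (t x)" using V x by (simp add: V_def)
      finally show "h (s x) (t x) = (\<Sum>v\<in>V. indicator (?A v) x *\<^sub>R h (fst v) (snd v))" by simp
    qed
    also have "\<dots> = (\<Sum>v\<in>V. LINT x|M. indicator (?A v) x *\<^sub>R h (fst v) (snd v))"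
      using A emeasure_finite
      by (intro Bochner_Integration.integral_sum integrable_scaleR_left integrable_real_indicator)
         (auto simp: less_top[symmetric])
    also have "\<dots> = (\<Sum>v\<in>V. measure M (?A v) *\<^sub>R h (fst v) (snd v))"
      using A by (intro sum.cong refl) (subst integral_scaleR_left, auto simp: less_top[symmetric])
    also have "\<dots> = (\<Sum>(w, z, c)\<leftarrow>xs. w *\<^sub>R h z c)"
      unfolding xs_def vs(1)[symmetric] by (simp add: sum_list_distinct_conv_sum_set[OF vs(2)] o_def case_prod_beta)
    finally show ?thesis by simp
  qed
  ultimately show ?thesis by (intro exI[of _ xs]) simp
qed

lemma unit_disc_retraction:
  fixes z :: complex
  shows "cmod (z / complex_of_real (max 1 (cmod z))) \<le> 1"
  by (simp add: norm_divide divide_le_eq)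

lemma simple_approximation:
  fixes Z :: "'m \<Rightarrow> 'b::euclidean_space" and \<phi> :: "'m \<Rightarrow> complex"
  assumes Z: "Z \<in> borel_measurable M" and \<phi>: "\<phi> \<in> borel_measurable M"
  obtains s t where "\<And>k. simple_function M (s k)" "\<And>k. simple_function M (t k)"
    and "\<And>x. x \<in> space M \<Longrightarrow> (\<lambda>k. s k x) \<longlonglongrightarrow> Z x" and "\<And>k x. x \<in> space M \<Longrightarrow> norm (s k x) \<le> 2 * norm (Z x)"
    and "\<And>x. x \<in> space M \<Longrightarrow> cmod (\<phi> x) \<le> 1 \<Longrightarrow> (\<lambda>k. t k x) \<longlonglongrightarrow> \<phi> x" and "\<And>k x. cmod (t k x) \<le> 1"
proof -
  obtain s where s: "\<And>k. simple_function M (s k)"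
    "\<And>x. x \<in> space M \<Longrightarrow> (\<lambda>k. s k x) \<longlonglongrightarrow> Z x" "\<And>k x. x \<in> space M \<Longrightarrow> norm (s k x) \<le> 2 * norm (Z x)"
    using borel_measurable_implies_sequence_metric[OF Z, of 0] unfolding norm_conv_dist by metis
  obtain t where t: "\<And>k. simple_function M (t k)" "\<And>x. x \<in> space M \<Longrightarrow> (\<lambda>k. t k x) \<longlonglongrightarrow> \<phi> x"
    using borel_measurable_implies_sequence_metric[OF \<phi>, of 0] by metis
  \<comment> \<open>Retraction onto the closed unit disc: continuous and the identity on the disc,
    so limits survive while the multipliers obtain modulus at most 1.\<close>
  let ?r = "\<lambda>z. z / complex_of_real (max 1 (cmod z))"
  have "(\<lambda>k. ?r (t k x)) \<longlonglongrightarrow> \<phi> x" if "x \<in> space M" "cmod (\<phi> x) \<le> 1" for x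
  proof -
    have "(\<lambda>k. ?r (t k x)) \<longlonglongrightarrow> ?r (\<phi> x)"
      using t(2)[OF that(1)] by (intro tendsto_intros) auto
    then show ?thesis using that by (simp add: max_absorb1)
  qed
  moreover have "simple_function M (\<lambda>x. ?r (t k x))" for k
    using t(1) by (rule simple_function_compose1)
  ultimately show ?thesis
    by (intro that[of s "\<lambda>k x. ?r (t k x)"] s unit_disc_retraction)
qed

text \<open>Turns the bound almost everywhere into one everywhere, as the multipliers require,
  without changing the integrals.\<close>

definition unit_truncation :: "('m \<Rightarrow> complex) \<Rightarrow> 'm \<Rightarrow> complex" where
  "unit_truncation \<phi> x = (if cmod (\<phi> x) \<le> 1 then \<phi> x else 0)"

lemma unit_truncation_measurable:
  assumes [measurable]: "\<phi> \<in> borel_measurable M"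
  shows "unit_truncation \<phi> \<in> borel_measurable M"
  unfolding unit_truncation_def[abs_def] by measurable

lemma unit_truncation_le_1: "cmod (unit_truncation \<phi> x) \<le> 1"
  by (simp add: unit_truncation_def)

lemma integral_unit_truncation:
  assumes [measurable]: "h \<in> borel_measurable M" "\<phi> \<in> borel_measurable M" and "AE x in M. cmod (\<phi> x) \<le> 1"
  shows "(LINT x|M. h x * \<phi> x) = (LINT x|M. h x * unit_truncation \<phi> x)"
proof -
  have [measurable]: "unit_truncation \<phi> \<in> borel_measurable M" by (rule unit_truncation_measurable) fact
  show ?thesis
    using assms(3) by (intro integral_cong_AE) (auto simp: unit_truncation_def)
qed

lemma gauss_discretisation:
  fixes \<mu> :: "'b::euclidean_space measure"
  assumes sets: "sets \<mu> = sets (restrict_space borel (sphere 0 1))" and fin: "finite_measure \<mu>"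
    and \<phi>: "\<phi> \<in> borel_measurable (restrict_space borel (sphere 0 1))" and le: "AE x in \<mu>. cmod (\<phi> x) \<le> 1"
  obtains ys where "\<And>n. valid_atoms (ys n)"
    and "\<And>\<zeta>. (\<lambda>n. gauss_exponent (ys n) \<zeta>) \<longlonglongrightarrow> (LINT x|\<mu>. complex_of_real ((\<zeta> \<bullet> x)\<^sup>2))"
    and "\<And>\<zeta>. (\<lambda>n. gauss_modulated (ys n) \<zeta>) \<longlonglongrightarrow> (LINT x|\<mu>. complex_of_real ((\<zeta> \<bullet> x)\<^sup>2) * \<phi> x)"
proof -
  interpret finite_measure \<mu> by fact
  have space: "space \<mu> = sphere 0 1"
    using sets_eq_imp_space_eq[OF sets] by (simp add: space_restrict_space)
  have meas: "h \<in> borel_measurable \<mu>" if "h \<in> borel_measurable (restrict_space borel (sphere 0 1))" for h :: "'b \<Rightarrow> 'c::topological_space"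
    using that measurable_cong_sets[OF sets refl] by blast
  have id [measurable]: "(\<lambda>x. x) \<in> borel_measurable \<mu>"
    by (rule meas, rule measurable_restrict_space1) simp
  have \<phi>' [measurable]: "\<phi> \<in> borel_measurable \<mu>" by (rule meas[OF \<phi>])
  obtain s t where st: "\<And>k. simple_function \<mu> (s k)" "\<And>k. simple_function \<mu> (t k)"
    "\<And>x. x \<in> space \<mu> \<Longrightarrow> (\<lambda>k. s k x) \<longlonglongrightarrow> x" "\<And>k x. x \<in> space \<mu> \<Longrightarrow> norm (s k x) \<le> 2 * norm x"
    "\<And>x. x \<in> space \<mu> \<Longrightarrow> cmod (unit_truncation \<phi> x) \<le> 1 \<Longrightarrow> (\<lambda>k. t k x) \<longlonglongrightarrow> unit_truncation \<phi> x" "\<And>k x. cmod (t k x) \<le> 1"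
    using simple_approximation[OF id unit_truncation_measurable[OF \<phi>']] by blast
  have [measurable]: "s k \<in> borel_measurable \<mu>" "t k \<in> borel_measurable \<mu>" for k
    using st(1,2) by (auto intro: borel_measurable_simple_function)
  have "\<forall>k. \<exists>xs. valid_atoms xs \<and> (\<forall>h :: 'b \<Rightarrow> complex \<Rightarrow> complex.
      (\<Sum>(w, z, c)\<leftarrow>xs. w *\<^sub>R h z c) = (LINT x|\<mu>. h (s k x) (t k x)))"
    by (intro allI simple_function_atoms fin st)
  from choice[OF this] obtain ys where ys: "\<forall>k. valid_atoms (ys k) \<and> (\<forall>h :: 'b \<Rightarrow> complex \<Rightarrow> complex.
      (\<Sum>(w, z, c)\<leftarrow>ys k. w *\<^sub>R h z c) = (LINT x|\<mu>. h (s k x) (t k x)))" ..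
  have atoms: "(\<Sum>(w, z, c)\<leftarrow>ys k. w *\<^sub>R h z c) = (LINT x|\<mu>. h (s k x) (t k x))"
    for k and h :: "'b \<Rightarrow> complex \<Rightarrow> complex"
    using ys by simp
  \<comment> \<open>Used twice: with \<open>c\<close> constantly 1 for the plain exponent, with
    \<open>c = t\<close> for the modulated one.\<close>
  have lim: "(\<lambda>k. LINT x|\<mu>. complex_of_real ((\<zeta> \<bullet> s k x)\<^sup>2) * c k x) \<longlonglongrightarrow> (LINT x|\<mu>. complex_of_real ((\<zeta> \<bullet> x)\<^sup>2) * d x)"
    if [measurable]: "\<And>k. c k \<in> borel_measurable \<mu>" "d \<in> borel_measurable \<mu>"
      and c: "\<And>k x. cmod (c k x) \<le> 1" "\<And>x. x \<in> space \<mu> \<Longrightarrow> (\<lambda>k. c k x) \<longlonglongrightarrow> d x" for \<zeta> c d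
  proof (rule integral_dominated_convergence[where w="\<lambda>_. (2 * norm \<zeta>)\<^sup>2"])
    show "AE x in \<mu>. (\<lambda>k. complex_of_real ((\<zeta> \<bullet> s k x)\<^sup>2) * c k x) \<longlonglongrightarrow> complex_of_real ((\<zeta> \<bullet> x)\<^sup>2) * d x"
      by (intro AE_I2 tendsto_intros st c) auto
    show "AE x in \<mu>. norm (complex_of_real ((\<zeta> \<bullet> s k x)\<^sup>2) * c k x) \<le> (2 * norm \<zeta>)\<^sup>2" for k
    proof (intro AE_I2)
      fix x assume x: "x \<in> space \<mu>"
      have "\<bar>\<zeta> \<bullet> s k x\<bar> \<le> norm \<zeta> * norm (s k x)" by (rule Cauchy_Schwarz_ineq2)
      also have "\<dots> \<le> norm \<zeta> * 2" using st(4)[OF x, of k] x by (intro mult_left_mono) (auto simp: space)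
      finally have "(\<zeta> \<bullet> s k x)\<^sup>2 \<le> (2 * norm \<zeta>)\<^sup>2"
        by (intro power2_le_iff_abs_le[THEN iffD2]) (auto simp: mult.commute)
      then have "(\<zeta> \<bullet> s k x)\<^sup>2 * cmod (c k x) \<le> (2 * norm \<zeta>)\<^sup>2 * 1"
        using c(1) by (intro mult_mono) auto
      then show "norm (complex_of_real ((\<zeta> \<bullet> s k x)\<^sup>2) * c k x) \<le> (2 * norm \<zeta>)\<^sup>2"
        by (simp only: norm_mult norm_of_real abs_power2 mult_1_right)
    qed
  qed auto
  show ?thesis
  proof (rule that)
    show "valid_atoms (ys k)" for k using ys by simp
    fix \<zeta>
    have "gauss_exponent (ys k) \<zeta> = (LINT x|\<mu>. complex_of_real ((\<zeta> \<bullet> s k x)\<^sup>2) * 1)" for k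
      using atoms[of "\<lambda>z c. complex_of_real ((\<zeta> \<bullet> z)\<^sup>2)" k] by (simp add: gauss_exponent_def)
    then show "(\<lambda>n. gauss_exponent (ys n) \<zeta>) \<longlonglongrightarrow> (LINT x|\<mu>. complex_of_real ((\<zeta> \<bullet> x)\<^sup>2))"
      using lim[of "\<lambda>_ _. 1" "\<lambda>_. 1" \<zeta>] by simp
    have "gauss_modulated (ys k) \<zeta> = (LINT x|\<mu>. complex_of_real ((\<zeta> \<bullet> s k x)\<^sup>2) * t k x)" for k
      using atoms[of "\<lambda>z c. complex_of_real ((\<zeta> \<bullet> z)\<^sup>2) * c" k] by (simp add: gauss_modulated_def)
    then have "(\<lambda>n. gauss_modulated (ys n) \<zeta>) \<longlonglongrightarrow> (LINT x|\<mu>. complex_of_real ((\<zeta> \<bullet> x)\<^sup>2) * unit_truncation \<phi> x)"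
      using lim[of t "unit_truncation \<phi>" \<zeta>] st(6) unit_truncation_measurable[OF \<phi>']
        st(5)[OF _ unit_truncation_le_1] by simp
    also have "(LINT x|\<mu>. complex_of_real ((\<zeta> \<bullet> x)\<^sup>2) * unit_truncation \<phi> x) = (LINT x|\<mu>. complex_of_real ((\<zeta> \<bullet> x)\<^sup>2) * \<phi> x)"
      by (rule integral_unit_truncation[symmetric]) (use le in auto)
    finally show "(\<lambda>n. gauss_modulated (ys n) \<zeta>) \<longlonglongrightarrow> (LINT x|\<mu>. complex_of_real ((\<zeta> \<bullet> x)\<^sup>2) * \<phi> x)" .
  qed
qed

text \<open>\<open>y\<close> approximates the jump \<open>z\<close>, but the cut-off is read off
  from \<open>z\<close> itself: its indicator jumps on the unit sphere and need not converge along
  approximations.\<close>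

definition truncated_kernel :: "'b::euclidean_space \<Rightarrow> 'b \<Rightarrow> 'b \<Rightarrow> complex" where
  "truncated_kernel \<zeta> z y =
     wave \<zeta> y - 1 - \<i> * complex_of_real (\<zeta> \<bullet> y) * indicator {z. norm z \<le> 1} z"

lemma truncated_kernel_diagonal: "truncated_kernel \<zeta> z z = levy_kernel \<zeta> z"
  by (simp add: truncated_kernel_def levy_kernel_def wave_def)

text \<open>A dominating function uniform in \<open>y\<close>: the second-order Taylor estimate for
  small jumps, the trivial bound 2 for large ones.\<close>

lemma truncated_kernel_bound:
  assumes "norm y \<le> 2 * norm z"
  shows "cmod (truncated_kernel \<zeta> z y) \<le> (2 * (norm \<zeta>)\<^sup>2 + 2) * min ((norm z)\<^sup>2) 1"
proof (cases "norm z \<le> 1")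
  case True
  have "cmod (iexp (\<zeta> \<bullet> y) - (\<Sum>k\<le>1. (\<i> * complex_of_real (\<zeta> \<bullet> y)) ^ k / fact k)) \<le> \<bar>\<zeta> \<bullet> y\<bar> ^ Suc 1 / fact (Suc 1)"
    by (rule iexp_approx1)
  then have "cmod (truncated_kernel \<zeta> z y) \<le> (\<zeta> \<bullet> y)\<^sup>2 / 2"
    using True by (simp add: truncated_kernel_def wave_def diff_diff_eq power2_eq_square)
  also have "(\<zeta> \<bullet> y)\<^sup>2 \<le> (norm \<zeta> * (2 * norm z))\<^sup>2"
  proof (intro power2_le_iff_abs_le[THEN iffD2])
    show "\<bar>\<zeta> \<bullet> y\<bar> \<le> norm \<zeta> * (2 * norm z)"
      using Cauchy_Schwarz_ineq2[of \<zeta> y] mult_left_mono[OF assms norm_ge_zero[of \<zeta>]] by linarith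
  qed simp
  also have "\<dots> / 2 = 2 * (norm \<zeta>)\<^sup>2 * (norm z)\<^sup>2" by (simp add: power_mult_distrib)
  also have "\<dots> \<le> (2 * (norm \<zeta>)\<^sup>2 + 2) * (norm z)\<^sup>2" by (intro mult_right_mono) auto
  also have "(norm z)\<^sup>2 = min ((norm z)\<^sup>2) 1" using True by (simp add: power_le_one min_absorb1)
  finally show ?thesis by simp
next
  case False
  then have "1 \<le> (norm z)\<^sup>2" by (simp add: one_le_power)
  moreover have "cmod (truncated_kernel \<zeta> z y) \<le> 2"
    using False norm_triangle_ineq4[of "wave \<zeta> y" 1] by (simp add: truncated_kernel_def)
  ultimately show ?thesis by (simp add: min_absorb2 add_increasing)
qed

text \<open>Chebyshev's inequality. It supplies the finite measures to which
  \<open>simple_function_atoms\<close> applies.\<close>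

lemma levy_measure_tail_finite:
  fixes \<nu> :: "'b::euclidean_space measure"
  assumes sets: "sets \<nu> = sets borel" and int: "(\<integral>\<^sup>+ z. ennreal (min ((norm z)\<^sup>2) 1) \<partial>\<nu>) < \<infinity>"
    and r: "0 < r"
  shows "emeasure \<nu> {z. r < norm z} < \<infinity>"
proof -
  note [measurable_cong] = sets
  define c where "c = min (r\<^sup>2) 1"
  have c: "0 < c" using r by (simp add: c_def)
  have A: "{z. r < norm z} \<in> sets \<nu>" unfolding sets by measurable
  have "ennreal c * emeasure \<nu> {z. r < norm z} = (\<integral>\<^sup>+ z. ennreal c * indicator {z. r < norm z} z \<partial>\<nu>)"
    using A by (simp add: nn_integral_cmult_indicator)
  also have "\<dots> \<le> (\<integral>\<^sup>+ z. ennreal (min ((norm z)\<^sup>2) 1) \<partial>\<nu>)"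
  proof (intro nn_integral_mono)
    fix z :: 'b
    have "c \<le> min ((norm z)\<^sup>2) 1" if "r < norm z"
      using that r by (auto simp: c_def min_le_iff_disj power_mono intro!: power_mono min.coboundedI1)
    then show "ennreal c * indicator {z. r < norm z} z \<le> ennreal (min ((norm z)\<^sup>2) 1)"
      by (auto simp: indicator_def intro!: ennreal_leI)
  qed
  finally have "ennreal c * emeasure \<nu> {z. r < norm z} < \<infinity>" using int by (rule le_less_trans)
  then show ?thesis using c by (auto simp: ennreal_mult_less_top)
qed

text \<open>Jumps near 0 are cut off to obtain finite measures \<open>M k\<close>. In the plain
  exponent the compensator has a real coefficient vector and becomes a drift
  \<open>\<gamma> n\<close>. In the modulated exponent the coefficients are complex, so it is kept
  as an additive function \<open>L n\<close>, to which \<open>transform_symbol\<close> is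
  blind.\<close>

lemma levy_discretisation:
  fixes \<nu> :: "'b::euclidean_space measure"
  assumes sets: "sets \<nu> = sets borel"
    and int: "(\<integral>\<^sup>+ z. ennreal (min ((norm z)\<^sup>2) 1) \<partial>\<nu>) < \<infinity>"
    and \<phi>: "\<phi> \<in> borel_measurable borel" and le: "AE z in \<nu>. cmod (\<phi> z) \<le> 1"
  obtains xs \<gamma> L where "\<And>n::nat. valid_atoms (xs n)" "\<And>n::nat. \<And>\<zeta> \<eta>. L n (\<zeta> + \<eta>) = L n \<zeta> + L n \<eta>"
    and "\<And>\<zeta>. (\<lambda>n. poisson_exponent (xs n) \<zeta> + \<i> * complex_of_real (\<zeta> \<bullet> \<gamma> n)) \<longlonglongrightarrow> (LINT z|\<nu>. levy_kernel \<zeta> z)"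
    and "\<And>\<zeta>. (\<lambda>n. poisson_modulated (xs n) \<zeta> + L n \<zeta>) \<longlonglongrightarrow> (LINT z|\<nu>. levy_kernel \<zeta> z * \<phi> z)"
proof -
  note [measurable_cong] = sets
  have [measurable]: "\<phi> \<in> borel_measurable \<nu>" using \<phi> measurable_cong_sets[OF sets refl] by blast
  have space: "space \<nu> = UNIV" using sets_eq_imp_space_eq[OF sets] by simp
  have id: "(\<lambda>z. z) \<in> borel_measurable \<nu>" by measurable
  have tr [measurable]: "unit_truncation \<phi> \<in> borel_measurable \<nu>" by (rule unit_truncation_measurable) simp
  obtain s t where st: "\<And>k. simple_function \<nu> (s k)" "\<And>k. simple_function \<nu> (t k)"
    "\<And>x. x \<in> space \<nu> \<Longrightarrow> (\<lambda>k. s k x) \<longlonglongrightarrow> x" "\<And>k x. x \<in> space \<nu> \<Longrightarrow> norm (s k x) \<le> 2 * norm x"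
    "\<And>x. x \<in> space \<nu> \<Longrightarrow> cmod (unit_truncation \<phi> x) \<le> 1 \<Longrightarrow> (\<lambda>k. t k x) \<longlonglongrightarrow> unit_truncation \<phi> x" "\<And>k x. cmod (t k x) \<le> 1"
    using simple_approximation[OF id tr] by blast
  have [measurable]: "s k \<in> borel_measurable \<nu>" "t k \<in> borel_measurable \<nu>" for k
    using st(1,2) by (auto intro: borel_measurable_simple_function)
  define A where "A k = {z::'b. 1 / real (Suc k) < norm z}" for k
  have A [measurable]: "A k \<in> sets \<nu>" for k unfolding sets A_def by measurable
  define M where "M k = density \<nu> (\<lambda>z. ennreal (indicator (A k) z))" for k
  have setsM [measurable_cong]: "sets (M k) = sets \<nu>" and spaceM: "space (M k) = UNIV" for k
    by (simp_all add: M_def space)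
  have fin: "finite_measure (M k)" for k
  proof
    have "emeasure (M k) (space (M k)) = (\<integral>\<^sup>+ z. indicator (A k) z \<partial>\<nu>)"
      unfolding M_def by (subst emeasure_density) (auto simp: space ennreal_indicator)
    also have "\<dots> = emeasure \<nu> (A k)" by simp
    also have "\<dots> < \<infinity>" unfolding A_def by (rule levy_measure_tail_finite[OF sets int]) simp
    finally show "emeasure (M k) (space (M k)) \<noteq> \<infinity>" by simp
  qed
  have integral_M: "(LINT z|M k. h z) = (LINT z|\<nu>. indicator (A k) z *\<^sub>R h z)"
    if "h \<in> borel_measurable \<nu>" for h :: "'b \<Rightarrow> complex" and k
    unfolding M_def using that by (intro integral_density) auto
  have sfM: "simple_function (M k) (s k)" "simple_function (M k) (t k)" for k
    using st(1,2)[of k] by (simp_all add: simple_function_def spaceM space setsM)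
  have "\<forall>k. \<exists>xs. valid_atoms xs \<and> (\<forall>h :: 'b \<Rightarrow> complex \<Rightarrow> complex.
      (\<Sum>(w, z, c)\<leftarrow>xs. w *\<^sub>R h z c) = (LINT x|M k. h (s k x) (t k x)))"
    by (intro allI simple_function_atoms fin sfM st)
  from choice[OF this] obtain xs where xs: "\<forall>k. valid_atoms (xs k) \<and> (\<forall>h :: 'b \<Rightarrow> complex \<Rightarrow> complex.
      (\<Sum>(w, z, c)\<leftarrow>xs k. w *\<^sub>R h z c) = (LINT x|M k. h (s k x) (t k x)))" ..
  have atoms: "(\<Sum>(w, z, c)\<leftarrow>xs k. w *\<^sub>R h z c) = (LINT x|M k. h (s k x) (t k x))"
    for k and h :: "'b \<Rightarrow> complex \<Rightarrow> complex"
    using xs by simp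
  let ?I = "indicator {z::'b. norm z \<le> 1} :: 'b \<Rightarrow> real"
  define \<gamma> where "\<gamma> k = - (LINT z|M k. ?I z *\<^sub>R s k z)" for k
  define L where "L k \<zeta> = - \<i> * (LINT z|M k. complex_of_real (\<zeta> \<bullet> (?I z *\<^sub>R s k z)) * t k z)" for k \<zeta>
  have Is: "norm (?I z *\<^sub>R s k z) \<le> 2" for k z
    using st(4)[of z k] by (simp add: indicator_def space)
  have int_s: "integrable (M k) (\<lambda>z. ?I z *\<^sub>R s k z)" for k
    using Is by (intro finite_measure.integrable_const_bound[OF fin, of _ 2]) auto
  have int_lin: "integrable (M k) (\<lambda>z. complex_of_real (\<zeta> \<bullet> (?I z *\<^sub>R s k z)) * c z)"
    if [measurable]: "c \<in> borel_measurable \<nu>" and c: "\<And>z. cmod (c z) \<le> 1" for k \<zeta> and c :: "'b \<Rightarrow> complex"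
  proof (rule finite_measure.integrable_const_bound[OF fin, of _ "norm \<zeta> * 2 * 1"])
    show "AE z in M k. norm (complex_of_real (\<zeta> \<bullet> (?I z *\<^sub>R s k z)) * c z) \<le> norm \<zeta> * 2 * 1"
    proof (intro AE_I2)
      fix z
      have "\<bar>\<zeta> \<bullet> (?I z *\<^sub>R s k z)\<bar> \<le> norm \<zeta> * 2"
        using Is[of z k] by (intro order_trans[OF Cauchy_Schwarz_ineq2] mult_left_mono) auto
      then show "norm (complex_of_real (\<zeta> \<bullet> (?I z *\<^sub>R s k z)) * c z) \<le> norm \<zeta> * 2 * 1"
        unfolding norm_mult norm_of_real using c by (intro mult_mono) auto
    qed
  qed measurable
  have int_wave: "integrable (M k) (\<lambda>z. (wave \<zeta> (s k z) - 1) * c z)"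
    if [measurable]: "c \<in> borel_measurable \<nu>" and c: "\<And>z. cmod (c z) \<le> 1" for k \<zeta> and c :: "'b \<Rightarrow> complex"
  proof (rule finite_measure.integrable_const_bound[OF fin, of _ "2 * 1"])
    have "cmod (wave \<zeta> z - 1) \<le> 2" for z
      using norm_triangle_ineq4[of "wave \<zeta> z" 1] by simp
    then show "AE z in M k. norm ((wave \<zeta> (s k z) - 1) * c z) \<le> 2 * 1"
      unfolding norm_mult using c by (intro AE_I2 mult_mono) auto
    show "(\<lambda>z. (wave \<zeta> (s k z) - 1) * c z) \<in> borel_measurable (M k)"
      unfolding wave_def by measurable
  qed
  have min_int: "integrable \<nu> (\<lambda>z. (2 * (norm \<zeta>)\<^sup>2 + 2) * min ((norm z)\<^sup>2) 1)" for \<zeta> :: 'b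
    using int by (intro integrable_mult_right integrableI_nonneg) auto
  \<comment> \<open>Jumps and compensator are joined before the limit: the bound by
    \<open>min ((norm z)^2) 1\<close> is available only for the combined kernel.\<close>
  have split: "(LINT z|M k. (wave \<zeta> (s k z) - 1) * c z) - \<i> * (LINT z|M k. complex_of_real (\<zeta> \<bullet> (?I z *\<^sub>R s k z)) * c z)
      = (LINT z|\<nu>. indicator (A k) z *\<^sub>R (truncated_kernel \<zeta> z (s k z) * c z))"
    if [measurable]: "c \<in> borel_measurable \<nu>" and c: "\<And>z. cmod (c z) \<le> 1" for k \<zeta> and c :: "'b \<Rightarrow> complex"
  proof -
    have "(LINT z|M k. (wave \<zeta> (s k z) - 1) * c z) - \<i> * (LINT z|M k. complex_of_real (\<zeta> \<bullet> (?I z *\<^sub>R s k z)) * c z)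
        = (LINT z|M k. (wave \<zeta> (s k z) - 1) * c z - \<i> * (complex_of_real (\<zeta> \<bullet> (?I z *\<^sub>R s k z)) * c z))"
      using int_wave[OF that] int_lin[OF that] by simp
    also have "\<dots> = (LINT z|M k. truncated_kernel \<zeta> z (s k z) * c z)"
      by (intro Bochner_Integration.integral_cong refl)
         (simp add: truncated_kernel_def indicator_def algebra_simps)
    also have "\<dots> = (LINT z|\<nu>. indicator (A k) z *\<^sub>R (truncated_kernel \<zeta> z (s k z) * c z))"
      by (rule integral_M) (simp add: truncated_kernel_def wave_def, measurable)
    finally show ?thesis .
  qed
  have lim: "(\<lambda>k. LINT z|\<nu>. indicator (A k) z *\<^sub>R (truncated_kernel \<zeta> z (s k z) * c k z))
      \<longlonglongrightarrow> (LINT z|\<nu>. levy_kernel \<zeta> z * d z)"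
    if [measurable]: "\<And>k. c k \<in> borel_measurable \<nu>" "d \<in> borel_measurable \<nu>"
      and c: "\<And>k z. cmod (c k z) \<le> 1" "\<And>z. (\<lambda>k. c k z) \<longlonglongrightarrow> d z" for \<zeta> c d
  proof (rule integral_dominated_convergence[where w="\<lambda>z. (2 * (norm \<zeta>)\<^sup>2 + 2) * min ((norm z)\<^sup>2) 1"])
    show "(\<lambda>z. levy_kernel \<zeta> z * d z) \<in> borel_measurable \<nu>"
      unfolding levy_kernel_def by measurable
    show "(\<lambda>z. indicator (A k) z *\<^sub>R (truncated_kernel \<zeta> z (s k z) * c k z)) \<in> borel_measurable \<nu>" for k
      unfolding truncated_kernel_def wave_def by measurable
    show "AE z in \<nu>. (\<lambda>k. indicator (A k) z *\<^sub>R (truncated_kernel \<zeta> z (s k z) * c k z)) \<longlonglongrightarrow> levy_kernel \<zeta> z * d z"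
    proof (intro AE_I2)
      fix z
      have sz: "(\<lambda>k. s k z) \<longlonglongrightarrow> z" using st(3) by (simp add: space)
      have "(\<lambda>k. truncated_kernel \<zeta> z (s k z) * c k z) \<longlonglongrightarrow> truncated_kernel \<zeta> z z * d z"
        unfolding truncated_kernel_def wave_def by (intro tendsto_intros sz c)
      moreover have "eventually (\<lambda>k. truncated_kernel \<zeta> z (s k z) * c k z
          = indicator (A k) z *\<^sub>R (truncated_kernel \<zeta> z (s k z) * c k z)) sequentially"
      proof (cases "z = 0")
        \<comment> \<open>The indicator of \<open>A k\<close> is 0 at the origin for all
          \<open>k\<close>; the bound \<open>norm (s k x) <= 2 * norm x\<close> gives
          \<open>s k 0 = 0\<close>, where the kernel vanishes as well.\<close>
        case True
        have "s k 0 = 0" for k using st(4)[of 0 k] by (simp add: space)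
        then show ?thesis using True by (simp add: truncated_kernel_def)
      next
        case False
        have "(\<lambda>k. 1 / real (Suc k)) \<longlonglongrightarrow> 0" by (rule LIMSEQ_Suc[OF lim_1_over_n])
        then have "eventually (\<lambda>k. 1 / real (Suc k) < norm z) sequentially"
          by (rule order_tendstoD(2)) (use False in simp)
        then show ?thesis by eventually_elim (simp add: A_def)
      qed
      ultimately show "(\<lambda>k. indicator (A k) z *\<^sub>R (truncated_kernel \<zeta> z (s k z) * c k z)) \<longlonglongrightarrow> levy_kernel \<zeta> z * d z"
        unfolding truncated_kernel_diagonal by (rule Lim_transform_eventually)
    qed
    show "AE z in \<nu>. norm (indicator (A k) z *\<^sub>R (truncated_kernel \<zeta> z (s k z) * c k z))
        \<le> (2 * (norm \<zeta>)\<^sup>2 + 2) * min ((norm z)\<^sup>2) 1" for k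
    proof (intro AE_I2)
      fix z
      have "norm (indicator (A k) z *\<^sub>R (truncated_kernel \<zeta> z (s k z) * c k z))
          \<le> cmod (truncated_kernel \<zeta> z (s k z)) * cmod (c k z)"
        by (simp add: indicator_def norm_mult)
      also have "\<dots> \<le> cmod (truncated_kernel \<zeta> z (s k z)) * 1"
        using c(1) by (intro mult_left_mono) auto
      also have "\<dots> \<le> (2 * (norm \<zeta>)\<^sup>2 + 2) * min ((norm z)\<^sup>2) 1"
        using truncated_kernel_bound[of "s k z" z \<zeta>] st(4)[of z k] by (simp add: space)
      finally show "norm (indicator (A k) z *\<^sub>R (truncated_kernel \<zeta> z (s k z) * c k z))
        \<le> (2 * (norm \<zeta>)\<^sup>2 + 2) * min ((norm z)\<^sup>2) 1" .
    qed
  qed (rule min_int)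
  show ?thesis
  proof (rule that)
    show "valid_atoms (xs k)" for k using xs by simp
    show "L k (\<zeta> + \<eta>) = L k \<zeta> + L k \<eta>" for k \<zeta> \<eta>
    proof -
      have "(LINT z|M k. complex_of_real ((\<zeta> + \<eta>) \<bullet> (?I z *\<^sub>R s k z)) * t k z)
          = (LINT z|M k. complex_of_real (\<zeta> \<bullet> (?I z *\<^sub>R s k z)) * t k z + complex_of_real (\<eta> \<bullet> (?I z *\<^sub>R s k z)) * t k z)"
        by (intro Bochner_Integration.integral_cong refl) (simp only: inner_add_left of_real_add ring_distribs)
      also have "\<dots> = (LINT z|M k. complex_of_real (\<zeta> \<bullet> (?I z *\<^sub>R s k z)) * t k z)
          + (LINT z|M k. complex_of_real (\<eta> \<bullet> (?I z *\<^sub>R s k z)) * t k z)"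
        by (intro Bochner_Integration.integral_add int_lin st) measurable
      finally show ?thesis unfolding L_def by (simp only: ring_distribs)
    qed
    fix \<zeta>
    have "poisson_exponent (xs k) \<zeta> + \<i> * complex_of_real (\<zeta> \<bullet> \<gamma> k)
        = (LINT z|\<nu>. indicator (A k) z *\<^sub>R (truncated_kernel \<zeta> z (s k z) * 1))" for k
    proof -
      have "poisson_exponent (xs k) \<zeta> = (LINT z|M k. (wave \<zeta> (s k z) - 1) * 1)"
        using atoms[of "\<lambda>z c. wave \<zeta> z - 1" k] by (simp add: poisson_exponent_def)
      moreover have "complex_of_real (\<zeta> \<bullet> \<gamma> k) = - (LINT z|M k. complex_of_real (\<zeta> \<bullet> (?I z *\<^sub>R s k z)) * 1)"
        unfolding \<gamma>_def using int_s[of k]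
        by (simp only: inner_minus_right integral_inner_right[symmetric] mult_1_right integral_complex_of_real of_real_minus)
      ultimately show ?thesis using split[of "\<lambda>_. 1" k \<zeta>] by simp
    qed
    then show "(\<lambda>k. poisson_exponent (xs k) \<zeta> + \<i> * complex_of_real (\<zeta> \<bullet> \<gamma> k)) \<longlonglongrightarrow> (LINT z|\<nu>. levy_kernel \<zeta> z)"
      using lim[of "\<lambda>_ _. 1" "\<lambda>_. 1" \<zeta>] by simp
    have "poisson_modulated (xs k) \<zeta> + L k \<zeta>
        = (LINT z|\<nu>. indicator (A k) z *\<^sub>R (truncated_kernel \<zeta> z (s k z) * t k z))" for k
    proof -
      have "poisson_modulated (xs k) \<zeta> = (LINT z|M k. (wave \<zeta> (s k z) - 1) * t k z)"
        using atoms[of "\<lambda>z c. (wave \<zeta> z - 1) * c" k] by (simp add: poisson_modulated_def)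
      then show ?thesis using split[of "t k" k \<zeta>] st(6) by (simp add: L_def)
    qed
    then have "(\<lambda>k. poisson_modulated (xs k) \<zeta> + L k \<zeta>) \<longlonglongrightarrow> (LINT z|\<nu>. levy_kernel \<zeta> z * unit_truncation \<phi> z)"
      using lim[of t "unit_truncation \<phi>" \<zeta>] st(6) st(5)[OF _ unit_truncation_le_1] by (simp add: space)
    also have "(LINT z|\<nu>. levy_kernel \<zeta> z * unit_truncation \<phi> z) = (LINT z|\<nu>. levy_kernel \<zeta> z * \<phi> z)"
      by (rule integral_unit_truncation[symmetric]) (use le in \<open>auto simp: levy_kernel_def\<close>)
    finally show "(\<lambda>k. poisson_modulated (xs k) \<zeta> + L k \<zeta>) \<longlonglongrightarrow> (LINT z|\<nu>. levy_kernel \<zeta> z * \<phi> z)" .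
  qed
qed

section \<open>The multiplier theorem\<close>

lemma spectral_form_swap:
  fixes f g :: "'a::euclidean_space \<Rightarrow> complex"
  assumes f: "cc_function f" and g: "cc_function g" and [measurable]: "m \<in> borel_measurable borel"
  shows "spectral_form f g (\<lambda>\<xi>. m (- \<xi>)) = spectral_form g f m"
proof -
  have [measurable]: "f \<in> borel_measurable borel" "g \<in> borel_measurable borel"
    using borel_measurable_integrable[OF cc_function_integrable[OF f]]
      borel_measurable_integrable[OF cc_function_integrable[OF g]] by simp_all
  have "(LINT \<xi>|lborel. m \<xi> * (fourier g \<xi> * fourier f (- \<xi>)))
      = (LINT \<xi>|lborel. m (0 + (- 1) *\<^sub>R \<xi>) * (fourier g (0 + (- 1) *\<^sub>R \<xi>) * fourier f (- (0 + (- 1) *\<^sub>R \<xi>))))"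
    by (subst lborel_integral_affine[where c="-1" and t=0]) auto
  then show ?thesis by (simp add: spectral_form_def mult_ac)
qed

text \<open>If \<open>m * fourier f\<close> is not integrable, neither is its product with a phase,
  so \<open>fourier_multiplier m f\<close> is 0 by the convention for integrals and the bound is
  trivial.\<close>

lemma dual_form_bound:
  fixes m f g :: "'a::euclidean_space \<Rightarrow> complex"
  assumes g: "test_function g" and le: "cmod (spectral_form f g m) \<le> K"
  shows "cmod (dual_form (fourier_multiplier m) f g) \<le> K"
proof (cases "integrable lborel (\<lambda>\<xi>. m \<xi> * fourier f \<xi>)")
  case True
  then show ?thesis
    using dual_form_fourier_multiplier[OF True g] le by (simp add: spectral_form_def mult_ac)
next
  case False
  have "fourier_multiplier m f x = 0" for x
  proof -
    let ?e = "\<lambda>\<xi>. exp (- \<i> * complex_of_real (\<xi> \<bullet> x))"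
    have "\<not> integrable lborel (\<lambda>\<xi>. ?e \<xi> * (m \<xi> * fourier f \<xi>))"
    proof
      assume i: "integrable lborel (\<lambda>\<xi>. ?e \<xi> * (m \<xi> * fourier f \<xi>))"
      have [measurable]: "(\<lambda>\<xi>. ?e \<xi> * (m \<xi> * fourier f \<xi>)) \<in> borel_measurable borel"
        using borel_measurable_integrable[OF i] by simp
      have "(\<lambda>\<xi>. exp (\<i> * complex_of_real (\<xi> \<bullet> x)) * (?e \<xi> * (m \<xi> * fourier f \<xi>))) \<in> borel_measurable borel"
        by measurable
      moreover have "exp (\<i> * complex_of_real (\<xi> \<bullet> x)) * (?e \<xi> * (m \<xi> * fourier f \<xi>)) = m \<xi> * fourier f \<xi>" for \<xi>
        by (simp add: exp_minus field_simps)
      ultimately have "(\<lambda>\<xi>. m \<xi> * fourier f \<xi>) \<in> borel_measurable lborel"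
        by (simp only: measurable_lborel2)
      then have "integrable lborel (\<lambda>\<xi>. m \<xi> * fourier f \<xi>)"
        by (rule Bochner_Integration.integrable_bound[OF i]) (auto simp: norm_mult)
      with False show False ..
    qed
    then show ?thesis unfolding fourier_multiplier_def by (simp add: not_integrable_integral_eq)
  qed
  then show ?thesis using order_trans[OF norm_ge_zero le] by (simp add: dual_form_def)
qed

lemma inner_matrix_vector_transpose:
  fixes A :: "real ^ 'n ^ 'd"
  shows "\<xi> \<bullet> (A *v z) = (transpose A *v \<xi>) \<bullet> z"
  by (simp add: dot_lmul_matrix transpose_matrix_vector)

lemma transpose_matrix_uminus:
  fixes A :: "real ^ 'n ^ 'd"
  shows "transpose A *v (- \<xi>) = - (transpose A *v \<xi>)"
  using linear_neg[OF matrix_vector_mul_linear[of "transpose A"]] .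

text \<open>Replacing \<open>\<xi>\<close> by \<open>- \<xi>\<close> and exchanging \<open>A\<close>
  with \<open>B\<close> turns the pair \<open>(a, b)\<close> into \<open>(- b, - a)\<close>.
  Together with \<open>spectral_form_swap\<close> this is the duality used below exponent 2.\<close>

lemma transform_symbol_swap:
  "transform_symbol \<Psi> \<Psi>' (- b) (- a) = transform_symbol \<Psi> \<Psi>' a b"
proof -
  have ab: "- a - - b = b - a" by simp
  have eq: "x - y - z = x - z - y" for x y z :: complex by simp
  show ?thesis
    unfolding transform_symbol_def ab minus_minus
    by (simp only: add.commute[of "\<Psi> (- a)"] eq[of _ "\<Psi> (- a)"] eq[of _ "\<Psi>' (- a)"])
qed

theorem admissible_levy:
  fixes \<mu> \<nu> :: "(real ^ 'n) measure" and A B :: "real ^ 'n ^ 'd" and f g :: "real ^ 'd \<Rightarrow> complex"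
  assumes \<mu>: "sets \<mu> = sets (restrict_space borel (sphere 0 1))" "finite_measure \<mu>"
    and \<nu>: "sets \<nu> = sets borel" "(\<integral>\<^sup>+ z. ennreal (min ((norm z)\<^sup>2) 1) \<partial>\<nu>) < \<infinity>"
    and \<phi>: "\<phi> \<in> borel_measurable borel" "AE z in \<nu>. cmod (\<phi> z) \<le> 1"
    and \<phi>': "\<phi>' \<in> borel_measurable (restrict_space borel (sphere 0 1))" "AE \<theta> in \<mu>. cmod (\<phi>' \<theta>) \<le> 1"
    and p: "2 \<le> p" and f: "cc_function f" and g: "cc_function g"
  shows "admissible_symbol f g ((p - 1) * Lp_norm p f * Lp_norm (p / (p - 1)) g)
    (\<lambda>\<xi>. transform_symbol (levy_exponent \<nu> \<mu> \<gamma>) (modulated_exponent \<nu> \<mu> \<phi> \<phi>') (transpose A *v \<xi>) (transpose B *v \<xi>))"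
proof -
  obtain ys where ys: "\<And>n. valid_atoms (ys n)"
    "\<And>\<zeta>. (\<lambda>n. gauss_exponent (ys n) \<zeta>) \<longlonglongrightarrow> (LINT x|\<mu>. complex_of_real ((\<zeta> \<bullet> x)\<^sup>2))"
    "\<And>\<zeta>. (\<lambda>n. gauss_modulated (ys n) \<zeta>) \<longlonglongrightarrow> (LINT x|\<mu>. complex_of_real ((\<zeta> \<bullet> x)\<^sup>2) * \<phi>' x)"
    using gauss_discretisation[OF \<mu> \<phi>'] by blast
  obtain xs \<gamma>' L where xs: "\<And>n::nat. valid_atoms (xs n)" "\<And>n::nat. \<And>\<zeta> \<eta>. L n (\<zeta> + \<eta>) = L n \<zeta> + L n \<eta>"
    "\<And>\<zeta>. (\<lambda>n. poisson_exponent (xs n) \<zeta> + \<i> * complex_of_real (\<zeta> \<bullet> \<gamma>' n)) \<longlonglongrightarrow> (LINT z|\<nu>. levy_kernel \<zeta> z)"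
    "\<And>\<zeta>. (\<lambda>n. poisson_modulated (xs n) \<zeta> + L n \<zeta>) \<longlonglongrightarrow> (LINT z|\<nu>. levy_kernel \<zeta> z * \<phi> z)"
    by (rule levy_discretisation[OF \<nu> \<phi>]) (rule that)
  \<comment> \<open>The compensating drift \<open>\<gamma>' n\<close> and the given
    \<open>\<gamma>\<close> are merged into one drift.\<close>
  let ?\<Psi> = "\<lambda>n \<zeta>. poisson_exponent (xs n) \<zeta> + - 1 / 2 * gauss_exponent (ys n) \<zeta>
    + \<i> * complex_of_real (\<zeta> \<bullet> (\<gamma>' n + \<gamma>))"
  let ?\<Psi>' = "\<lambda>n \<zeta>. poisson_modulated (xs n) \<zeta> + - 1 / 2 * gauss_modulated (ys n) \<zeta> + L n \<zeta>"
  show ?thesis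
  proof (rule admissible_symbol_limit[OF f g])
    show "eventually (\<lambda>n. admissible_symbol f g ((p - 1) * Lp_norm p f * Lp_norm (p / (p - 1)) g)
        (\<lambda>\<xi>. transform_symbol (?\<Psi> n) (?\<Psi>' n) (transpose A *v \<xi>) (transpose B *v \<xi>))) sequentially"
      by (intro always_eventually allI admissible_finite_levy[where S="(*v) A" and T="(*v) B"]
          inner_matrix_vector_transpose p f g xs ys)
    show "(\<lambda>n. transform_symbol (?\<Psi> n) (?\<Psi>' n) (transpose A *v \<xi>) (transpose B *v \<xi>))
        \<longlonglongrightarrow> transform_symbol (levy_exponent \<nu> \<mu> \<gamma>) (modulated_exponent \<nu> \<mu> \<phi> \<phi>') (transpose A *v \<xi>) (transpose B *v \<xi>)" for \<xi>
    proof (rule transform_symbol_tendsto)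
      fix \<zeta> :: "real ^ 'n"
      have "(\<lambda>n. (poisson_exponent (xs n) \<zeta> + \<i> * complex_of_real (\<zeta> \<bullet> \<gamma>' n)) + - 1 / 2 * gauss_exponent (ys n) \<zeta> + \<i> * complex_of_real (\<zeta> \<bullet> \<gamma>))
          \<longlonglongrightarrow> (LINT z|\<nu>. levy_kernel \<zeta> z) + - 1 / 2 * (LINT x|\<mu>. complex_of_real ((\<zeta> \<bullet> x)\<^sup>2)) + \<i> * complex_of_real (\<zeta> \<bullet> \<gamma>)"
        by (intro tendsto_intros xs ys)
      then show "(\<lambda>n. ?\<Psi> n \<zeta>) \<longlonglongrightarrow> levy_exponent \<nu> \<mu> \<gamma> \<zeta>"
        by (simp add: levy_exponent_def inner_add_right algebra_simps)
      have "(\<lambda>n. (poisson_modulated (xs n) \<zeta> + L n \<zeta>) + - 1 / 2 * gauss_modulated (ys n) \<zeta>)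
          \<longlonglongrightarrow> (LINT z|\<nu>. levy_kernel \<zeta> z * \<phi> z) + - 1 / 2 * (LINT x|\<mu>. complex_of_real ((\<zeta> \<bullet> x)\<^sup>2) * \<phi>' x)"
        by (intro tendsto_intros xs ys)
      then show "(\<lambda>n. ?\<Psi>' n \<zeta>) \<longlonglongrightarrow> modulated_exponent \<nu> \<mu> \<phi> \<phi>' \<zeta>"
        by (simp add: modulated_exponent_def algebra_simps)
    qed
  qed
qed

theorem theorem1:
  fixes \<mu> \<nu> :: "(real ^ 'n) measure" and \<gamma> :: "real ^ 'n"
    and \<phi> \<phi>' :: "real ^ 'n \<Rightarrow> complex"
    and \<Psi> \<Psi>' :: "real ^ 'n \<Rightarrow> complex"
    and A B :: "real ^ 'n ^ 'd"
    and m :: "real ^ 'd \<Rightarrow> complex"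
    and p :: real
  assumes "sets \<mu> = sets (restrict_space borel (sphere 0 1))" and "finite_measure \<mu>"
    and "sets \<nu> = sets borel" and "emeasure \<nu> {0} = 0"
    and "(\<integral>\<^sup>+ z. ennreal (min ((norm z)\<^sup>2) 1) \<partial>\<nu>) < \<infinity>"
    and "\<phi> \<in> borel_measurable borel" and "AE z in \<nu>. cmod (\<phi> z) \<le> 1"
    and "\<phi>' \<in> borel_measurable (restrict_space borel (sphere 0 1))"
    and "AE \<theta> in \<mu>. cmod (\<phi>' \<theta>) \<le> 1"
    and "\<And>\<zeta>. \<Psi> \<zeta> = levy_exponent \<nu> \<mu> \<gamma> \<zeta>"
    and "\<And>\<zeta>. \<Psi>' \<zeta> = modulated_exponent \<nu> \<mu> \<phi> \<phi>' \<zeta>"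
    and "\<And>\<xi>. m \<xi> =
      (let a = transpose A *v \<xi>; b = transpose B *v \<xi>
       in exp (\<Psi> b + \<Psi> (- a)) * (\<Psi>' (b - a) - \<Psi>' b - \<Psi>' (- a))
            * exp_quotient (\<Psi> (b - a) - \<Psi> b - \<Psi> (- a)))"
    and "1 < p"
  shows "Lp_operator_norm p (fourier_multiplier m) \<le> ennreal (max (p - 1) (1 / (p - 1)))"
proof -
  let ?q = "p / (p - 1)" and ?C = "max (p - 1) (1 / (p - 1))"
  let ?m = "\<lambda>A B \<xi>. transform_symbol (levy_exponent \<nu> \<mu> \<gamma>) (modulated_exponent \<nu> \<mu> \<phi> \<phi>')
    (transpose A *v \<xi>) (transpose B *v \<xi>)"
  have m: "m = ?m A B"
    using assms(10-12) by (simp add: fun_eq_iff transform_symbol_def Let_def)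
  note admissible = admissible_levy[OF assms(1-3,5-9)]
  have bound: "cmod (spectral_form f g m) \<le> ?C * Lp_norm p f * Lp_norm ?q g"
    if f: "cc_function f" and g: "cc_function g" for f g :: "real ^ 'd \<Rightarrow> complex"
  proof (cases "2 \<le> p")
    case True
    have "cmod (spectral_form f g m) \<le> (p - 1) * Lp_norm p f * Lp_norm ?q g"
      using admissible[OF True f g] unfolding m admissible_symbol_def by blast
    also have "\<dots> \<le> ?C * Lp_norm p f * Lp_norm ?q g"
      by (intro mult_right_mono Lp_norm_nonneg) auto
    finally show ?thesis .
  next
    case False
    \<comment> \<open>The estimate is applied to \<open>(g, f)\<close> with exponent
      \<open>?q\<close>; its constant is \<open>?q - 1 = 1 / (p - 1)\<close>, and the exponent
      conjugate to \<open>?q\<close> is \<open>p\<close>.\<close>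
    have q: "2 \<le> ?q" using False \<open>1 < p\<close> by (simp add: field_simps)
    have adm: "admissible_symbol g f ((?q - 1) * Lp_norm ?q g * Lp_norm (?q / (?q - 1)) f) (?m B A)"
      by (rule admissible[OF q g f])
    have "?m B A (- \<xi>) = m \<xi>" for \<xi>
      by (simp only: m transform_symbol_swap transpose_matrix_uminus)
    then have "spectral_form f g m = spectral_form g f (?m B A)"
      using spectral_form_swap[OF f g, of "?m B A"] adm by (simp add: admissible_symbol_def)
    then have "cmod (spectral_form f g m) \<le> (?q - 1) * Lp_norm ?q g * Lp_norm (?q / (?q - 1)) f"
      using adm by (simp only: admissible_symbol_def)
    also have "\<dots> = 1 / (p - 1) * Lp_norm p f * Lp_norm ?q g"
      unfolding conjugate_exponent(4)[OF \<open>1 < p\<close>] conjugate_exponent(3)[OF \<open>1 < p\<close>] by simp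
    also have "\<dots> \<le> ?C * Lp_norm p f * Lp_norm ?q g"
      by (intro mult_right_mono Lp_norm_nonneg) auto
    finally show ?thesis .
  qed
  show ?thesis
    unfolding Lp_operator_norm_def
  proof (intro Inf_lower CollectI allI impI)
    fix f g :: "real ^ 'd \<Rightarrow> complex"
    assume fg: "test_function f" "test_function g"
    have "cmod (dual_form (fourier_multiplier m) f g) \<le> ?C * Lp_norm p f * Lp_norm ?q g"
      using fg by (intro dual_form_bound bound test_function_cc)
    moreover have "0 \<le> ?C" using \<open>1 < p\<close> by simp
    ultimately show "ennreal (cmod (dual_form (fourier_multiplier m) f g))
        \<le> ennreal ?C * ennreal (Lp_norm p f) * ennreal (Lp_norm ?q g)"
      by (simp add: ennreal_mult[symmetric] Lp_norm_nonneg ennreal_leI)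
  qed
qed

end
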